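(* Let $G$ be one of $\mathrm{GL}_{2n},\mathrm{SL}_{2n},\mathrm{GO}_{2n},\mathrm{O}_{2n},\mathrm{GSp}_{2n},\mathrm{Sp}_{2n}$ over $\mathbb F_q$, with Siegel parabolic subgroup $P$. For any character $\chi\colon P\to\mathbb C^\times$, the representation $\operatorname{Ind}_P^G\chi$ is multiplicity-free.
   Context: $q$ is an odd prime power with $3\nmid q$, and $n\ge1$. Set $\varepsilon=+1$ if $G\in\{\mathrm{GO}_{2n},\mathrm{O}_{2n}\}$ and $\varepsilon=-1$ otherwise, and $J=\begin{bmatrix}0&\varepsilon1_n\\1_n&0\end{bmatrix}$. The groups $\mathrm{GO}_{2n}$ (with $\varepsilon=1$) and $\mathrm{GSp}_{2n}$ (with $\varepsilon=-1$) consist of $g\in\mathrm{GL}_{2n}(\mathbb F_q)$ with $g^\intercal Jg=\lambda J$ for some $\lambda\in\mathbb F_q^\times$; $\mathrm{O}_{2n}$ and $\mathrm{Sp}_{2n}$ are the subgroups with $\lambda=1$. $P=\left\{\begin{bmatrix}A&B\\0&D\end{bmatrix}\in G\right\}$ with $n\times n$ blocks. $\operatorname{Ind}_P^G\chi$ is the space of functions $f\colon G\to\mathbb C$ with $f(pg)=\chi(p)f(g)$ for $p\in P$, $g\in G$, with $G$ acting by right translation. *)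

theory Defs
  imports
    "HOL-Library.Cardinality"
    "HOL-Library.Function_Algebras"
    "HOL-Number_Theory.Prime_Powers"
    "HOL-Algebra.Coset"
    "Jordan_Normal_Form.Determinant"
begin

section \<open>Representations on complex subspaces\<close>

text \<open>
  A representation of \<open>G\<close> lives on a subspace \<open>V\<close> of an ambient complex vector space; only the
  values of \<open>\<rho> g v\<close> with \<open>g \<in> carrier G\<close> and \<open>v \<in> V\<close> are relevant.
\<close>

locale group_rep = group G + vector_space scale
  for G (structure) and scale :: "complex \<Rightarrow> 'v::ab_group_add \<Rightarrow> 'v" +
  fixes V :: "'v set" and \<rho> :: "'g \<Rightarrow> 'v \<Rightarrow> 'v"
  constrains G :: "('g, 'm) monoid_scheme"
  assumes subspace_V: "subspace V"
    and act_closed: "\<lbrakk>g \<in> carrier G; v \<in> V\<rbrakk> \<Longrightarrow> \<rho> g v \<in> V"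
    and act_add: "\<lbrakk>g \<in> carrier G; v \<in> V; w \<in> V\<rbrakk> \<Longrightarrow> \<rho> g (v + w) = \<rho> g v + \<rho> g w"
    and act_scale: "\<lbrakk>g \<in> carrier G; v \<in> V\<rbrakk> \<Longrightarrow> \<rho> g (scale c v) = scale c (\<rho> g v)"
    and act_one: "v \<in> V \<Longrightarrow> \<rho> \<one> v = v"
    and act_mult: "\<lbrakk>g \<in> carrier G; h \<in> carrier G; v \<in> V\<rbrakk> \<Longrightarrow> \<rho> (g \<otimes> h) v = \<rho> g (\<rho> h v)"

definition irreducible_rep ::
  "('g, 'm) monoid_scheme \<Rightarrow> (complex \<Rightarrow> 'v::ab_group_add \<Rightarrow> 'v) \<Rightarrow> 'v set \<Rightarrow>
    ('g \<Rightarrow> 'v \<Rightarrow> 'v) \<Rightarrow> bool" where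
  "irreducible_rep G scale V \<rho> \<longleftrightarrow>
     group_rep G scale V \<rho> \<and> V \<noteq> {0} \<and>
     (\<forall>W\<subseteq>V. group_rep G scale W \<rho> \<longrightarrow> W = {0} \<or> W = V)"

definition isomorphic_subreps ::
  "('g, 'm) monoid_scheme \<Rightarrow> (complex \<Rightarrow> 'v::ab_group_add \<Rightarrow> 'v) \<Rightarrow>
    ('g \<Rightarrow> 'v \<Rightarrow> 'v) \<Rightarrow> 'v set \<Rightarrow> 'v set \<Rightarrow> bool" where
  "isomorphic_subreps G scale \<rho> V W \<longleftrightarrow>
     (\<exists>T. bij_betw T V W \<and>
       (\<forall>v\<in>V. \<forall>w\<in>V. T (v + w) = T v + T w) \<and>
       (\<forall>c. \<forall>v\<in>V. T (scale c v) = scale c (T v)) \<and>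
       (\<forall>g\<in>carrier G. \<forall>v\<in>V. T (\<rho> g v) = \<rho> g (T v)))"

text \<open>The bijection says that every vector of \<open>V\<close> is uniquely a sum of one vector from each
  member of \<open>\<W>\<close>, so that \<open>V\<close> is the internal direct sum of the members of \<open>\<W>\<close>.\<close>

definition internal_direct_sum :: "'v::comm_monoid_add set \<Rightarrow> 'v set set \<Rightarrow> bool" where
  "internal_direct_sum V \<W> \<longleftrightarrow>
     bij_betw (\<lambda>w. \<Sum>W\<in>\<W>. w W) (\<Pi>\<^sub>E W\<in>\<W>. W) V"

definition multiplicity_free ::
  "('g, 'm) monoid_scheme \<Rightarrow> (complex \<Rightarrow> 'v::ab_group_add \<Rightarrow> 'v) \<Rightarrow> 'v set \<Rightarrow>
    ('g \<Rightarrow> 'v \<Rightarrow> 'v) \<Rightarrow> bool" where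
  "multiplicity_free G scale V \<rho> \<longleftrightarrow>
     group_rep G scale V \<rho> \<and>
     (\<exists>\<W>. finite \<W> \<and> (\<forall>W\<in>\<W>. irreducible_rep G scale W \<rho>) \<and>
       internal_direct_sum V \<W> \<and>
       (\<forall>W\<in>\<W>. \<forall>W'\<in>\<W>. W \<noteq> W' \<longrightarrow> \<not> isomorphic_subreps G scale \<rho> W W'))"


section \<open>Induced representations\<close>

definition complex_units :: "complex monoid" where
  "complex_units = \<lparr>carrier = UNIV - {0}, monoid.mult = (*), one = 1\<rparr>"

text \<open>Functions on \<open>G\<close> are represented by functions on the whole type that vanish outside
  \<open>carrier G\<close>; with this convention they form a subspace under pointwise operations.\<close>

definition fun_scale :: "complex \<Rightarrow> ('g \<Rightarrow> complex) \<Rightarrow> 'g \<Rightarrow> complex" where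
  "fun_scale c f = (\<lambda>g. c * f g)"

definition induced_space ::
  "('g, 'm) monoid_scheme \<Rightarrow> 'g set \<Rightarrow> ('g \<Rightarrow> complex) \<Rightarrow> ('g \<Rightarrow> complex) set" where
  "induced_space G P \<chi> =
     {f. (\<forall>p\<in>P. \<forall>g\<in>carrier G. f (p \<otimes>\<^bsub>G\<^esub> g) = \<chi> p * f g) \<and> (\<forall>g. g \<notin> carrier G \<longrightarrow> f g = 0)}"

definition right_translation ::
  "('g, 'm) monoid_scheme \<Rightarrow> 'g \<Rightarrow> ('g \<Rightarrow> complex) \<Rightarrow> 'g \<Rightarrow> complex" where
  "right_translation G x f = (\<lambda>g. if g \<in> carrier G then f (g \<otimes>\<^bsub>G\<^esub> x) else 0)"


section \<open>The classical groups and their Siegel parabolic subgroups\<close>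

datatype group_kind = KGL | KSL | KGO | KO | KGSp | KSp

definition form_sign :: "group_kind \<Rightarrow> 'a::ring_1" where
  "form_sign k = (if k \<in> {KGO, KO} then 1 else -1)"

definition form_mat :: "group_kind \<Rightarrow> nat \<Rightarrow> 'a::ring_1 mat" where
  "form_mat k n = four_block_mat (0\<^sub>m n n) (form_sign k \<cdot>\<^sub>m 1\<^sub>m n) (1\<^sub>m n) (0\<^sub>m n n)"

definition GL_set :: "nat \<Rightarrow> 'a::field mat set" where
  "GL_set m = {g \<in> carrier_mat m m. invertible_mat g}"

fun classical_set :: "group_kind \<Rightarrow> nat \<Rightarrow> 'a::field mat set" where
  "classical_set KGL n = GL_set (2 * n)"
| "classical_set KSL n = {g \<in> GL_set (2 * n). det g = 1}"
| "classical_set KGO n = {g \<in> GL_set (2 * n).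
     \<exists>\<mu>. \<mu> \<noteq> 0 \<and> transpose_mat g * form_mat KGO n * g = \<mu> \<cdot>\<^sub>m form_mat KGO n}"
| "classical_set KO n = {g \<in> GL_set (2 * n).
     transpose_mat g * form_mat KO n * g = form_mat KO n}"
| "classical_set KGSp n = {g \<in> GL_set (2 * n).
     \<exists>\<mu>. \<mu> \<noteq> 0 \<and> transpose_mat g * form_mat KGSp n * g = \<mu> \<cdot>\<^sub>m form_mat KGSp n}"
| "classical_set KSp n = {g \<in> GL_set (2 * n).
     transpose_mat g * form_mat KSp n * g = form_mat KSp n}"

definition classical_group :: "group_kind \<Rightarrow> nat \<Rightarrow> 'a::field mat monoid" where
  "classical_group k n =
     \<lparr>carrier = classical_set k n, monoid.mult = (*), one = 1\<^sub>m (2 * n)\<rparr>"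

definition siegel_parabolic :: "group_kind \<Rightarrow> nat \<Rightarrow> 'a::field mat set" where
  "siegel_parabolic k n =
     {g \<in> classical_set k n. \<exists>A B D.
        A \<in> carrier_mat n n \<and> B \<in> carrier_mat n n \<and> D \<in> carrier_mat n n \<and>
        g = four_block_mat A B (0\<^sub>m n n) D}"


section \<open>Basic facts\<close>

lemma form_mat_carrier [simp]: "form_mat k n \<in> carrier_mat (2 * n) (2 * n)"
  unfolding form_mat_def by (simp add: mult_2)

lemma GL_inverse:
  assumes "g \<in> GL_set m"
  obtains h where "h \<in> GL_set m" "h * g = 1\<^sub>m m" "g * h = 1\<^sub>m m"
proof -
  have g: "g \<in> carrier_mat m m" and "invertible_mat g" using assms by (auto simp: GL_set_def)
  then obtain h where h: "g * h = 1\<^sub>m m" "h * g = 1\<^sub>m (dim_row h)"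
    by (auto simp: invertible_mat_def inverts_mat_def)
  have "dim_col h = m" using arg_cong[OF h(1), of dim_col] by simp
  moreover have "dim_row h = m" using arg_cong[OF h(2), of dim_col] g by simp
  ultimately have hc: "h \<in> carrier_mat m m" by auto
  then have "h * g = 1\<^sub>m m" using h by simp
  moreover have "h \<in> GL_set m" using hc h g
    by (auto simp: GL_set_def invertible_mat_def inverts_mat_def intro!: exI[of _ g])
  ultimately show thesis using h that by blast
qed

lemma GL_mult:
  assumes "g \<in> GL_set m" "h \<in> GL_set m"
  shows "g * h \<in> GL_set (m::nat)"
proof -
  obtain g' h' where i: "g' \<in> GL_set m" "g' * g = 1\<^sub>m m" "g * g' = 1\<^sub>m m"
     "h' \<in> GL_set m" "h' * h = 1\<^sub>m m" "h * h' = 1\<^sub>m m"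
    using GL_inverse[OF assms(1)] GL_inverse[OF assms(2)] by metis
  have c: "g \<in> carrier_mat m m" "h \<in> carrier_mat m m" "g' \<in> carrier_mat m m" "h' \<in> carrier_mat m m"
    using assms i by (auto simp: GL_set_def)
  have "(g * h) * (h' * g') = g * (h * h') * g'"
    using c by (simp add: assoc_mult_mat[of _ m m _ m _ m])
  moreover have "(h' * g') * (g * h) = h' * (g' * g) * h"
    using c by (simp add: assoc_mult_mat[of _ m m _ m _ m])
  ultimately show ?thesis using c i
    by (auto simp: GL_set_def invertible_mat_def inverts_mat_def intro!: exI[of _ "h' * g'"])
qed

lemma GL_one: "1\<^sub>m m \<in> GL_set m"
  by (auto simp: GL_set_def invertible_mat_def inverts_mat_def intro!: exI[of _ "1\<^sub>m m"])

lemma similitude_mult: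
  fixes J :: "'a::field mat"
  assumes c: "J \<in> carrier_mat m m" "g \<in> carrier_mat m m" "h \<in> carrier_mat m m"
    and e: "transpose_mat g * J * g = a \<cdot>\<^sub>m J" "transpose_mat h * J * h = b \<cdot>\<^sub>m J"
  shows "transpose_mat (g * h) * J * (g * h) = (a * b) \<cdot>\<^sub>m J"
proof -
  have "transpose_mat (g * h) * J * (g * h) = transpose_mat h * (transpose_mat g * J * g) * h"
    using c by (simp add: transpose_mult[of _ m m _ m] assoc_mult_mat[of _ m m _ m _ m])
  also have "\<dots> = a \<cdot>\<^sub>m (transpose_mat h * J * h)"
    using c e(1) by (simp add: mult_smult_distrib[of _ m m] mult_smult_assoc_mat[of _ m m])
  also have "\<dots> = (a * b) \<cdot>\<^sub>m J" unfolding e(2) by (auto intro!: eq_matI)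
  finally show ?thesis .
qed

lemma similitude_inverse:
  fixes J :: "'a::field mat"
  assumes c: "J \<in> carrier_mat m m" "g \<in> carrier_mat m m" "h \<in> carrier_mat m m"
    and i: "g * h = 1\<^sub>m m" and e: "transpose_mat g * J * g = a \<cdot>\<^sub>m J" and "a \<noteq> 0"
  shows "transpose_mat h * J * h = inverse a \<cdot>\<^sub>m J"
proof -
  have "transpose_mat h * (transpose_mat g * J * g) * h = transpose_mat (g * h) * J * (g * h)"
    using c by (simp add: transpose_mult[of _ m m _ m] assoc_mult_mat[of _ m m _ m _ m])
  then have "a \<cdot>\<^sub>m (transpose_mat h * J * h) = J"
    using c e i by (simp add: mult_smult_distrib[of _ m m] mult_smult_assoc_mat[of _ m m])
  then have "inverse a \<cdot>\<^sub>m (a \<cdot>\<^sub>m (transpose_mat h * J * h)) = inverse a \<cdot>\<^sub>m J" by simp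
  moreover have "inverse a \<cdot>\<^sub>m (a \<cdot>\<^sub>m X) = X" for X :: "'a mat"
    using \<open>a \<noteq> 0\<close> by (auto intro!: eq_matI)
  ultimately show ?thesis by simp
qed

lemma one_smult_mat [simp]: "(1::'a::field) \<cdot>\<^sub>m X = X"
  by (auto intro!: eq_matI)

lemma classical_set_GL: "g \<in> classical_set k n \<Longrightarrow> g \<in> GL_set (2 * n)"
  by (cases k) auto

lemma classical_set_one: "1\<^sub>m (2 * n) \<in> classical_set k n"
proof -
  have "transpose_mat (1\<^sub>m (2 * n)) * form_mat k n * 1\<^sub>m (2 * n) = 1 \<cdot>\<^sub>m (form_mat k n :: 'a::field mat)" for k
    by (simp add: left_mult_one_mat[OF form_mat_carrier] right_mult_one_mat[OF form_mat_carrier])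
  then show ?thesis by (cases k) (auto simp: GL_one intro!: exI[of _ 1])
qed

lemma classical_set_mult:
  assumes "g \<in> classical_set k n" "h \<in> classical_set k n"
  shows "g * h \<in> classical_set k n"
proof -
  have gl: "g \<in> GL_set (2 * n)" "h \<in> GL_set (2 * n)" using assms classical_set_GL by blast+
  then have c: "g \<in> carrier_mat (2 * n) (2 * n)" "h \<in> carrier_mat (2 * n) (2 * n)"
    by (auto simp: GL_set_def)
  note s = similitude_mult[OF form_mat_carrier c]
  show ?thesis
    using assms GL_mult[OF gl] det_mult[OF c] s[where a = 1 and b = 1]
    by (cases k) (auto, (metis s no_zero_divisors)+)
qed

lemma classical_set_inverse:
  assumes "g \<in> classical_set k n"
  shows "\<exists>h\<in>classical_set k n. h * g = 1\<^sub>m (2 * n)"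
proof -
  have gl: "g \<in> GL_set (2 * n)" using assms classical_set_GL by blast
  then obtain h where h: "h \<in> GL_set (2 * n)" "h * g = 1\<^sub>m (2 * n)" "g * h = 1\<^sub>m (2 * n)"
    by (rule GL_inverse)
  have c: "g \<in> carrier_mat (2 * n) (2 * n)" "h \<in> carrier_mat (2 * n) (2 * n)"
    using gl h by (auto simp: GL_set_def)
  note s = similitude_inverse[OF form_mat_carrier c h(3)]
  have "det g * det h = 1" using det_mult[OF c] h(3) by simp
  then have "h \<in> classical_set k n"
    using assms h(1) s[where a = 1]
    by (cases k) (auto, (metis s nonzero_imp_inverse_nonzero)+)
  then show ?thesis using h(2) by blast
qed

lemma classical_set_carrier: "g \<in> classical_set k n \<Longrightarrow> g \<in> carrier_mat (2 * n) (2 * n)"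
  using classical_set_GL by (auto simp: GL_set_def)

lemma group_classical_group: "group (classical_group k n)"
proof (rule groupI)
  fix x y z :: "'a mat"
  assume "x \<in> carrier (classical_group k n)" "y \<in> carrier (classical_group k n)"
    "z \<in> carrier (classical_group k n)"
  then have "x \<in> carrier_mat (2 * n) (2 * n)" "y \<in> carrier_mat (2 * n) (2 * n)"
    "z \<in> carrier_mat (2 * n) (2 * n)"
    using classical_set_carrier by (auto simp: classical_group_def)
  then show "x \<otimes>\<^bsub>classical_group k n\<^esub> y \<otimes>\<^bsub>classical_group k n\<^esub> z =
    x \<otimes>\<^bsub>classical_group k n\<^esub> (y \<otimes>\<^bsub>classical_group k n\<^esub> z)"
    by (simp add: classical_group_def assoc_mult_mat[of _ "2*n" "2*n" _ "2*n" _ "2*n"])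
next
  fix x :: "'a mat"
  assume "x \<in> carrier (classical_group k n)"
  then show "\<one>\<^bsub>classical_group k n\<^esub> \<otimes>\<^bsub>classical_group k n\<^esub> x = x"
    using classical_set_carrier[of x k n] by (simp add: classical_group_def)
qed (auto simp: classical_group_def classical_set_one classical_set_mult classical_set_inverse)

lemma group_rep_induced_space:
  assumes "group G" and P: "P \<subseteq> carrier G"
  shows "group_rep G fun_scale (induced_space G P \<chi>) (right_translation G)"
proof -
  interpret group G by fact
  interpret vector_space fun_scale
    by unfold_locales (auto simp: fun_scale_def fun_eq_iff algebra_simps)
  show ?thesis
  proof unfold_locales
    show "subspace (induced_space G P \<chi>)"
      by (auto simp: subspace_def induced_space_def fun_scale_def algebra_simps)
  next
    fix g v assume "g \<in> carrier G" "v \<in> induced_space G P \<chi>"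
    then show "right_translation G g v \<in> induced_space G P \<chi>"
      using P by (auto simp: induced_space_def right_translation_def m_assoc subset_iff)
  qed (auto simp: induced_space_def right_translation_def fun_scale_def fun_eq_iff m_assoc)
qed

end

theory Submission
  imports Defs
begin

text \<open>A finite-dimensional complex representation of a finite group is multiplicity-free as soon as its
  equivariant endomorphisms commute: it splits into irreducibles by Maschke's theorem, and an
  isomorphism between two different summands would yield two endomorphisms that do not commute
  (\<open>multiplicity_free_if_endos_commute\<close>).

  An endomorphism \<open>T\<close> of the representation induced from \<open>\<chi>\<close> is convolution with one function
  \<open>\<phi> = T delta\<close> on \<open>G\<close>, where \<open>delta\<close> is \<open>\<chi>\<close> on \<open>P\<close> and \<open>0\<close> elsewhere, and
  \<open>\<phi> (p g p') = \<chi> p \<chi> p' \<phi> g\<close>. If an anti-automorphism \<open>\<tau>\<close> of \<open>G\<close> fixes every such \<open>\<phi>\<close>, then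
  convolution commutes; this is Gelfand's trick. It suffices that \<open>\<tau>\<close> preserves \<open>P\<close> and \<open>\<chi>\<close> and fixes
  representatives of the double cosets of \<open>P\<close>. The trick survives a twist (\<open>gelfand_trick\<close>): it is
  enough that \<open>\<chi> (\<tau> p) * \<psi> p = \<chi> p\<close> on \<open>P\<close> for a character \<open>\<psi>\<close> of \<open>G\<close> that is \<open>1\<close> on the representatives.

  Here \<open>\<tau>\<close> is \<open>flip\<close>, which sends the matrix with blocks \<open>A, B, C, D\<close> to the one with blocks
  \<open>D\<^sup>T, B\<^sup>T, C\<^sup>T, A\<^sup>T\<close>, and the representatives are the matrices \<open>weyl k n I\<close>, which exchange the two
  basis vectors with index \<open>i\<close> for each \<open>i \<in> I\<close> (\<open>siegel_double_cosets\<close>). In general \<open>flip\<close> does not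
  preserve \<open>\<chi>\<close>, since it exchanges the two diagonal blocks. There are two cases. Either every \<open>\<phi>\<close>
  vanishes off \<open>P\<close>, and then all endomorphisms are scalars. Or some \<open>\<phi>\<close> is nonzero at some
  \<open>w = weyl k n I\<close> outside \<open>P\<close>; then \<open>\<chi> p' = \<chi> p\<close> whenever \<open>w p = p' w\<close>, and this condition is strong
  enough to produce the twist \<open>\<psi>\<close> (\<open>exists_twist\<close>).

  The last step rests on how little of \<open>P\<close> a character sees. The field has more than three elements, so
  some \<open>a \<noteq> 0\<close> has \<open>a\<^sup>2 \<noteq> 1\<close>, and conjugation by block scalars shows that \<open>\<chi>\<close> is trivial on the
  unipotent radical. Elementary matrices are commutators with dilations, so \<open>\<chi>\<close> sees a block of the
  Levi subgroup only through its determinant, which can be placed at any chosen diagonal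
  position \<open>l\<close>. For \<open>l \<in> I\<close>, conjugation by \<open>w\<close> exchanges the entries at \<open>l\<close> of the two blocks,
  exactly as \<open>flip\<close> does. What remains in the similitude groups are the elements with blocks \<open>1\<close> and
  \<open>\<mu> 1\<close>; on these \<open>\<chi>\<close> and its flip differ by a character of the multiplier \<open>\<mu>\<close>, which is the twist.\<close>

section \<open>Complete reducibility\<close>

definition equivariant_endo ::
  "('g, 'm) monoid_scheme \<Rightarrow> (complex \<Rightarrow> 'v::ab_group_add \<Rightarrow> 'v) \<Rightarrow> 'v set \<Rightarrow>
    ('g \<Rightarrow> 'v \<Rightarrow> 'v) \<Rightarrow> ('v \<Rightarrow> 'v) \<Rightarrow> bool" where
  "equivariant_endo G scale V \<rho> T \<longleftrightarrow>
     (\<forall>v\<in>V. T v \<in> V) \<and> (\<forall>v\<in>V. \<forall>w\<in>V. T (v + w) = T v + T w) \<and>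
     (\<forall>c. \<forall>v\<in>V. T (scale c v) = scale c (T v)) \<and>
     (\<forall>g\<in>carrier G. \<forall>v\<in>V. T (\<rho> g v) = \<rho> g (T v))"

context group_rep
begin

lemma zero_in_V: "0 \<in> V"
  using subspace_V by (rule subspace_0)

lemma act_zero: "g \<in> carrier G \<Longrightarrow> \<rho> g 0 = 0"
  using act_scale[of g 0 0] zero_in_V by simp

lemma act_sum: "g \<in> carrier G \<Longrightarrow> (\<And>i. i \<in> I \<Longrightarrow> f i \<in> V) \<Longrightarrow> \<rho> g (\<Sum>i\<in>I. f i) = (\<Sum>i\<in>I. \<rho> g (f i))"
  by (induction I rule: infinite_finite_induct) 
     (auto simp: act_zero act_add subspace_sum[OF subspace_V])

lemma group_rep_subspace:
  assumes "subspace W" "W \<subseteq> V" "\<And>g w. g \<in> carrier G \<Longrightarrow> w \<in> W \<Longrightarrow> \<rho> g w \<in> W"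
  shows "group_rep G scale W \<rho>"
  by unfold_locales (use assms in \<open>auto simp: act_add act_scale act_one act_mult subset_iff\<close>)

lemma equivariant_endo_sum:
  assumes "equivariant_endo G scale V \<rho> T" "\<And>i. i \<in> I \<Longrightarrow> f i \<in> V"
  shows "T (\<Sum>i\<in>I. f i) = (\<Sum>i\<in>I. T (f i))"
proof -
  have "T (scale 0 0) = scale 0 (T 0)"
    using assms(1) zero_in_V unfolding equivariant_endo_def by blast
  then have T0: "T 0 = 0" by simp
  show ?thesis
    using assms(2)
  proof (induction I rule: infinite_finite_induct)
    case (insert x F)
    then have "f x \<in> V" "sum f F \<in> V" by (auto intro: subspace_sum[OF subspace_V])
    then show ?case using insert assms(1) by (simp add: equivariant_endo_def)
  qed (use T0 in auto)
qed

text \<open>Maschke's theorem: averaging any linear projection onto \<open>W\<close> over the group makes its kernel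
  an invariant complement.\<close>

lemma invariant_complement:
  assumes fin: "finite (carrier G)" and W: "group_rep G scale W \<rho>" "W \<subseteq> V"
  obtains W' where "group_rep G scale W' \<rho>" "W' \<subseteq> V" "W \<inter> W' = {0}"
    "\<And>v. v \<in> V \<Longrightarrow> \<exists>w\<in>W. \<exists>w'\<in>W'. v = w + w'"
proof -
  interpret W: group_rep G scale W \<rho> by fact
  interpret vector_space_pair scale scale ..
  obtain B where B: "B \<subseteq> W" "independent B" "W \<subseteq> span B"
    using basis_exists[of W] by metis
  have spanB: "span B = W" using B W.subspace_V by (simp add: span_subspace)
  define \<pi> where "\<pi> = construct B (\<lambda>b. b)"
  interpret \<pi>: Vector_Spaces.linear scale scale \<pi>
    unfolding \<pi>_def by (rule linear_construct) fact
  have \<pi>_W: "\<pi> v \<in> W" for v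
    using construct_in_span[OF B(2), of "\<lambda>b. b" v] spanB by (simp add: \<pi>_def)
  have \<pi>_id: "\<pi> w = w" if "w \<in> W" for w
  proof -
    have "Vector_Spaces.linear scale scale (\<lambda>x. x)" by (rule linear_ident)
    from linear_eq_on[OF \<pi>.linear_axioms this, of w B] that spanB show ?thesis
      using construct_basis[OF B(2)] by (simp add: \<pi>_def)
  qed
  define N :: complex where "N = of_nat (card (carrier G))"
  have "N \<noteq> 0" using fin one_closed by (auto simp: N_def card_eq_0_iff)
  define avg where "avg v = scale (1 / N) (\<Sum>g\<in>carrier G. \<rho> (inv g) (\<pi> (\<rho> g v)))" for v
  have avg_W: "avg v \<in> W" for v
    unfolding avg_def by (intro W.subspace_V[THEN subspace_scale] subspace_sum[OF W.subspace_V] W.act_closed \<pi>_W) auto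
  have avg_add: "avg (v + w) = avg v + avg w" if "v \<in> V" "w \<in> V" for v w
    by (simp add: avg_def act_add that \<pi>.add W.act_add \<pi>_W sum.distrib scale_right_distrib cong: sum.cong)
  have avg_scale: "avg (scale c v) = scale c (avg v)" if "v \<in> V" for c v
    by (simp add: avg_def act_scale that \<pi>.scale W.act_scale \<pi>_W scale_sum_right mult.commute cong: sum.cong)
  have avg_act: "avg (\<rho> h v) = \<rho> h (avg v)" if "h \<in> carrier G" "v \<in> V" for h v
  proof -
    have "(\<Sum>g\<in>carrier G. \<rho> (inv g) (\<pi> (\<rho> g (\<rho> h v)))) =
          (\<Sum>g\<in>carrier G. \<rho> (h \<otimes> inv g) (\<pi> (\<rho> g v)))"
    proof (rule sum.reindex_bij_witness[where i="\<lambda>g. g \<otimes> inv h" and j="\<lambda>g. g \<otimes> h"])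
      fix g assume g: "g \<in> carrier G"
      show "\<rho> (h \<otimes> inv (g \<otimes> h)) (\<pi> (\<rho> (g \<otimes> h) v)) = \<rho> (inv g) (\<pi> (\<rho> g (\<rho> h v)))"
        using g that by (simp add: inv_mult_group m_assoc[symmetric] act_mult)
    qed (use that in \<open>auto simp: m_assoc\<close>)
    also have "\<dots> = \<rho> h (\<Sum>g\<in>carrier G. \<rho> (inv g) (\<pi> (\<rho> g v)))"
      using that by (subst W.act_sum) (auto intro!: W.act_closed \<pi>_W sum.cong W.act_mult)
    finally show ?thesis
      unfolding avg_def using that
      by (subst W.act_scale) (auto intro!: subspace_sum[OF W.subspace_V] W.act_closed \<pi>_W)
  qed
  have avg_id: "avg w = w" if "w \<in> W" for w
  proof -
    have "\<rho> (inv g) (\<pi> (\<rho> g w)) = w" if g: "g \<in> carrier G" for g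
      using g \<open>w \<in> W\<close> by (simp add: \<pi>_id W.act_closed W.act_mult[symmetric] W.act_one)
    then have "avg w = scale (1 / N) (\<Sum>g\<in>carrier G. w)" by (simp add: avg_def)
    also have "\<dots> = w" using \<open>N \<noteq> 0\<close>
      by (simp add: sum_constant_scale N_def)
    finally show ?thesis .
  qed
  define W' where "W' = {v \<in> V. avg v = 0}"
  have "subspace W'"
    unfolding subspace_def W'_def
    using subspace_V avg_id[of 0] W.zero_in_V avg_add avg_scale by (auto simp: subspace_def)
  then have 1: "group_rep G scale W' \<rho>"
    by (rule group_rep_subspace) (auto simp: W'_def avg_act act_closed act_zero)
  have 2: "W \<inter> W' = {0}"
    using W.zero_in_V avg_id by (auto simp: W'_def zero_in_V)
  have 3: "\<exists>w\<in>W. \<exists>w'\<in>W'. v = w + w'" if "v \<in> V" for v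
  proof (intro bexI)
    have "avg v \<in> V" using avg_W W(2) by auto
    then have m: "scale (-1) (avg v) \<in> V" by (rule subspace_scale[OF subspace_V])
    have "avg (v + scale (-1) (avg v)) = 0"
      unfolding avg_add[OF that m] avg_scale[OF \<open>avg v \<in> V\<close>] avg_id[OF avg_W] by simp
    then show "v + scale (-1) (avg v) \<in> W'"
      unfolding W'_def using subspace_add[OF subspace_V that m] by blast
  qed (use avg_W in auto)
  show thesis using that[OF 1 _ 2 3] by (auto simp: W'_def)
qed

text \<open>The ambient space may be infinite-dimensional; below a finite spanning set, dimension is still
  strictly monotone.\<close>

lemma dim_psubset_finite_span:
  assumes "subspace W" "W \<subset> U" "U \<subseteq> span B" "finite B"
  shows "dim W < dim U"
proof -
  obtain C where C: "C \<subseteq> W" "independent C" "W \<subseteq> span C" "card C = dim W"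
    using basis_exists[of W] by metis
  obtain D where D: "C \<subseteq> D" "D \<subseteq> U" "independent D" "U \<subseteq> span D"
    using maximal_independent_subset_extend[of C U] C assms by blast
  have "finite D" using independent_span_bound[OF assms(4) D(3)] D(2) assms(3) by auto
  moreover have "C \<noteq> D"
    using C D assms span_minimal[of C W] by auto
  ultimately have "card C < card D" using D by (auto intro: psubset_card_mono)
  then show ?thesis using C(4) basis_card_eq_dim[OF D(2,4,3)] by simp
qed

end

lemma bij_betw_iff_ex1: "bij_betw f A B \<longleftrightarrow> (\<forall>a\<in>A. f a \<in> B) \<and> (\<forall>b\<in>B. \<exists>!a. a \<in> A \<and> f a = b)"
  unfolding bij_betw_def inj_on_def by blast

lemma internal_direct_sumI:
  assumes "\<And>w. w \<in> (\<Pi>\<^sub>E W\<in>\<W>. W) \<Longrightarrow> (\<Sum>W\<in>\<W>. w W) \<in> V"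
    and "\<And>v. v \<in> V \<Longrightarrow> \<exists>!w. w \<in> (\<Pi>\<^sub>E W\<in>\<W>. W) \<and> (\<Sum>W\<in>\<W>. w W) = v"
  shows "internal_direct_sum V \<W>"
  using assms by (simp add: internal_direct_sum_def bij_betw_iff_ex1)

lemma internal_direct_sumD:
  assumes "internal_direct_sum V \<W>"
  shows "w \<in> (\<Pi>\<^sub>E W\<in>\<W>. W) \<Longrightarrow> (\<Sum>W\<in>\<W>. w W) \<in> V"
    and "v \<in> V \<Longrightarrow> \<exists>!w. w \<in> (\<Pi>\<^sub>E W\<in>\<W>. W) \<and> (\<Sum>W\<in>\<W>. w W) = v"
    and "w \<in> (\<Pi>\<^sub>E W\<in>\<W>. W) \<Longrightarrow> w' \<in> (\<Pi>\<^sub>E W\<in>\<W>. W) \<Longrightarrow> (\<Sum>W\<in>\<W>. w W) = (\<Sum>W\<in>\<W>. w' W) \<Longrightarrow> w = w'"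
  using assms inj_onD[of "\<lambda>w. \<Sum>W\<in>\<W>. w W" "\<Pi>\<^sub>E W\<in>\<W>. W" w w']
  by (simp_all add: internal_direct_sum_def bij_betw_iff_ex1) (metis (no_types, lifting))

lemma internal_direct_sum_member_subset:
  assumes "internal_direct_sum V \<W>" "finite \<W>" "\<And>W. W \<in> \<W> \<Longrightarrow> 0 \<in> W" "W \<in> \<W>"
  shows "W \<subseteq> V"
proof
  fix x assume "x \<in> W"
  then have "(\<lambda>X\<in>\<W>. if X = W then x else 0) \<in> (\<Pi>\<^sub>E W\<in>\<W>. W)" using assms by auto
  from internal_direct_sumD(1)[OF assms(1) this] show "x \<in> V"
    using assms(2,4) by (simp add: sum.delta cong: sum.cong)
qed

lemma internal_direct_sum_insert:
  fixes U :: "'v::ab_group_add set"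
  assumes sum: "internal_direct_sum U \<W>" and fin: "finite \<W>" and W: "W \<notin> \<W>"
    and closed: "\<And>w u. w \<in> W \<Longrightarrow> u \<in> U \<Longrightarrow> w + u \<in> V"
    and decomp: "\<And>v. v \<in> V \<Longrightarrow> \<exists>w\<in>W. \<exists>u\<in>U. v = w + u"
    and unique: "\<And>w w' u u'. w \<in> W \<Longrightarrow> w' \<in> W \<Longrightarrow> u \<in> U \<Longrightarrow> u' \<in> U \<Longrightarrow> w + u = w' + u' \<Longrightarrow> w = w' \<and> u = u'"
  shows "internal_direct_sum V (insert W \<W>)"
proof (rule internal_direct_sumI)
  fix w assume w: "w \<in> (\<Pi>\<^sub>E X\<in>insert W \<W>. X)"
  then have "restrict w \<W> \<in> (\<Pi>\<^sub>E X\<in>\<W>. X)" by auto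
  from internal_direct_sumD(1)[OF sum this] have "(\<Sum>X\<in>\<W>. w X) \<in> U" by simp
  then show "(\<Sum>X\<in>insert W \<W>. w X) \<in> V" using w fin W closed by auto
next
  fix v assume "v \<in> V"
  then obtain x u where xu: "x \<in> W" "u \<in> U" "v = x + u" using decomp by blast
  then obtain w where w: "w \<in> (\<Pi>\<^sub>E X\<in>\<W>. X)" "(\<Sum>X\<in>\<W>. w X) = u"
    using internal_direct_sumD(2)[OF sum] by blast
  have eq: "(\<Sum>X\<in>\<W>. (w(W := x)) X) = u" using w(2) W by (auto intro: sum.cong)
  show "\<exists>!w. w \<in> (\<Pi>\<^sub>E X\<in>insert W \<W>. X) \<and> (\<Sum>X\<in>insert W \<W>. w X) = v"
  proof (rule ex1I[of _ "w(W := x)"])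
    have "w(W := x) \<in> (\<Pi>\<^sub>E X\<in>insert W \<W>. X)" using w(1) xu(1) by (auto simp: PiE_def extensional_def)
    moreover have "(\<Sum>X\<in>insert W \<W>. (w(W := x)) X) = v" using eq fin W xu by simp
    ultimately show "w(W := x) \<in> (\<Pi>\<^sub>E X\<in>insert W \<W>. X) \<and> (\<Sum>X\<in>insert W \<W>. (w(W := x)) X) = v" by blast
  next
    fix w' assume "w' \<in> (\<Pi>\<^sub>E X\<in>insert W \<W>. X) \<and> (\<Sum>X\<in>insert W \<W>. w' X) = v"
    then have w': "w' \<in> (\<Pi>\<^sub>E X\<in>insert W \<W>. X)" "v = (\<Sum>X\<in>insert W \<W>. w' X)" by auto
    have r: "restrict w' \<W> \<in> (\<Pi>\<^sub>E X\<in>\<W>. X)" using w' by auto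
    have "(\<Sum>X\<in>\<W>. w' X) \<in> U" using internal_direct_sumD(1)[OF sum r] by simp
    moreover have "w' W \<in> W" using w' by auto
    moreover have "x + u = w' W + (\<Sum>X\<in>\<W>. w' X)" using w' xu fin W by simp
    ultimately have e: "x = w' W" "u = (\<Sum>X\<in>\<W>. w' X)" using unique xu by blast+
    have "restrict w' \<W> = w"
      by (rule internal_direct_sumD(3)[OF sum r w(1)]) (use w(2) e(2) in simp)
    then have r': "w' X = w X" if "X \<in> \<W>" for X using that by (metis restrict_apply')
    show "w' = w(W := x)"
    proof
      fix X
      consider "X = W" | "X \<noteq> W" "X \<in> \<W>" | "X \<noteq> W" "X \<notin> \<W>" by blast
      then show "w' X = (w(W := x)) X"
        using e(1) r' PiE_arb[OF w'(1), of X] PiE_arb[OF w(1), of X] by cases auto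
    qed
  qed
qed

text \<open>A nonzero invariant subspace of least dimension is irreducible, and Maschke's theorem splits it off;
  the complement has smaller dimension.\<close>

lemma irreducible_decomposition:
  assumes "group_rep G scale V \<rho>" "finite (carrier G)" "finite B" "V \<subseteq> module.span scale B"
  shows "\<exists>\<W>. finite \<W> \<and> (\<forall>W\<in>\<W>. irreducible_rep G scale W \<rho>) \<and> internal_direct_sum V \<W>"
  using assms(1,4)
proof (induction "vector_space.dim scale V" arbitrary: V rule: less_induct)
  case less
  interpret V: group_rep G scale V \<rho> by fact
  show ?case
  proof (cases "V = {0}")
    case True
    then show ?thesis
      by (intro exI[of _ "{}"]) (auto simp: internal_direct_sum_def bij_betw_def)
  next
    case False
    let ?P = "\<lambda>W. group_rep G scale W \<rho> \<and> W \<subseteq> V \<and> W \<noteq> {0}"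
    define W where "W = arg_min (vector_space.dim scale) ?P"
    have W: "?P W" and min: "\<And>X. ?P X \<Longrightarrow> V.dim W \<le> V.dim X"
      unfolding W_def using arg_min_nat_lemma[of ?P V "V.dim"] False less.prems(1) by auto
    interpret W: group_rep G scale W \<rho> using W by simp
    have irr: "irreducible_rep G scale W \<rho>"
      unfolding irreducible_rep_def
    proof (intro conjI allI impI)
      fix X assume X: "X \<subseteq> W" "group_rep G scale X \<rho>"
      then interpret X: group_rep G scale X \<rho> by simp
      show "X = {0} \<or> X = W"
        using min[of X] X W less.prems V.dim_psubset_finite_span[OF X.subspace_V, of W B] assms(3) by force
    qed (use W in auto)
    obtain U where U: "group_rep G scale U \<rho>" "U \<subseteq> V" "W \<inter> U = {0}"
      "\<And>v. v \<in> V \<Longrightarrow> \<exists>w\<in>W. \<exists>u\<in>U. v = w + u"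
      using V.invariant_complement[OF assms(2), of W] W by blast
    interpret U: group_rep G scale U \<rho> by fact
    have "U \<noteq> V" using U(3) W by (metis Int_absorb2)
    then have "U \<subset> V" using U(2) by auto
    then have "V.dim U < V.dim V"
      by (rule V.dim_psubset_finite_span[OF U.subspace_V _ less.prems(2) assms(3)])
    then obtain \<W> where \<W>: "finite \<W>" "\<forall>W\<in>\<W>. irreducible_rep G scale W \<rho>" "internal_direct_sum U \<W>"
      using less.hyps[OF _ U(1) order_trans[OF U(2) less.prems(2)]] by metis
    have z: "0 \<in> X" if "X \<in> \<W>" for X
      using \<W>(2) that group_rep.zero_in_V[of G scale X \<rho>] by (simp add: irreducible_rep_def)
    have "W \<notin> \<W>"
    proof
      assume "W \<in> \<W>"
      then have "W \<subseteq> U" using internal_direct_sum_member_subset[OF \<W>(3,1)] z by metis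
      then show False using U(3) W by auto
    qed
    have "internal_direct_sum V (insert W \<W>)"
    proof (rule internal_direct_sum_insert[OF \<W>(3,1) \<open>W \<notin> \<W>\<close>])
      fix w w' u u' assume a: "w \<in> W" "w' \<in> W" "u \<in> U" "u' \<in> U" "w + u = w' + u'"
      have "w - w' = u' - u" using a(5) by (simp add: algebra_simps)
      moreover have "w - w' \<in> W" "u' - u \<in> U"
        using a W.subspace_V U.subspace_V by (auto intro: V.subspace_diff)
      ultimately have "w - w' \<in> W \<inter> U" by simp
      then have "w - w' = 0" unfolding U(3) by simp
      then show "w = w' \<and> u = u'" using a by simp
    next
      fix w u assume "w \<in> W" "u \<in> U"
      then show "w + u \<in> V" using U(2) W by (intro V.subspace_add[OF V.subspace_V]) auto
    qed (rule U(4))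
    then show ?thesis using irr \<W> by (intro exI[of _ "insert W \<W>"]) auto
  qed
qed

text \<open>An isomorphism \<open>T\<close> between two different summands, precomposed with the projection, and its
  inverse, also precomposed with the projection, compose to the identity of one summand in
  one order and to \<open>0\<close> in the other.\<close>

lemma multiplicity_free_if_endos_commute:
  assumes rep: "group_rep G scale V \<rho>" and fin: "finite (carrier G)"
    and B: "finite B" "V \<subseteq> module.span scale B"
    and comm: "\<And>S T v. equivariant_endo G scale V \<rho> S \<Longrightarrow> equivariant_endo G scale V \<rho> T \<Longrightarrow> v \<in> V \<Longrightarrow>
      S (T v) = T (S v)"
  shows "multiplicity_free G scale V \<rho>"
proof -
  interpret V: group_rep G scale V \<rho> by fact
  obtain \<W> where \<W>: "finite \<W>" "\<forall>W\<in>\<W>. irreducible_rep G scale W \<rho>" "internal_direct_sum V \<W>"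
    using irreducible_decomposition[OF assms(1-4)] by blast
  note D = internal_direct_sumD[OF \<W>(3)]
  have reps: "group_rep G scale W \<rho>" if "W \<in> \<W>" for W
    using \<W>(2) that by (simp add: irreducible_rep_def)
  note subsp = group_rep.subspace_V[OF reps]
  have sub: "W \<subseteq> V" if "W \<in> \<W>" for W
    using internal_direct_sum_member_subset[OF \<W>(3,1)] group_rep.zero_in_V[OF reps] that by metis
  define dec where "dec v = (THE w. w \<in> (\<Pi>\<^sub>E W\<in>\<W>. W) \<and> (\<Sum>W\<in>\<W>. w W) = v)" for v
  have dec: "dec v \<in> (\<Pi>\<^sub>E W\<in>\<W>. W)" "(\<Sum>W\<in>\<W>. dec v W) = v" if "v \<in> V" for v
    using theI'[OF D(2)[OF that]] unfolding dec_def by auto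
  have dec_eq: "dec v X = f X" if "\<And>W. W \<in> \<W> \<Longrightarrow> f W \<in> W" "(\<Sum>W\<in>\<W>. f W) = v" "X \<in> \<W>" for f v X
  proof -
    have 1: "restrict f \<W> \<in> (\<Pi>\<^sub>E W\<in>\<W>. W)" "(\<Sum>W\<in>\<W>. restrict f \<W> W) = v"
      using that by auto
    then have "v \<in> V" using D(1) by blast
    then have "dec v = restrict f \<W>" using D(2)[of v] dec[of v] 1 by blast
    then show ?thesis using that(3) by simp
  qed
  have dec_mem: "dec v X \<in> X" if "v \<in> V" "X \<in> \<W>" for v X using dec(1)[OF that(1)] that(2) by auto
  have dec_add: "dec (v + w) X = dec v X + dec w X" if "v \<in> V" "w \<in> V" "X \<in> \<W>" for v w X
    by (rule dec_eq) (use that dec in \<open>auto simp: sum.distrib intro!: V.subspace_add[OF subsp] dec_mem\<close>)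
  have dec_scale: "dec (scale c v) X = scale c (dec v X)" if "v \<in> V" "X \<in> \<W>" for c v X
    by (rule dec_eq) (use that dec in \<open>auto simp: V.scale_sum_right[symmetric] intro!: V.subspace_scale[OF subsp] dec_mem\<close>)
  have dec_act: "dec (\<rho> g v) X = \<rho> g (dec v X)" if "v \<in> V" "X \<in> \<W>" "g \<in> carrier G" for g v X
  proof (rule dec_eq)
    have "\<rho> g (\<Sum>W\<in>\<W>. dec v W) = (\<Sum>W\<in>\<W>. \<rho> g (dec v W))"
      using dec_mem[OF that(1)] sub by (intro V.act_sum that) blast
    then show "(\<Sum>W\<in>\<W>. \<rho> g (dec v W)) = \<rho> g v" using dec(2)[OF that(1)] by simp
  qed (use that in \<open>auto intro!: group_rep.act_closed[OF reps] dec_mem\<close>)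
  have dec_in: "dec x X = (if X = W then x else 0)" if "x \<in> W" "W \<in> \<W>" "X \<in> \<W>" for x W X
    by (rule dec_eq) (use that \<W>(1) V.subspace_0[OF subsp] in auto)
  have endo: "equivariant_endo G scale V \<rho> (\<lambda>v. T (dec v W))"
    if T: "bij_betw T W W'" "\<forall>v\<in>W. \<forall>w\<in>W. T (v + w) = T v + T w"
       "\<forall>c. \<forall>v\<in>W. T (scale c v) = scale c (T v)"
       "\<forall>g\<in>carrier G. \<forall>v\<in>W. T (\<rho> g v) = \<rho> g (T v)" and W: "W \<in> \<W>" "W' \<in> \<W>" for T W W'
    unfolding equivariant_endo_def
  proof (intro conjI ballI allI)
    fix v assume "v \<in> V"
    then show "T (dec v W) \<in> V" using dec_mem W sub[OF W(2)] T(1) by (auto simp: bij_betw_def)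
  qed (use T(2-) W dec_mem in \<open>auto simp: dec_add dec_scale dec_act\<close>)
  have "\<not> isomorphic_subreps G scale \<rho> W W'" if W: "W \<in> \<W>" "W' \<in> \<W>" "W \<noteq> W'" for W W'
  proof
    assume "isomorphic_subreps G scale \<rho> W W'"
    then obtain T where T: "bij_betw T W W'" "\<forall>v\<in>W. \<forall>w\<in>W. T (v + w) = T v + T w"
       "\<forall>c. \<forall>v\<in>W. T (scale c v) = scale c (T v)"
       "\<forall>g\<in>carrier G. \<forall>v\<in>W. T (\<rho> g v) = \<rho> g (T v)"
      unfolding isomorphic_subreps_def by blast
    define S where "S = inv_into W T"
    have S: "bij_betw S W' W" and TS: "\<And>y. y \<in> W' \<Longrightarrow> T (S y) = y" and ST: "\<And>x. x \<in> W \<Longrightarrow> S (T x) = x"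
      using T(1) bij_betw_inv_into[OF T(1)] by (auto simp: S_def bij_betw_def f_inv_into_f)
    have SW: "S y \<in> W" if "y \<in> W'" for y using S that by (auto simp: bij_betw_def)
    have S_eq: "S y = x" if "x \<in> W" "T x = y" for x y using ST that by auto
    interpret W: group_rep G scale W \<rho> using reps W by blast
    have "equivariant_endo G scale V \<rho> (\<lambda>v. S (dec v W'))"
      by (rule endo[OF S _ _ _ W(2,1)])
         (auto intro!: S_eq V.subspace_add[OF W.subspace_V] V.subspace_scale[OF W.subspace_V] W.act_closed SW simp: T TS SW)
    note comm = comm[OF this endo[OF T W(1,2)]]
    have T0: "T 0 = 0" "S 0 = 0"
      using T(3)[rule_format, of 0 0] W.zero_in_V ST[of 0] by auto
    have "x = 0" if "x \<in> W" for x
    proof -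
      have "T x \<in> W'" using T(1) that by (auto simp: bij_betw_def)
      moreover have "x \<in> V" using that sub W by blast
      ultimately show ?thesis
        using comm[of x] that W T0 by (simp add: dec_in[of x W] dec_in[of "T x" W'] dec_in[of 0 W] ST W.zero_in_V)
    qed
    then have "W = {0}" using W.zero_in_V by auto
    then show False using \<W>(2) W(1) unfolding irreducible_rep_def by blast
  qed
  then show ?thesis unfolding multiplicity_free_def using rep \<W> by blast
qed

section \<open>Endomorphisms of an induced representation\<close>

lemma sum_fun_apply: "(\<Sum>i\<in>I. f i) x = (\<Sum>i\<in>I. f i x)"
  by (induction I rule: infinite_finite_induct) auto

locale induced_character = group G for G (structure) +
  fixes P :: "'g set" and \<chi> :: "'g \<Rightarrow> complex"
  constrains G :: "('g, 'm) monoid_scheme"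
  assumes finite_carrier: "finite (carrier G)"
    and subgroup_P: "subgroup P G"
    and \<chi>_hom: "\<chi> \<in> hom (G\<lparr>carrier := P\<rparr>) complex_units"
begin

lemma P_subset: "P \<subseteq> carrier G" using subgroup_P by (rule subgroup.subset)

lemma P_closed [simp]: "p \<in> P \<Longrightarrow> p \<in> carrier G" using P_subset by auto

lemma P_mult: "p \<in> P \<Longrightarrow> p' \<in> P \<Longrightarrow> p \<otimes> p' \<in> P" using subgroup_P by (rule subgroup.m_closed)

lemma P_inv: "p \<in> P \<Longrightarrow> inv p \<in> P" using subgroup_P by (rule subgroup.m_inv_closed)

lemma P_one: "\<one> \<in> P" using subgroup_P by (rule subgroup.one_closed)

lemma \<chi>_mult: "p \<in> P \<Longrightarrow> p' \<in> P \<Longrightarrow> \<chi> (p \<otimes> p') = \<chi> p * \<chi> p'"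
  using \<chi>_hom by (auto simp: hom_def complex_units_def)

lemma \<chi>_nonzero: "p \<in> P \<Longrightarrow> \<chi> p \<noteq> 0"
  using \<chi>_hom by (auto simp: hom_def complex_units_def)

lemma \<chi>_one: "\<chi> \<one> = 1"
  using \<chi>_mult[OF P_one P_one] \<chi>_nonzero[OF P_one] by simp

abbreviation "V \<equiv> induced_space G P \<chi>"
abbreviation "R \<equiv> right_translation G"
abbreviation "endo \<equiv> equivariant_endo G fun_scale V R"

lemma mem_P_left_iff: "p \<in> P \<Longrightarrow> g \<in> carrier G \<Longrightarrow> p \<otimes> g \<in> P \<longleftrightarrow> g \<in> P"
  using P_mult[of "inv p" "p \<otimes> g"] P_inv[of p] P_mult[of p g] by (auto simp: inv_solve_left' m_assoc[symmetric])

lemma mem_P_right_iff: "p \<in> P \<Longrightarrow> g \<in> carrier G \<Longrightarrow> g \<otimes> p \<in> P \<longleftrightarrow> g \<in> P"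
  using P_mult[of "g \<otimes> p" "inv p"] P_inv[of p] P_mult[of g p] by (auto simp: m_assoc)

text \<open>The cyclic vector of the induced representation.\<close>

definition delta :: "'g \<Rightarrow> complex" where
  "delta g = (if g \<in> P then \<chi> g else 0)"

lemma delta_mem: "delta \<in> V"
  by (auto simp: induced_space_def delta_def mem_P_left_iff \<chi>_mult)

lemma right_translation_delta: "p \<in> P \<Longrightarrow> R p delta = fun_scale (\<chi> p) delta"
  by (auto simp: right_translation_def delta_def fun_scale_def fun_eq_iff mem_P_right_iff \<chi>_mult)

lemma group_rep_V: "group_rep G fun_scale V R"
  using group_rep_induced_space[OF group_axioms P_subset] .

sublocale V: group_rep G fun_scale V R
  by (rule group_rep_V)

text \<open>The condition \<open>g h\<inverse> \<in> P\<close> says that \<open>h\<close> lies in the coset \<open>P g\<close>.\<close>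

lemma right_coset_card:
  assumes g: "g \<in> carrier G"
  shows "card {h \<in> carrier G. g \<otimes> inv h \<in> P} = card P"
proof -
  have "bij_betw (\<lambda>h. g \<otimes> inv h) {h \<in> carrier G. g \<otimes> inv h \<in> P} P"
  proof (rule bij_betw_byWitness[where f' = "\<lambda>p. inv p \<otimes> g"])
    show "\<forall>h\<in>{h \<in> carrier G. g \<otimes> inv h \<in> P}. inv (g \<otimes> inv h) \<otimes> g = h"
      using g by (simp add: inv_mult_group m_assoc)
    have *: "g \<otimes> inv (inv p \<otimes> g) = p" if "p \<in> P" for p
      using g that by (simp add: inv_mult_group m_assoc[symmetric])
    then show "\<forall>p\<in>P. g \<otimes> inv (inv p \<otimes> g) = p" by blast
    show "(\<lambda>p. inv p \<otimes> g) ` P \<subseteq> {h \<in> carrier G. g \<otimes> inv h \<in> P}"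
      using g * by auto
  qed auto
  then show ?thesis by (rule bij_betw_same_card)
qed

text \<open>At \<open>g\<close> only the \<open>h\<close> in the coset \<open>P g\<close> contribute, and all of them contribute the same value; hence
  the division by the order of \<open>P\<close>.\<close>

lemma delta_expansion:
  assumes f: "f \<in> V"
  shows "f = (\<Sum>h\<in>carrier G. fun_scale (f h / of_nat (card P)) (R (inv h) delta))"
proof
  fix g
  have N: "of_nat (card P) \<noteq> (0::complex)"
    using P_one finite_subset[OF P_subset finite_carrier] by (auto simp: card_eq_0_iff)
  show "f g = (\<Sum>h\<in>carrier G. fun_scale (f h / of_nat (card P)) (R (inv h) delta)) g"
  proof (cases "g \<in> carrier G")
    case g: True
    have "f h / of_nat (card P) * delta (g \<otimes> inv h) = (if g \<otimes> inv h \<in> P then f g / of_nat (card P) else 0)"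
      if h: "h \<in> carrier G" for h
    proof -
      have "\<chi> (g \<otimes> inv h) * f h = f g" if "g \<otimes> inv h \<in> P"
      proof -
        have "f (g \<otimes> inv h \<otimes> h) = \<chi> (g \<otimes> inv h) * f h"
          using f that h by (auto simp: induced_space_def)
        then show ?thesis using g h by (simp add: m_assoc)
      qed
      then show ?thesis by (auto simp: delta_def mult.commute)
    qed
    then have "(\<Sum>h\<in>carrier G. fun_scale (f h / of_nat (card P)) (R (inv h) delta)) g =
      (\<Sum>h\<in>carrier G. if g \<otimes> inv h \<in> P then f g / of_nat (card P) else 0)"
      using g by (auto simp: sum_fun_apply fun_scale_def right_translation_def intro!: sum.cong)
    also have "\<dots> = of_nat (card {h \<in> carrier G. g \<otimes> inv h \<in> P}) * (f g / of_nat (card P))"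
      using finite_carrier by (simp add: sum.If_cases Int_def)
    also have "\<dots> = f g" using N by (simp add: right_coset_card[OF g])
    finally show ?thesis ..
  next
    case False
    then show ?thesis using f by (simp add: sum_fun_apply fun_scale_def right_translation_def induced_space_def)
  qed
qed

lemma V_finite_span: "V \<subseteq> V.span ((\<lambda>h. R (inv h) delta) ` carrier G)"
proof
  fix f assume "f \<in> V"
  have "(\<Sum>h\<in>carrier G. fun_scale (f h / of_nat (card P)) (R (inv h) delta)) \<in> V.span ((\<lambda>h. R (inv h) delta) ` carrier G)"
    by (intro V.span_sum V.span_scale V.span_base) auto
  then show "f \<in> V.span ((\<lambda>h. R (inv h) delta) ` carrier G)"
    using delta_expansion[OF \<open>f \<in> V\<close>] by simp
qed

text \<open>Equivariance moves \<open>T\<close> past the translations in the expansion of \<open>f\<close>, so that \<open>T\<close> is convolution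
  with \<open>T delta\<close>.\<close>

lemma endo_formula:
  assumes T: "endo T" and f: "f \<in> V" and g: "g \<in> carrier G"
  shows "T f g = (\<Sum>h\<in>carrier G. f h / of_nat (card P) * T delta (g \<otimes> inv h))"
proof -
  have m: "R (inv h) delta \<in> V" if "h \<in> carrier G" for h
    using that delta_mem by (intro V.act_closed) auto
  have "T f = T (\<Sum>h\<in>carrier G. fun_scale (f h / of_nat (card P)) (R (inv h) delta))"
    using delta_expansion[OF f] by simp
  also have "\<dots> = (\<Sum>h\<in>carrier G. T (fun_scale (f h / of_nat (card P)) (R (inv h) delta)))"
    using m by (intro V.equivariant_endo_sum[OF T] V.subspace_scale[OF V.subspace_V])
  also have "\<dots> = (\<Sum>h\<in>carrier G. fun_scale (f h / of_nat (card P)) (R (inv h) (T delta)))"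
    using T m delta_mem unfolding equivariant_endo_def by (intro sum.cong) auto
  finally show ?thesis using g by (simp add: sum_fun_apply fun_scale_def right_translation_def)
qed

lemma endo_eqI:
  assumes "endo S" "endo T" "S delta = T delta" "f \<in> V"
  shows "S f = T f"
proof
  fix g
  have "S f \<in> V" "T f \<in> V" using assms by (auto simp: equivariant_endo_def)
  then show "S f g = T f g"
    using endo_formula[OF assms(1,4)] endo_formula[OF assms(2,4)] assms(3)
    by (cases "g \<in> carrier G") (auto simp: induced_space_def)
qed

lemma endo_compose: "endo S \<Longrightarrow> endo T \<Longrightarrow> endo (\<lambda>f. S (T f))"
  unfolding equivariant_endo_def by simp

lemma endo_delta_mem: "endo T \<Longrightarrow> T delta \<in> V"
  using delta_mem by (simp add: equivariant_endo_def)

text \<open>On the left this is membership in the induced space; on the right it is inherited from \<open>delta\<close>,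
  which is an eigenvector of \<open>P\<close>.\<close>

lemma endo_delta_biequivariant:
  assumes T: "endo T" and p: "p \<in> P" "p' \<in> P" and g: "g \<in> carrier G"
  shows "T delta (p \<otimes> g \<otimes> p') = \<chi> p * \<chi> p' * T delta g"
proof -
  have "R p' (T delta) = T (R p' delta)"
    using T p delta_mem unfolding equivariant_endo_def by auto
  also have "\<dots> = fun_scale (\<chi> p') (T delta)"
    using T p delta_mem unfolding equivariant_endo_def by (simp add: right_translation_delta)
  finally have "R p' (T delta) (p \<otimes> g) = \<chi> p' * T delta (p \<otimes> g)" by (simp add: fun_scale_def)
  moreover have "T delta (p \<otimes> g) = \<chi> p * T delta g"
    using endo_delta_mem[OF T] p g by (auto simp: induced_space_def)
  ultimately show ?thesis using p g by (simp add: right_translation_def)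
qed

lemma endo_delta_right:
  assumes "endo T" "p \<in> P" "g \<in> carrier G"
  shows "T delta (g \<otimes> p) = \<chi> p * T delta g"
  using endo_delta_biequivariant[OF assms(1) P_one assms(2,3)] assms by (simp add: \<chi>_one)

lemma endo_compose_formula:
  assumes "endo S" "endo T" "g \<in> carrier G"
  shows "T (S delta) g = (\<Sum>h\<in>carrier G. S delta h * T delta (g \<otimes> inv h)) / of_nat (card P)"
  using endo_formula[OF assms(2) endo_delta_mem[OF assms(1)] assms(3)]
  by (simp add: sum_divide_distrib)

lemma endos_commute_if_delta:
  assumes "endo S" "endo T" "\<And>g. g \<in> carrier G \<Longrightarrow> S (T delta) g = T (S delta) g" "f \<in> V"
  shows "S (T f) = T (S f)"
proof (rule endo_eqI[OF endo_compose[OF assms(1,2)] endo_compose[OF assms(2,1)] _ assms(4)])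
  have "S (T delta) \<in> V" "T (S delta) \<in> V"
    using assms(1,2) delta_mem by (auto simp: equivariant_endo_def)
  then have "S (T delta) g = T (S delta) g" for g
    using assms(3)[of g] by (cases "g \<in> carrier G") (simp_all add: induced_space_def)
  then show "S (T delta) = T (S delta)" by blast
qed

text \<open>Every \<open>\<phi> = T delta\<close> satisfies \<open>\<phi> (\<tau> x) * \<psi> x = \<phi> x\<close>: this holds at the representatives, and the
  assumption on \<open>\<chi>\<close> carries it over their double cosets. Since \<open>\<tau>\<close> reverses products, it exchanges
  the two factors of a convolution, and since \<open>\<psi>\<close> is multiplicative, the factors \<open>\<psi>\<close> cancel.\<close>

lemma gelfand_trick:
  fixes \<tau> :: "'g \<Rightarrow> 'g" and \<psi> :: "'g \<Rightarrow> complex"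
  assumes \<tau>: "\<And>g. g \<in> carrier G \<Longrightarrow> \<tau> g \<in> carrier G" "\<And>g. g \<in> carrier G \<Longrightarrow> \<tau> (\<tau> g) = g"
      "\<And>g h. g \<in> carrier G \<Longrightarrow> h \<in> carrier G \<Longrightarrow> \<tau> (g \<otimes> h) = \<tau> h \<otimes> \<tau> g"
      "\<And>p. p \<in> P \<Longrightarrow> \<tau> p \<in> P"
    and \<psi>: "\<And>g h. g \<in> carrier G \<Longrightarrow> h \<in> carrier G \<Longrightarrow> \<psi> (g \<otimes> h) = \<psi> g * \<psi> h"
    and \<chi>\<tau>: "\<And>p. p \<in> P \<Longrightarrow> \<chi> (\<tau> p) * \<psi> p = \<chi> p"
    and W: "W \<subseteq> carrier G" "\<And>w. w \<in> W \<Longrightarrow> \<tau> w = w" "\<And>w. w \<in> W \<Longrightarrow> \<psi> w = 1"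
    and cosets: "\<And>g. g \<in> carrier G \<Longrightarrow> \<exists>p\<in>P. \<exists>w\<in>W. \<exists>p'\<in>P. g = p \<otimes> w \<otimes> p'"
    and ST: "endo S" "endo T" and f: "f \<in> V"
  shows "S (T f) = T (S f)"
proof (rule endos_commute_if_delta[OF ST _ f])
  fix g assume g: "g \<in> carrier G"
  have sym: "T delta (\<tau> x) * \<psi> x = T delta x" if T: "endo T" and x: "x \<in> carrier G" for T x
  proof -
    obtain p w p' where pw: "p \<in> P" "w \<in> W" "p' \<in> P" "x = p \<otimes> w \<otimes> p'" using cosets[OF x] by blast
    then have w: "w \<in> carrier G" using W by auto
    have "\<tau> x = \<tau> p' \<otimes> w \<otimes> \<tau> p" using pw w \<tau> W(2) by (simp add: m_assoc)
    then have "T delta (\<tau> x) * \<psi> x = (\<chi> (\<tau> p') * \<psi> p') * (\<chi> (\<tau> p) * \<psi> p) * T delta w"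
      using pw w \<psi> W(3) \<tau>(4) by (simp add: endo_delta_biequivariant[OF T])
    also have "\<dots> = T delta x"
      using pw w by (simp add: \<chi>\<tau> endo_delta_biequivariant[OF T])
    finally show ?thesis .
  qed
  have "\<tau> \<one> \<otimes> \<tau> \<one> = \<tau> \<one>" using \<tau>(3)[of \<one> \<one>] by simp
  then have \<tau>_one: "\<tau> \<one> = \<one>" using \<tau>(1)[of \<one>] by (metis l_cancel_one one_closed)
  have \<tau>_inv: "\<tau> (inv h) = inv (\<tau> h)" if "h \<in> carrier G" for h
    using \<tau>(3)[of h "inv h"] that \<tau>(1) \<tau>_one by (intro inv_equality[symmetric]) auto
  have "S (T delta) (\<tau> g) = (\<Sum>h\<in>carrier G. T delta h * S delta (\<tau> g \<otimes> inv h)) / of_nat (card P)"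
    using endo_compose_formula[OF ST(2,1)] \<tau>(1) g by simp
  also have "(\<Sum>h\<in>carrier G. T delta h * S delta (\<tau> g \<otimes> inv h)) =
             (\<Sum>h\<in>carrier G. T delta (\<tau> h) * S delta (\<tau> (inv h \<otimes> g)))"
    by (rule sum.reindex_bij_witness[where i = \<tau> and j = \<tau>])
       (use \<tau> g in \<open>auto simp: \<tau>_inv\<close>)
  also have "\<dots> = (\<Sum>h\<in>carrier G. T delta (\<tau> (g \<otimes> inv h)) * S delta (\<tau> h))"
    by (rule sum.reindex_bij_witness[where i = "\<lambda>h. g \<otimes> inv h" and j = "\<lambda>h. inv h \<otimes> g"])
       (use g in \<open>simp_all add: inv_mult_group m_assoc[symmetric]\<close>, use g in \<open>simp_all add: m_assoc\<close>)
  finally have "S (T delta) (\<tau> g) * \<psi> g =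
      (\<Sum>h\<in>carrier G. T delta (\<tau> (g \<otimes> inv h)) * S delta (\<tau> h) * \<psi> g) / of_nat (card P)"
    by (simp add: sum_distrib_right)
  also have "(\<Sum>h\<in>carrier G. T delta (\<tau> (g \<otimes> inv h)) * S delta (\<tau> h) * \<psi> g) =
             (\<Sum>h\<in>carrier G. S delta h * T delta (g \<otimes> inv h))"
  proof (rule sum.cong[OF refl])
    fix h assume h: "h \<in> carrier G"
    have "\<psi> g = \<psi> (g \<otimes> inv h \<otimes> h)" using g h by (simp add: m_assoc)
    also have "\<dots> = \<psi> (g \<otimes> inv h) * \<psi> h" using g h by (intro \<psi>) auto
    finally show "T delta (\<tau> (g \<otimes> inv h)) * S delta (\<tau> h) * \<psi> g = S delta h * T delta (g \<otimes> inv h)"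
      using sym[OF ST(1) h] sym[OF ST(2), of "g \<otimes> inv h"] g h by (simp add: mult_ac)
  qed
  also have "\<dots> / of_nat (card P) = T (S delta) g"
    using endo_compose_formula[OF ST g] by simp
  finally show "S (T delta) g = T (S delta) g"
    using sym[OF endo_compose[OF ST] g] by simp
qed

text \<open>If \<open>w p = p' w\<close> with \<open>\<chi> p' \<noteq> \<chi> p\<close>, bi-equivariance forces \<open>T delta w = 0\<close>. So a twist is required
  only in the presence of a representative outside \<open>P\<close> that admits no such pair; otherwise every
  \<open>T delta\<close> is a multiple of \<open>delta\<close>, and every endomorphism is a scalar.\<close>

lemma multiplicity_free_induced:
  fixes \<tau> :: "'g \<Rightarrow> 'g"
  assumes \<tau>: "\<And>g. g \<in> carrier G \<Longrightarrow> \<tau> g \<in> carrier G" "\<And>g. g \<in> carrier G \<Longrightarrow> \<tau> (\<tau> g) = g"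
      "\<And>g h. g \<in> carrier G \<Longrightarrow> h \<in> carrier G \<Longrightarrow> \<tau> (g \<otimes> h) = \<tau> h \<otimes> \<tau> g"
      "\<And>p. p \<in> P \<Longrightarrow> \<tau> p \<in> P"
    and W: "W \<subseteq> carrier G" "\<And>w. w \<in> W \<Longrightarrow> \<tau> w = w"
    and cosets: "\<And>g. g \<in> carrier G \<Longrightarrow> \<exists>p\<in>P. \<exists>w\<in>W. \<exists>p'\<in>P. g = p \<otimes> w \<otimes> p'"
    and twist: "\<And>w. w \<in> W \<Longrightarrow> w \<notin> P \<Longrightarrow>
      (\<And>p p'. p \<in> P \<Longrightarrow> p' \<in> P \<Longrightarrow> w \<otimes> p = p' \<otimes> w \<Longrightarrow> \<chi> p' = \<chi> p) \<Longrightarrow>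
      \<exists>\<psi>. (\<forall>g\<in>carrier G. \<forall>h\<in>carrier G. \<psi> (g \<otimes> h) = \<psi> g * \<psi> h) \<and> (\<forall>w\<in>W. \<psi> w = 1) \<and>
        (\<forall>p\<in>P. \<chi> (\<tau> p) * \<psi> p = \<chi> p)"
  shows "multiplicity_free G fun_scale V R"
proof (rule multiplicity_free_if_endos_commute[OF group_rep_V finite_carrier _ V_finite_span])
  fix S T f assume ST: "endo S" "endo T" and f: "f \<in> V"
  show "S (T f) = T (S f)"
  proof (cases "\<exists>w\<in>W. w \<notin> P \<and> (\<forall>p\<in>P. \<forall>p'\<in>P. w \<otimes> p = p' \<otimes> w \<longrightarrow> \<chi> p' = \<chi> p)")
    case True
    then obtain w where "w \<in> W" "w \<notin> P" "\<And>p p'. p \<in> P \<Longrightarrow> p' \<in> P \<Longrightarrow> w \<otimes> p = p' \<otimes> w \<Longrightarrow> \<chi> p' = \<chi> p"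
      by blast
    from twist[OF this] obtain \<psi> where "\<forall>g\<in>carrier G. \<forall>h\<in>carrier G. \<psi> (g \<otimes> h) = \<psi> g * \<psi> h"
      "\<forall>w\<in>W. \<psi> w = 1" "\<forall>p\<in>P. \<chi> (\<tau> p) * \<psi> p = \<chi> p" by blast
    then show ?thesis
      using \<tau> W cosets ST f by (intro gelfand_trick[of \<tau> \<psi> W S T f]) auto
  next
    case False
    have scalar: "S f = fun_scale (S delta \<one>) f" if S: "endo S" and f: "f \<in> V" for S f
    proof (rule endo_eqI[OF S _ _ f])
      show "endo (fun_scale (S delta \<one>))"
        using V.subspace_scale[OF V.subspace_V]
        by (auto simp: equivariant_endo_def V.scale_right_distrib V.act_scale mult.commute)
      have zero: "S delta w = 0" if w: "w \<in> W" "w \<notin> P" for w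
      proof -
        obtain p p' where p: "p \<in> P" "p' \<in> P" "w \<otimes> p = p' \<otimes> w" "\<chi> p' \<noteq> \<chi> p"
          using False w by blast
        have "w \<in> carrier G" using w W by auto
        then have "\<chi> p * S delta w = \<chi> p' * S delta w"
          using endo_delta_right[OF S p(1), of w] endo_delta_biequivariant[OF S p(2) P_one, of w] p
          by (simp add: \<chi>_one)
        then show ?thesis using p(4) by simp
      qed
      show "S delta = fun_scale (S delta \<one>) delta"
      proof
        fix g
        consider "g \<notin> carrier G" | "g \<in> P" | "g \<in> carrier G" "g \<notin> P" by blast
        then show "S delta g = fun_scale (S delta \<one>) delta g"
        proof cases
          case 1
          then show ?thesis using endo_delta_mem[OF S] delta_mem by (simp add: fun_scale_def induced_space_def)
        next
          case 2
          then show ?thesis using endo_delta_right[OF S 2, of \<one>] by (simp add: fun_scale_def delta_def)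
        next
          case 3
          obtain p w p' where g: "p \<in> P" "w \<in> W" "p' \<in> P" "g = p \<otimes> w \<otimes> p'" using cosets[OF 3(1)] by blast
          then have "w \<notin> P" using 3 P_mult by blast
          then have "S delta g = 0" using g W zero by (auto simp: endo_delta_biequivariant[OF S])
          then show ?thesis using 3 by (simp add: fun_scale_def delta_def)
        qed
      qed
    qed
    have "S f \<in> V" "T f \<in> V" using ST f by (auto simp: equivariant_endo_def)
    then show ?thesis using scalar[OF ST(1)] scalar[OF ST(2)] f by (simp add: mult.commute)
  qed
qed (use finite_carrier in auto)

end

section \<open>Elementary matrices\<close>

text \<open>The vector \<open>v\<close> is added to column \<open>k\<close> (or row \<open>k\<close>) of the identity off the diagonal; the value
  \<open>v k\<close> is ignored, so that no condition on \<open>v\<close> has to be carried along.\<close>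

definition col_elem :: "nat \<Rightarrow> nat \<Rightarrow> (nat \<Rightarrow> 'a::field) \<Rightarrow> 'a mat" where
  "col_elem n k v = mat n n (\<lambda>(i, j). (if i = j then 1 else 0) + (if j = k \<and> i \<noteq> k then v i else 0))"

definition row_elem :: "nat \<Rightarrow> nat \<Rightarrow> (nat \<Rightarrow> 'a::field) \<Rightarrow> 'a mat" where
  "row_elem n k v = mat n n (\<lambda>(i, j). (if i = j then 1 else 0) + (if i = k \<and> j \<noteq> k then v j else 0))"

definition dilation :: "nat \<Rightarrow> nat \<Rightarrow> 'a::field \<Rightarrow> 'a mat" where
  "dilation n k a = mat n n (\<lambda>(i, j). if i = j then (if i = k then a else 1) else 0)"

inductive_set elem_group :: "nat \<Rightarrow> 'a::field mat set" for n where
  one: "1\<^sub>m n \<in> elem_group n"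
| col: "k < n \<Longrightarrow> A \<in> elem_group n \<Longrightarrow> col_elem n k v * A \<in> elem_group n"
| row: "k < n \<Longrightarrow> A \<in> elem_group n \<Longrightarrow> row_elem n k v * A \<in> elem_group n"

lemma elem_carrier [simp]:
  "col_elem n k v \<in> carrier_mat n n" "row_elem n k v \<in> carrier_mat n n" "dilation n k a \<in> carrier_mat n n"
  by (auto simp: col_elem_def row_elem_def dilation_def)

lemma elem_dim [simp]:
  "dim_row (col_elem n k v) = n" "dim_col (col_elem n k v) = n"
  "dim_row (row_elem n k v) = n" "dim_col (row_elem n k v) = n"
  "dim_row (dilation n k a) = n" "dim_col (dilation n k a) = n"
  by (auto simp: col_elem_def row_elem_def dilation_def)

lemma elem_group_carrier [simp]: "A \<in> elem_group n \<Longrightarrow> A \<in> carrier_mat n n"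
  by (induction rule: elem_group.induct) (auto intro: mult_carrier_mat)

lemma index_mult_row_elem:
  assumes "A \<in> carrier_mat n n" "i < n" "j < n" "k < n"
  shows "(A * row_elem n k v) $$ (i, j) = A $$ (i, j) + (if j = k then 0 else A $$ (i, k) * v j)"
proof -
  have "(A * row_elem n k v) $$ (i, j) = (\<Sum>t<n. A $$ (i, t) * row_elem n k v $$ (t, j))"
    using assms by (auto simp: scalar_prod_def lessThan_atLeast0)
  also have "\<dots> = (\<Sum>t<n. (if t = j then A $$ (i, t) else 0) + (if t = k \<and> j \<noteq> k then A $$ (i, t) * v j else 0))"
    using assms by (intro sum.cong) (auto simp: row_elem_def algebra_simps)
  also have "\<dots> = A $$ (i, j) + (if j = k then 0 else A $$ (i, k) * v j)"
    using assms by (cases "j = k") (simp_all add: sum.distrib)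
  finally show ?thesis .
qed

lemma index_mult_dilation:
  assumes "A \<in> carrier_mat n n" "i < n" "j < n"
  shows "(A * dilation n k a) $$ (i, j) = A $$ (i, j) * (if j = k then a else 1)"
proof -
  have "(A * dilation n k a) $$ (i, j) = (\<Sum>t<n. A $$ (i, t) * dilation n k a $$ (t, j))"
    using assms by (auto simp: scalar_prod_def lessThan_atLeast0)
  also have "\<dots> = (\<Sum>t<n. if t = j then A $$ (i, t) * (if t = k then a else 1) else 0)"
    using assms by (intro sum.cong) (auto simp: dilation_def)
  also have "\<dots> = A $$ (i, j) * (if j = k then a else 1)"
    using assms by simp
  finally show ?thesis .
qed

lemma transpose_col_elem: "transpose_mat (col_elem n k v) = row_elem n k v"
  by (auto simp: row_elem_def col_elem_def)

lemma transpose_dilation: "transpose_mat (dilation n k a) = dilation n k a"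
  by (auto simp: dilation_def)

lemma index_mult_col_elem:
  assumes A: "A \<in> carrier_mat n n" and "i < n" "j < n" "k < n"
  shows "(col_elem n k v * A) $$ (i, j) = A $$ (i, j) + (if i = k then 0 else A $$ (k, j) * v i)"
proof -
  have "transpose_mat (col_elem n k v * A) = transpose_mat A * row_elem n k v"
    using A by (simp add: transpose_mult[of _ n n _ n] transpose_col_elem)
  moreover have "(col_elem n k v * A) $$ (i, j) = transpose_mat (col_elem n k v * A) $$ (j, i)"
    using assms by (simp del: index_mult_mat(1))
  ultimately have "(col_elem n k v * A) $$ (i, j) = (transpose_mat A * row_elem n k v) $$ (j, i)" by simp
  then show ?thesis using assms index_mult_row_elem[of "transpose_mat A" n j i k v] by auto
qed

lemma index_dilation_mult:
  assumes A: "A \<in> carrier_mat n n" and "i < n" "j < n"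
  shows "(dilation n k a * A) $$ (i, j) = (if i = k then a else 1) * A $$ (i, j)"
proof -
  have "transpose_mat (dilation n k a * A) = transpose_mat A * dilation n k a"
    using A by (simp add: transpose_mult[of _ n n _ n] transpose_dilation)
  moreover have "(dilation n k a * A) $$ (i, j) = transpose_mat (dilation n k a * A) $$ (j, i)"
    using assms by (simp del: index_mult_mat(1))
  ultimately have "(dilation n k a * A) $$ (i, j) = (transpose_mat A * dilation n k a) $$ (j, i)" by simp
  then show ?thesis using assms index_mult_dilation[of "transpose_mat A" n j i k a] by auto
qed

lemma row_elem_add:
  assumes "k < n"
  shows "row_elem n k u * row_elem n k v = row_elem n k (\<lambda>i. u i + v i)"
  by (rule eq_matI) (use assms in \<open>auto simp: index_mult_row_elem simp del: index_mult_mat(1)\<close>,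
    auto simp: row_elem_def)

lemma row_elem_zero: "row_elem n k (\<lambda>_. 0) = 1\<^sub>m n"
  by (auto simp: row_elem_def)

lemma col_elem_add:
  assumes "k < n"
  shows "col_elem n k u * col_elem n k v = col_elem n k (\<lambda>i. u i + v i)"
proof -
  have "transpose_mat (col_elem n k u * col_elem n k v) = row_elem n k v * row_elem n k u"
    by (simp add: transpose_mult[of _ n n _ n] transpose_col_elem)
  also have "\<dots> = transpose_mat (col_elem n k (\<lambda>i. u i + v i))"
    using assms by (simp add: row_elem_add transpose_col_elem add.commute)
  finally show ?thesis by (metis transpose_transpose)
qed

lemma col_elem_zero: "col_elem n k (\<lambda>_. 0) = 1\<^sub>m n"
  by (auto simp: col_elem_def)

lemma elem_group_mult:
  assumes "A \<in> elem_group n" "B \<in> elem_group n"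
  shows "A * B \<in> elem_group n"
  using assms
proof (induction rule: elem_group.induct)
  case one
  then show ?case using elem_group_carrier[of B n] by (simp add: left_mult_one_mat[of B n n])
next
  case (col k A v)
  then show ?case
    by (auto simp: assoc_mult_mat[of _ n n _ n _ n] intro: elem_group.col)
next
  case (row k A v)
  then show ?case
    by (auto simp: assoc_mult_mat[of _ n n _ n _ n] intro: elem_group.row)
qed

lemma col_elem_mem: "k < n \<Longrightarrow> col_elem n k v \<in> elem_group n"
  using elem_group.col[OF _ elem_group.one, of k n v] by simp

lemma row_elem_mem: "k < n \<Longrightarrow> row_elem n k v \<in> elem_group n"
  using elem_group.row[OF _ elem_group.one, of k n v] by simp

lemma elem_group_GL: "A \<in> elem_group n \<Longrightarrow> A \<in> GL_set n"
proof (induction rule: elem_group.induct)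
  case one
  show ?case by (rule GL_one)
next
  case (col k A v)
  have "col_elem n k v \<in> GL_set n"
    using col_elem_add[OF col(1), of v "\<lambda>i. - v i"] col_elem_add[OF col(1), of "\<lambda>i. - v i" v]
    by (auto simp: GL_set_def invertible_mat_def inverts_mat_def col_elem_zero intro!: exI[of _ "col_elem n k (\<lambda>i. - v i)"])
  then show ?case using col by (intro GL_mult)
next
  case (row k A v)
  have "row_elem n k v \<in> GL_set n"
    using row_elem_add[OF row(1), of v "\<lambda>i. - v i"] row_elem_add[OF row(1), of "\<lambda>i. - v i" v]
    by (auto simp: GL_set_def invertible_mat_def inverts_mat_def row_elem_zero intro!: exI[of _ "row_elem n k (\<lambda>i. - v i)"])
  then show ?case using row by (intro GL_mult)
qed

lemma elem_group_left_inverse: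
  "S \<in> elem_group n \<Longrightarrow> \<exists>S'\<in>elem_group n. S' * S = 1\<^sub>m n"
proof (induction rule: elem_group.induct)
  case one
  show ?case by (intro bexI[of _ "1\<^sub>m n"]) (auto intro: elem_group.one)
next
  case (col k A v)
  then obtain A' where A': "A' \<in> elem_group n" "A' * A = 1\<^sub>m n" by blast
  note m = col_elem_mem[OF col(1), of "\<lambda>i. - v i"]
  have "(A' * col_elem n k (\<lambda>i. - v i)) * (col_elem n k v * A) = A' * (col_elem n k (\<lambda>i. - v i) * col_elem n k v) * A"
    using A' col(2) by (simp add: assoc_mult_mat[of _ n n _ n _ n] mult_carrier_mat[of _ n n _ n])
  also have "\<dots> = 1\<^sub>m n" using A' col by (simp add: col_elem_add col_elem_zero right_mult_one_mat[of A' n n])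
  finally show ?case using elem_group_mult[OF A'(1) m] by blast
next
  case (row k A v)
  then obtain A' where A': "A' \<in> elem_group n" "A' * A = 1\<^sub>m n" by blast
  note m = row_elem_mem[OF row(1), of "\<lambda>i. - v i"]
  have "(A' * row_elem n k (\<lambda>i. - v i)) * (row_elem n k v * A) = A' * (row_elem n k (\<lambda>i. - v i) * row_elem n k v) * A"
    using A' row(2) by (simp add: assoc_mult_mat[of _ n n _ n _ n] mult_carrier_mat[of _ n n _ n])
  also have "\<dots> = 1\<^sub>m n" using A' row by (simp add: row_elem_add row_elem_zero right_mult_one_mat[of A' n n])
  finally show ?case using elem_group_mult[OF A'(1) m] by blast
qed

lemma dilation_mult: "dilation n k a * dilation n k b = dilation n k (a * b)"
  by (rule eq_matI) (auto simp: index_mult_dilation simp del: index_mult_mat(1), auto simp: dilation_def)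

lemma dilation_one: "dilation n k 1 = 1\<^sub>m n"
  by (auto simp: dilation_def)

lemma dilation_GL: "a \<noteq> 0 \<Longrightarrow> dilation n k a \<in> GL_set n"
  using dilation_mult[of n k a "1 / a"] dilation_mult[of n k "1 / a" a]
  by (auto simp: GL_set_def invertible_mat_def inverts_mat_def dilation_one intro!: exI[of _ "dilation n k (1 / a)"])

lemma dilation_conj_row_elem:
  assumes "k < n" "a \<noteq> 0"
  shows "dilation n k a * row_elem n k v * dilation n k (1 / a) = row_elem n k (\<lambda>i. a * v i)"
  by (rule eq_matI)
     (use assms in \<open>auto simp: index_mult_dilation[OF mult_carrier_mat[of _ n n _ n]] index_dilation_mult simp del: index_mult_mat(1)\<close>,
      use assms in \<open>auto simp: row_elem_def\<close>)

lemma dilation_conj_col_elem: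
  assumes "k < n" "a \<noteq> 0"
  shows "dilation n k a * col_elem n k v * dilation n k (1 / a) = col_elem n k (\<lambda>i. v i / a)"
  by (rule eq_matI)
     (use assms in \<open>auto simp: index_mult_dilation[OF mult_carrier_mat[of _ n n _ n]] index_dilation_mult simp del: index_mult_mat(1)\<close>,
      use assms in \<open>auto simp: col_elem_def\<close>)

text \<open>Conjugation by a dilation at \<open>k\<close> rescales \<open>v\<close> by \<open>1 / a\<close> or \<open>a\<close>. As \<open>a \<noteq> 1\<close>, every generator is
  therefore a quotient of a generator and its conjugate, and \<open>c\<close> does not distinguish these two.\<close>

lemma character_elem_group_trivial:
  fixes c :: "'a::field mat \<Rightarrow> 'b::field"
  assumes a: "a \<noteq> 0" "a \<noteq> (1::'a)"
    and mult: "\<And>A B. A \<in> elem_group n \<Longrightarrow> B \<in> elem_group n \<Longrightarrow> c (A * B) = c A * c B"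
    and nonzero: "\<And>A. A \<in> elem_group n \<Longrightarrow> c A \<noteq> 0"
    and conj: "\<And>k A. k < n \<Longrightarrow> A \<in> elem_group n \<Longrightarrow> c (dilation n k a * A * dilation n k (1 / a)) = c A"
    and A: "A \<in> elem_group n"
  shows "c A = 1"
proof -
  have col1: "c (col_elem n k v) = 1" if k: "k < n" for k v
  proof -
    \<comment> \<open>chosen to solve \<open>u / a = u + v\<close>\<close>
    define u where "u i = v i * a / (1 - a)" for i
    have "(\<lambda>i. u i / a) = (\<lambda>i. u i + v i)" using a by (auto simp: u_def fun_eq_iff field_simps)
    then have "c (col_elem n k u) = c (col_elem n k u * col_elem n k v)"
      using conj[OF k col_elem_mem[OF k, of u]] a k by (simp add: dilation_conj_col_elem col_elem_add)
    then show ?thesis using mult[OF col_elem_mem[OF k] col_elem_mem[OF k], of u v] nonzero[OF col_elem_mem[OF k, of u]] by simp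
  qed
  have row1: "c (row_elem n k v) = 1" if k: "k < n" for k v
  proof -
    \<comment> \<open>chosen to solve \<open>a u = u + v\<close>\<close>
    define u where "u i = v i / (a - 1)" for i
    have "(\<lambda>i. a * u i) = (\<lambda>i. u i + v i)" using a by (auto simp: u_def fun_eq_iff field_simps)
    then have "c (row_elem n k u) = c (row_elem n k u * row_elem n k v)"
      using conj[OF k row_elem_mem[OF k, of u]] a k by (simp add: dilation_conj_row_elem row_elem_add)
    then show ?thesis using mult[OF row_elem_mem[OF k] row_elem_mem[OF k], of u v] nonzero[OF row_elem_mem[OF k, of u]] by simp
  qed
  show ?thesis using A
  proof (induction rule: elem_group.induct)
    case one
    show ?case using mult[OF elem_group.one elem_group.one] nonzero[OF elem_group.one] by simp
  qed (simp_all add: mult col1 row1 col_elem_mem row_elem_mem)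
qed

lemma det_elem_group:
  fixes a :: "'a::field"
  assumes "a \<noteq> 0" "a \<noteq> 1" "A \<in> elem_group n"
  shows "det (A :: 'a mat) = 1"
proof (rule character_elem_group_trivial[OF assms(1,2) _ _ _ assms(3)])
  fix A B :: "'a mat" assume "A \<in> elem_group n" "B \<in> elem_group n"
  then show "det (A * B) = det A * det B" by (intro det_mult[of _ n] elem_group_carrier)
next
  fix A :: "'a mat" assume "A \<in> elem_group n"
  then obtain B where "B \<in> GL_set n" "A * B = 1\<^sub>m n" using GL_inverse[OF elem_group_GL] by metis
  moreover from this have "det A * det B = 1"
    using det_mult[of A n B] elem_group_carrier[OF \<open>A \<in> elem_group n\<close>] by (simp add: GL_set_def)
  ultimately show "det A \<noteq> 0" by auto
next
  fix k and A :: "'a mat" assume k: "k < n" and A: "A \<in> elem_group n"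
  have "det (dilation n k a) * det (dilation n k (1 / a)) = 1"
    using det_mult[of "dilation n k a" n "dilation n k (1 / a)"] assms by (simp add: dilation_mult dilation_one)
  then show "det (dilation n k a * A * dilation n k (1 / a)) = det A"
    using elem_group_carrier[OF A] by (simp add: det_mult[of _ n] mult_carrier_mat[of _ n n _ n])
qed

section \<open>Diagonalisation by elementary matrices\<close>

text \<open>The index \<open>k\<close> splits off as a diagonal block of size one that is already in normal form.\<close>

definition cleared :: "nat \<Rightarrow> 'a::field mat \<Rightarrow> nat \<Rightarrow> bool" where
  "cleared n C k \<longleftrightarrow> (\<forall>j<n. j \<noteq> k \<longrightarrow> C $$ (k, j) = 0 \<and> C $$ (j, k) = 0) \<and> C $$ (k, k) \<in> {0, 1}"

definition elem_equiv :: "nat \<Rightarrow> 'a::field mat \<Rightarrow> 'a mat \<Rightarrow> bool" where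
  "elem_equiv n C D \<longleftrightarrow> (\<exists>S\<in>elem_group n. \<exists>T\<in>elem_group n. D = S * C * T)"

lemma elem_equiv_refl: "C \<in> carrier_mat n n \<Longrightarrow> elem_equiv n C C"
  unfolding elem_equiv_def by (intro bexI[of _ "1\<^sub>m n"]) (auto intro: elem_group.one)

lemma elem_equiv_trans:
  assumes "C \<in> carrier_mat n n" "elem_equiv n C D" "elem_equiv n D E"
  shows "elem_equiv n C E"
proof -
  obtain S T S' T' where *: "S \<in> elem_group n" "T \<in> elem_group n" "D = S * C * T"
     "S' \<in> elem_group n" "T' \<in> elem_group n" "E = S' * D * T'"
    using assms unfolding elem_equiv_def by blast
  then have "E = (S' * S) * C * (T * T')"
    using assms(1) by (simp add: assoc_mult_mat[of _ n n _ n _ n] mult_carrier_mat[of _ n n _ n])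
  then show ?thesis unfolding elem_equiv_def using * elem_group_mult by blast
qed

lemma elem_equiv_carrier: "elem_equiv n C D \<Longrightarrow> C \<in> carrier_mat n n \<Longrightarrow> D \<in> carrier_mat n n"
  unfolding elem_equiv_def using elem_group_carrier by (auto intro!: mult_carrier_mat)

lemma elem_equiv_row: "C \<in> carrier_mat n n \<Longrightarrow> k < n \<Longrightarrow> elem_equiv n C (C * row_elem n k v)"
  unfolding elem_equiv_def
  by (intro bexI[of _ "1\<^sub>m n"] bexI[of _ "row_elem n k v"]) (auto intro: elem_group.one row_elem_mem)

lemma elem_equiv_col: "C \<in> carrier_mat n n \<Longrightarrow> k < n \<Longrightarrow> elem_equiv n C (col_elem n k v * C)"
  unfolding elem_equiv_def
  by (intro bexI[of _ "1\<^sub>m n"] bexI[of _ "col_elem n k v"]) (auto intro: elem_group.one col_elem_mem)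

text \<open>The indices in \<open>K\<close> are those at which progress may be lost.\<close>

definition preserves_cleared :: "nat \<Rightarrow> nat set \<Rightarrow> 'a::field mat \<Rightarrow> 'a mat \<Rightarrow> bool" where
  "preserves_cleared n K C D \<longleftrightarrow> (\<forall>i<n. i \<notin> K \<longrightarrow> cleared n C i \<longrightarrow> cleared n D i)"

text \<open>A multiple of column \<open>j\<close> is added to column \<open>k\<close>. The index \<open>j\<close> is not cleared, because of its
  entry in row \<open>k\<close>, and a cleared index \<open>i \<noteq> k\<close> has a zero in column \<open>j\<close>, so its row and column stay
  as they are.\<close>

lemma pivot_from_row:
  assumes C: "C \<in> carrier_mat n n" and kj: "k < n" "j < n" "j \<noteq> k" "C $$ (k, j) \<noteq> 0"
  shows "\<exists>D. elem_equiv n C D \<and> D $$ (k, k) = 1 \<and> preserves_cleared n {k} C D"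
proof (intro exI conjI)
  define v where "v t = (if t = k then (1 - C $$ (k, k)) / C $$ (k, j) else 0)" for t
  let ?D = "C * row_elem n j v"
  show "elem_equiv n C ?D" using C kj by (intro elem_equiv_row)
  have e: "?D $$ (i, t) = C $$ (i, t) + (if t = k then C $$ (i, j) * v k else 0)" if "i < n" "t < n" for i t
    using index_mult_row_elem[OF C that kj(2), of v] kj by (auto simp: v_def)
  show "?D $$ (k, k) = 1" using e[of k k] kj by (simp add: v_def)
  show "preserves_cleared n {k} C ?D"
    unfolding preserves_cleared_def
  proof (intro allI impI)
    fix i assume i: "i < n" "i \<notin> {k}" "cleared n C i"
    then have "i \<noteq> j" "C $$ (i, j) = 0" using kj by (auto simp: cleared_def)
    then show "cleared n ?D i" using i kj by (auto simp: cleared_def e simp del: index_mult_mat(1))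
  qed
qed

lemma pivot_from_col:
  assumes C: "C \<in> carrier_mat n n" and kj: "k < n" "j < n" "j \<noteq> k" "C $$ (j, k) \<noteq> 0"
  shows "\<exists>D. elem_equiv n C D \<and> D $$ (k, k) = 1 \<and> preserves_cleared n {k} C D"
proof (intro exI conjI)
  define v where "v t = (if t = k then (1 - C $$ (k, k)) / C $$ (j, k) else 0)" for t
  let ?D = "col_elem n j v * C"
  show "elem_equiv n C ?D" using C kj by (intro elem_equiv_col)
  have e: "?D $$ (i, t) = C $$ (i, t) + (if i = k then C $$ (j, t) * v k else 0)" if "i < n" "t < n" for i t
    using index_mult_col_elem[OF C that kj(2), of v] kj by (auto simp: v_def)
  show "?D $$ (k, k) = 1" using e[of k k] kj by (simp add: v_def)
  show "preserves_cleared n {k} C ?D"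
    unfolding preserves_cleared_def
  proof (intro allI impI)
    fix i assume i: "i < n" "i \<notin> {k}" "cleared n C i"
    then have "i \<noteq> j" "C $$ (j, i) = 0" using kj by (auto simp: cleared_def)
    then show "cleared n ?D i" using i kj by (auto simp: cleared_def e simp del: index_mult_mat(1))
  qed
qed

lemma preserves_cleared_trans:
  "preserves_cleared n K C D \<Longrightarrow> preserves_cleared n L D E \<Longrightarrow> preserves_cleared n (K \<union> L) C E"
  by (auto simp: preserves_cleared_def)

text \<open>If row and column \<open>k\<close> vanish off the diagonal, adding column \<open>k\<close> to column \<open>l\<close> creates a nonzero
  entry beside the diagonal. The index
  \<open>l\<close> serves as scratch space.\<close>

lemma pivot:
  assumes C: "C \<in> carrier_mat n n" and k: "k < n" "l < n" "l \<noteq> k" "\<not> cleared n C k"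
  shows "\<exists>D. elem_equiv n C D \<and> D $$ (k, k) = 1 \<and> preserves_cleared n {k, l} C D"
proof -
  have weaken: "preserves_cleared n {k, l} C D" if "preserves_cleared n {k} C D" for D
    using that by (auto simp: preserves_cleared_def)
  show ?thesis
  proof (cases "\<exists>j<n. j \<noteq> k \<and> (C $$ (k, j) \<noteq> 0 \<or> C $$ (j, k) \<noteq> 0)")
    case True
    then show ?thesis
      using pivot_from_row[OF C k(1)] pivot_from_col[OF C k(1)] weaken by metis
  next
    case False
    then have c: "C $$ (k, k) \<noteq> 0" using k by (auto simp: cleared_def)
    define v where "v t = (if t = l then 1 else 0 :: 'a)" for t
    let ?D = "C * row_elem n k v"
    have D: "elem_equiv n C ?D" using C k by (intro elem_equiv_row)
    have e: "?D $$ (i, t) = C $$ (i, t) + (if t = l then C $$ (i, k) else 0)" if "i < n" "t < n" for i t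
      using index_mult_row_elem[OF C that k(1), of v] k by (auto simp: v_def)
    have p: "preserves_cleared n {l} C ?D"
      unfolding preserves_cleared_def
    proof (intro allI impI)
      fix i assume i: "i < n" "i \<notin> {l}" "cleared n C i"
      then have "i \<noteq> k" "C $$ (i, k) = 0" using k by (auto simp: cleared_def)
      then show "cleared n ?D i" using i k by (auto simp: cleared_def e simp del: index_mult_mat(1))
    qed
    have "?D $$ (k, l) \<noteq> 0" using e[of k l] k c False by auto
    from pivot_from_row[OF elem_equiv_carrier[OF D C] k(1-3) this]
    obtain E where E: "elem_equiv n ?D E" "E $$ (k, k) = 1" "preserves_cleared n {k} ?D E" by blast
    then show ?thesis
      using elem_equiv_trans[OF C D E(1)] preserves_cleared_trans[OF p E(3)]
      by (auto simp: insert_commute)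
  qed
qed

lemma clear_by_pivot:
  assumes C: "C \<in> carrier_mat n n" and k: "k < n" "C $$ (k, k) = 1"
  shows "\<exists>D. elem_equiv n C D \<and> cleared n D k \<and> preserves_cleared n {k} C D"
proof (intro exI conjI)
  let ?D = "C * row_elem n k (\<lambda>j. - C $$ (k, j))"
  let ?E = "col_elem n k (\<lambda>i. - C $$ (i, k)) * ?D"
  have D: "?D \<in> carrier_mat n n" using C by (auto intro: mult_carrier_mat)
  show "elem_equiv n C ?E"
    using elem_equiv_trans[OF C elem_equiv_row[OF C k(1)] elem_equiv_col[OF D k(1)]] .
  have e: "?E $$ (i, j) = (if i = k then if j = k then 1 else 0 else if j = k then 0 else C $$ (i, j) - C $$ (i, k) * C $$ (k, j))"
    if "i < n" "j < n" for i j
    using index_mult_col_elem[OF D that k(1)] index_mult_row_elem[OF C that k(1)]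
      index_mult_row_elem[OF C k(1) that(2) k(1)] k(2) by (simp del: index_mult_mat(1))
  show "cleared n ?E k" using k by (auto simp: cleared_def e simp del: index_mult_mat(1))
  show "preserves_cleared n {k} C ?E"
    using k by (auto simp: preserves_cleared_def cleared_def e simp del: index_mult_mat(1))
qed

text \<open>One diagonal entry must stay arbitrary, because elementary matrices do not change the determinant.
  Its position \<open>l\<close> is free; characters of the Levi subgroup are later compared with the action of a
  double coset representative, and for this \<open>l\<close> has to be an index that the representative moves.\<close>

lemma diagonalise:
  fixes C :: "'a::field mat"
  assumes "C \<in> carrier_mat n n" "l < n"
  shows "\<exists>D. elem_equiv n C D \<and> (\<forall>k<n. k \<noteq> l \<longrightarrow> cleared n D k)"
  using assms
proof (induction "card {k. k < n \<and> k \<noteq> l \<and> \<not> cleared n C k}" arbitrary: C rule: less_induct)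
  case less
  let ?bad = "\<lambda>C. {k. k < n \<and> k \<noteq> l \<and> \<not> cleared n C k}"
  show ?case
  proof (cases "?bad C = {}")
    case True
    then show ?thesis using elem_equiv_refl[OF less.prems(1)] by blast
  next
    case False
    then obtain k where k: "k < n" "k \<noteq> l" "\<not> cleared n C k" by blast
    obtain D where D: "elem_equiv n C D" "D $$ (k, k) = 1" "preserves_cleared n {k, l} C D"
      using pivot[OF less.prems(1) k(1) less.prems(2) _ k(3)] k(2) by metis
    note Dc = elem_equiv_carrier[OF D(1) less.prems(1)]
    obtain E where E: "elem_equiv n D E" "cleared n E k" "preserves_cleared n {k} D E"
      using clear_by_pivot[OF Dc k(1) D(2)] by blast
    note CE = elem_equiv_trans[OF less.prems(1) D(1) E(1)]
    have "?bad E \<subset> ?bad C"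
      using D(3) E(2,3) k by (auto simp: preserves_cleared_def)
    then have "card (?bad E) < card (?bad C)" by (intro psubset_card_mono) auto
    from less.hyps[OF this elem_equiv_carrier[OF CE less.prems(1)] less.prems(2)]
    show ?thesis using elem_equiv_trans[OF less.prems(1) CE] by blast
  qed
qed

text \<open>For invertible \<open>A\<close> the diagonal form has no zero on the diagonal, so all entries but the one at \<open>l\<close>
  are \<open>1\<close>, and that entry is the determinant.\<close>

lemma elem_dilation_decomposition:
  fixes A :: "'a::field mat"
  assumes a: "a \<noteq> 0" "a \<noteq> (1::'a)" and A: "A \<in> GL_set n" and l: "l < n"
  obtains S T where "S \<in> elem_group n" "T \<in> elem_group n" "A = S * dilation n l (det A) * T"
proof -
  have Ac: "A \<in> carrier_mat n n" using A by (simp add: GL_set_def)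
  obtain D where D: "elem_equiv n A D" "\<And>k. k < n \<Longrightarrow> k \<noteq> l \<Longrightarrow> cleared n D k"
    using diagonalise[OF Ac l] by blast
  then obtain S T where ST: "S \<in> elem_group n" "T \<in> elem_group n" "D = S * A * T"
    unfolding elem_equiv_def by blast
  note c = elem_group_carrier[OF ST(1)] elem_group_carrier[OF ST(2)] Ac
  have Dc: "D \<in> carrier_mat n n" using elem_equiv_carrier[OF D(1) Ac] .
  have detD: "det D = det A"
    using ST c by (simp add: det_mult[of _ n] det_elem_group[OF a])
  have "det A \<noteq> 0"
  proof -
    obtain B where "B \<in> GL_set n" "A * B = 1\<^sub>m n" using GL_inverse[OF A] by metis
    then have "det A * det B = 1" using det_mult[OF Ac, of B] by (simp add: GL_set_def)
    then show ?thesis by auto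
  qed
  have off: "D $$ (i, j) = 0" if "i < n" "j < n" "i \<noteq> j" for i j
    using D(2)[of i] D(2)[of j] that unfolding cleared_def by (cases "i = l") auto
  have "upper_triangular D" using off Dc by (auto simp: upper_triangular_def)
  then have detp: "det D = (\<Prod>i<n. D $$ (i, i))"
    using det_upper_triangular[OF _ Dc] Dc by (simp add: prod_list_diag_prod lessThan_atLeast0)
  have one: "D $$ (i, i) = 1" if "i < n" "i \<noteq> l" for i
  proof -
    have "D $$ (i, i) \<noteq> 0" using detp detD \<open>det A \<noteq> 0\<close> that by auto
    then show ?thesis using D(2)[OF that] by (simp add: cleared_def)
  qed
  have "det D = D $$ (l, l)"
    unfolding detp using l one by (subst prod.remove[of _ l]) (auto intro!: prod.neutral)
  then have D_eq: "D = dilation n l (det A)"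
    using detD off one Dc by (intro eq_matI) (auto simp: dilation_def)
  obtain S' T' where S': "S' \<in> elem_group n" "S' * S = 1\<^sub>m n" and T': "T' \<in> elem_group n" "T' * T = 1\<^sub>m n"
    using ST elem_group_left_inverse by metis
  have "T * T' = 1\<^sub>m n"
    using mat_mult_left_right_inverse[OF elem_group_carrier[OF T'(1)] c(2) T'(2)] .
  have "S' * D * T' = (S' * S) * A * (T * T')"
    using c S'(1) T'(1) unfolding ST(3)
    by (simp add: assoc_mult_mat[of _ n n _ n _ n] mult_carrier_mat[of _ n n _ n])
  also have "\<dots> = A" using S' \<open>T * T' = 1\<^sub>m n\<close> Ac by simp
  finally show thesis using that[OF S'(1) T'(1)] D_eq by simp
qed

definition coord_proj :: "nat \<Rightarrow> nat set \<Rightarrow> 'a::field mat" where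
  "coord_proj n I = mat n n (\<lambda>(i, j). if i = j \<and> i \<in> I then 1 else 0)"

text \<open>A dilation turns the remaining arbitrary entry of the diagonal form, if nonzero, into \<open>1\<close>.\<close>

lemma rank_normal_form:
  fixes C :: "'a::field mat"
  assumes C: "C \<in> carrier_mat n n" and n: "n > 0"
  obtains X Y I where "X \<in> GL_set n" "Y \<in> GL_set n" "X * C * Y = coord_proj n I"
proof -
  obtain D where D: "elem_equiv n C D" "\<And>k. k < n \<Longrightarrow> k \<noteq> 0 \<Longrightarrow> cleared n D k"
    using diagonalise[OF C n] by blast
  then obtain S T where ST: "S \<in> elem_group n" "T \<in> elem_group n" "D = S * C * T"
    unfolding elem_equiv_def by blast
  note c = elem_group_carrier[OF ST(1)] elem_group_carrier[OF ST(2)] C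
  have Dc: "D \<in> carrier_mat n n" using elem_equiv_carrier[OF D(1) C] .
  define d where "d = (if D $$ (0, 0) = 0 then 1 else 1 / D $$ (0, 0))"
  have "d \<noteq> 0" by (simp add: d_def)
  have off: "D $$ (i, j) = 0" if "i < n" "j < n" "i \<noteq> j" for i j
    using D(2)[of i] D(2)[of j] that unfolding cleared_def by (cases "i = 0") auto
  have on: "D $$ (i, i) \<in> {0, 1}" if "i < n" "i \<noteq> 0" for i
    using D(2)[OF that] by (simp add: cleared_def)
  have "(dilation n 0 d * S) * C * T = dilation n 0 d * D"
    using c ST by (simp add: assoc_mult_mat[of _ n n _ n _ n] mult_carrier_mat[of _ n n _ n])
  also have "\<dots> = coord_proj n {i. D $$ (i, i) \<noteq> 0}"
  proof (rule eq_matI)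
    fix i j assume "i < dim_row (coord_proj n {i. D $$ (i, i) \<noteq> 0} :: 'a mat)" "j < dim_col (coord_proj n {i. D $$ (i, i) \<noteq> 0} :: 'a mat)"
    then have ij: "i < n" "j < n" by (auto simp: coord_proj_def)
    then show "(dilation n 0 d * D) $$ (i, j) = coord_proj n {i. D $$ (i, i) \<noteq> 0} $$ (i, j)"
      using index_dilation_mult[OF Dc ij, of 0 d] off[OF ij] on[of i]
      by (cases "i = j") (auto simp: coord_proj_def d_def simp del: index_mult_mat(1))
  qed (use Dc in \<open>auto simp: coord_proj_def\<close>)
  finally show thesis
    using that GL_mult[OF dilation_GL[OF \<open>d \<noteq> 0\<close>] elem_group_GL[OF ST(1)]] elem_group_GL[OF ST(2)] by blast
qed

section \<open>Block matrices\<close>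

lemma smult_smult_mat: "a \<cdot>\<^sub>m (b \<cdot>\<^sub>m (A :: 'a::field mat)) = (a * b) \<cdot>\<^sub>m A"
  by (auto intro!: eq_matI)

lemma smult_zero_mat: "a \<cdot>\<^sub>m (0\<^sub>m nr nc :: 'a::field mat) = 0\<^sub>m nr nc"
  by (auto intro!: eq_matI)

lemma smult_add_mat:
  "A \<in> carrier_mat nr nc \<Longrightarrow> B \<in> carrier_mat nr nc \<Longrightarrow> a \<cdot>\<^sub>m (A + B) = a \<cdot>\<^sub>m A + a \<cdot>\<^sub>m (B :: 'a::field mat)"
  by (auto intro!: eq_matI simp: algebra_simps)

lemma transpose_smult_mat: "transpose_mat (a \<cdot>\<^sub>m A) = a \<cdot>\<^sub>m transpose_mat (A :: 'a::field mat)"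
  by (auto intro!: eq_matI)

lemmas square_simps =
  assoc_mult_mat[of _ n n _ n _ n] mult_carrier_mat[of _ n n _ n]
  add_mult_distrib_mat[of _ n n _ _ n] mult_add_distrib_mat[of _ n n _ n]
  mult_smult_distrib[of _ n n _ n] mult_smult_assoc_mat[of _ n n _ n]
  left_mult_one_mat[of _ n n] right_mult_one_mat[of _ n n]
  left_mult_zero_mat[of _ n n n] right_mult_zero_mat[of _ n n n]
  transpose_mult[of _ n n _ n] transpose_add[of _ n n] for n

lemma block_carrier [simp]:
  "A \<in> carrier_mat n n \<Longrightarrow> D \<in> carrier_mat n n \<Longrightarrow> four_block_mat A B C D \<in> carrier_mat (2 * n) (2 * n)"
  by (simp add: mult_2)

lemma block_cases:
  assumes "g \<in> carrier_mat (2 * n) (2 * n)"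
  obtains A B C D where "A \<in> carrier_mat n n" "B \<in> carrier_mat n n" "C \<in> carrier_mat n n" "D \<in> carrier_mat n n"
    "g = four_block_mat A B C D"
proof -
  obtain A B C D where s: "split_block g n n = (A, B, C, D)" by (metis prod_cases4)
  show thesis by (rule that[OF split_block[OF s, of n n]]) (use assms in auto)
qed

lemma block_inject:
  assumes "A \<in> carrier_mat n n" "B \<in> carrier_mat n n" "C \<in> carrier_mat n n" "D \<in> carrier_mat n n"
    "A' \<in> carrier_mat n n" "B' \<in> carrier_mat n n" "C' \<in> carrier_mat n n" "D' \<in> carrier_mat n n"
  shows "four_block_mat A B C D = four_block_mat A' B' C' D' \<longleftrightarrow> A = A' \<and> B = B' \<and> C = C' \<and> D = D'"
proof
  assume e: "four_block_mat A B C D = four_block_mat A' B' C' D'"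
  have "A $$ (i, j) = A' $$ (i, j)" "B $$ (i, j) = B' $$ (i, j)"
       "C $$ (i, j) = C' $$ (i, j)" "D $$ (i, j) = D' $$ (i, j)" if "i < n" "j < n" for i j
    using arg_cong[OF e, of "\<lambda>M. M $$ (i, j)"] arg_cong[OF e, of "\<lambda>M. M $$ (i, n + j)"]
      arg_cong[OF e, of "\<lambda>M. M $$ (n + i, j)"] arg_cong[OF e, of "\<lambda>M. M $$ (n + i, n + j)"] that assms
    by auto
  then show "A = A' \<and> B = B' \<and> C = C' \<and> D = D'" using assms by (auto intro!: eq_matI)
qed auto

lemma block_mult:
  assumes "A \<in> carrier_mat n n" "B \<in> carrier_mat n n" "C \<in> carrier_mat n n" "D \<in> carrier_mat n n"
    "A' \<in> carrier_mat n n" "B' \<in> carrier_mat n n" "C' \<in> carrier_mat n n" "D' \<in> carrier_mat n n"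
  shows "four_block_mat A B C D * four_block_mat A' B' C' D' =
    four_block_mat (A * A' + B * C') (A * B' + B * D') (C * A' + D * C') (C * B' + D * D')"
  by (rule mult_four_block_mat[of _ n n _ n _ n _ _ n _ n]) (use assms in auto)

lemma block_transpose:
  assumes "A \<in> carrier_mat n n" "B \<in> carrier_mat n n" "C \<in> carrier_mat n n" "D \<in> carrier_mat n n"
  shows "transpose_mat (four_block_mat A B C D) =
    four_block_mat (transpose_mat A) (transpose_mat C) (transpose_mat B) (transpose_mat D)"
  by (rule transpose_four_block_mat) (use assms in auto)

lemma block_smult:
  assumes "A \<in> carrier_mat n n" "B \<in> carrier_mat n n" "C \<in> carrier_mat n n" "D \<in> carrier_mat n n"
  shows "a \<cdot>\<^sub>m four_block_mat A B C D = four_block_mat (a \<cdot>\<^sub>m A) (a \<cdot>\<^sub>m B) (a \<cdot>\<^sub>m C) (a \<cdot>\<^sub>m D)"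
  by (rule smult_four_block_mat) (use assms in auto)

lemma block_one: "four_block_mat (1\<^sub>m n) (0\<^sub>m n n) (0\<^sub>m n n) (1\<^sub>m n) = 1\<^sub>m (2 * n)"
  by (auto intro!: eq_matI)

lemma GL_iff_det: "g \<in> GL_set m \<longleftrightarrow> g \<in> carrier_mat m m \<and> det g \<noteq> (0::'a::field)"
proof
  assume g: "g \<in> GL_set m"
  then obtain h where "h \<in> GL_set m" "g * h = 1\<^sub>m m" by (rule GL_inverse)
  then have "det g * det h = 1" using g det_mult[of g m h] by (simp add: GL_set_def)
  then show "g \<in> carrier_mat m m \<and> det g \<noteq> 0" using g by (auto simp: GL_set_def)
next
  assume g: "g \<in> carrier_mat m m \<and> det g \<noteq> 0"
  then obtain h where "h \<in> carrier_mat m m" "h * g = 1\<^sub>m m" "g * h = 1\<^sub>m m"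
    using det_non_zero_imp_unit[of g m "()"] by (auto simp: Units_def ring_mat_def)
  then show "g \<in> GL_set m"
    using g by (auto simp: GL_set_def invertible_mat_def inverts_mat_def intro!: exI[of _ h])
qed

lemma GL_carrier: "g \<in> GL_set m \<Longrightarrow> g \<in> carrier_mat m m"
  by (simp add: GL_set_def)

lemma det_block_triangular:
  fixes A :: "'a::field mat"
  assumes "A \<in> carrier_mat n n" "B \<in> carrier_mat n n" "D \<in> carrier_mat n n"
  shows "det (four_block_mat A B (0\<^sub>m n n) D) = det A * det D"
  by (rule det_four_block_mat_lower_left_zero) (use assms in auto)

lemma block_triangular_GL:
  fixes A :: "'a::field mat"
  assumes "A \<in> carrier_mat n n" "B \<in> carrier_mat n n" "D \<in> carrier_mat n n"
  shows "four_block_mat A B (0\<^sub>m n n) D \<in> GL_set (2 * n) \<longleftrightarrow> A \<in> GL_set n \<and> D \<in> GL_set n"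
  using assms by (simp add: GL_iff_det det_block_triangular)

text \<open>The inverse transpose.\<close>

definition dual_mat :: "nat \<Rightarrow> 'a::field mat \<Rightarrow> 'a mat" where
  "dual_mat n A = (SOME B. B \<in> carrier_mat n n \<and> transpose_mat A * B = 1\<^sub>m n)"

lemma transpose_GL: "A \<in> GL_set n \<Longrightarrow> transpose_mat A \<in> GL_set n"
  by (auto simp: GL_iff_det det_transpose[of A n])

lemma dual_mat:
  assumes "A \<in> GL_set n"
  shows "dual_mat n A \<in> GL_set n" "transpose_mat A * dual_mat n A = 1\<^sub>m n"
    "dual_mat n A * transpose_mat A = 1\<^sub>m n"
    "transpose_mat (dual_mat n A) * A = 1\<^sub>m n" "A * transpose_mat (dual_mat n A) = 1\<^sub>m n"
proof -
  have A: "A \<in> carrier_mat n n" using assms by (rule GL_carrier)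
  obtain B where "B \<in> GL_set n" "transpose_mat A * B = 1\<^sub>m n"
    using GL_inverse[OF transpose_GL[OF assms]] by metis
  then have "\<exists>B. B \<in> carrier_mat n n \<and> transpose_mat A * B = 1\<^sub>m n" using GL_carrier by blast
  from someI_ex[OF this] have d: "dual_mat n A \<in> carrier_mat n n" and 1: "transpose_mat A * dual_mat n A = 1\<^sub>m n"
    unfolding dual_mat_def by auto
  have 2: "dual_mat n A * transpose_mat A = 1\<^sub>m n"
    by (rule mat_mult_left_right_inverse[OF _ d 1]) (use A in simp)
  have "det (transpose_mat A) * det (dual_mat n A) = 1"
    using det_mult[of "transpose_mat A" n "dual_mat n A"] A d 1 by simp
  then show "dual_mat n A \<in> GL_set n" using d by (auto simp: GL_iff_det)
  show "transpose_mat A * dual_mat n A = 1\<^sub>m n" "dual_mat n A * transpose_mat A = 1\<^sub>m n" by fact+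
  show "transpose_mat (dual_mat n A) * A = 1\<^sub>m n"
    using arg_cong[OF 1, of transpose_mat] A d by (simp add: transpose_mult[of _ n n _ n])
  show "A * transpose_mat (dual_mat n A) = 1\<^sub>m n"
    using arg_cong[OF 2, of transpose_mat] A d by (simp add: transpose_mult[of _ n n _ n])
qed

lemma dual_mat_unique:
  assumes A: "A \<in> GL_set n" and B: "B \<in> carrier_mat n n" "transpose_mat A * B = 1\<^sub>m n"
  shows "dual_mat n A = B"
proof -
  note d = dual_mat[OF A] and c = GL_carrier[OF A] GL_carrier[OF dual_mat(1)[OF A]]
  have "dual_mat n A * (transpose_mat A * B) = (dual_mat n A * transpose_mat A) * B"
    using c B by (simp add: square_simps[where n = n])
  then show ?thesis using d B c by simp
qed

lemma dual_mat_mult: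
  assumes A: "A \<in> GL_set n" and B: "B \<in> GL_set n"
  shows "dual_mat n (A * B) = dual_mat n A * dual_mat n B"
proof (rule dual_mat_unique[OF GL_mult[OF A B]])
  note c = GL_carrier[OF A] GL_carrier[OF dual_mat(1)[OF A]] GL_carrier[OF B] GL_carrier[OF dual_mat(1)[OF B]]
  show "dual_mat n A * dual_mat n B \<in> carrier_mat n n" using c by (simp add: square_simps[where n = n])
  have "transpose_mat (A * B) * (dual_mat n A * dual_mat n B) =
        transpose_mat B * (transpose_mat A * dual_mat n A) * dual_mat n B"
    using c by (simp add: square_simps[where n = n])
  then show "transpose_mat (A * B) * (dual_mat n A * dual_mat n B) = 1\<^sub>m n"
    using c dual_mat[OF A] dual_mat[OF B] by (simp add: square_simps[where n = n])
qed

lemma dual_mat_dual: "A \<in> GL_set n \<Longrightarrow> dual_mat n (dual_mat n A) = A"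
  using dual_mat[of A n] by (intro dual_mat_unique) (auto dest: GL_carrier)

lemma dual_mat_dilation: "a \<noteq> 0 \<Longrightarrow> dual_mat n (dilation n k a) = dilation n k (1 / a)"
  by (rule dual_mat_unique) (auto simp: dilation_GL transpose_dilation dilation_mult dilation_one)

section \<open>The classical groups in block form\<close>

definition has_form :: "group_kind \<Rightarrow> bool" where
  "has_form k \<longleftrightarrow> k \<notin> {KGL, KSL}"

lemma form_sign_square: "form_sign k * form_sign k = (1::'a::ring_1)"
  by (simp add: form_sign_def)

lemma mem_classical_form:
  assumes "has_form k"
  shows "g \<in> classical_set k n \<longleftrightarrow> g \<in> GL_set (2 * n) \<and>
    (\<exists>\<mu>. \<mu> \<noteq> 0 \<and> (k \<in> {KO, KSp} \<longrightarrow> \<mu> = 1) \<and> transpose_mat g * form_mat k n * g = \<mu> \<cdot>\<^sub>m form_mat k n)"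
  using assms by (cases k) (auto simp: has_form_def)

lemma mem_classical_linear:
  assumes "\<not> has_form k"
  shows "g \<in> classical_set k n \<longleftrightarrow> g \<in> GL_set (2 * n) \<and> (k = KSL \<longrightarrow> det g = 1)"
  using assms by (cases k) (auto simp: has_form_def)

lemma form_mat_block_iff:
  fixes A :: "'a::field mat" and k :: group_kind
  assumes c: "A \<in> carrier_mat n n" "B \<in> carrier_mat n n" "C \<in> carrier_mat n n" "D \<in> carrier_mat n n"
  defines "g \<equiv> four_block_mat A B C D"
  defines "\<epsilon> \<equiv> form_sign k :: 'a"
  shows "transpose_mat g * form_mat k n * g = \<mu> \<cdot>\<^sub>m form_mat k n \<longleftrightarrow>
    transpose_mat C * A + \<epsilon> \<cdot>\<^sub>m (transpose_mat A * C) = 0\<^sub>m n n \<and>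
    transpose_mat C * B + \<epsilon> \<cdot>\<^sub>m (transpose_mat A * D) = (\<mu> * \<epsilon>) \<cdot>\<^sub>m 1\<^sub>m n \<and>
    transpose_mat D * A + \<epsilon> \<cdot>\<^sub>m (transpose_mat B * C) = \<mu> \<cdot>\<^sub>m 1\<^sub>m n \<and>
    transpose_mat D * B + \<epsilon> \<cdot>\<^sub>m (transpose_mat B * D) = 0\<^sub>m n n"
proof -
  have J: "form_mat k n = four_block_mat (0\<^sub>m n n) (\<epsilon> \<cdot>\<^sub>m 1\<^sub>m n) (1\<^sub>m n) (0\<^sub>m n n)"
    by (simp add: form_mat_def \<epsilon>_def)
  have "transpose_mat g * form_mat k n = four_block_mat (transpose_mat C) (\<epsilon> \<cdot>\<^sub>m transpose_mat A) (transpose_mat D) (\<epsilon> \<cdot>\<^sub>m transpose_mat B)"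
    using c by (simp add: g_def J block_transpose[of _ n] block_mult[of _ n] square_simps[where n = n])
  then have "transpose_mat g * form_mat k n * g = four_block_mat
      (transpose_mat C * A + \<epsilon> \<cdot>\<^sub>m (transpose_mat A * C)) (transpose_mat C * B + \<epsilon> \<cdot>\<^sub>m (transpose_mat A * D))
      (transpose_mat D * A + \<epsilon> \<cdot>\<^sub>m (transpose_mat B * C)) (transpose_mat D * B + \<epsilon> \<cdot>\<^sub>m (transpose_mat B * D))"
    using c by (simp add: g_def block_mult[of _ n] square_simps[where n = n])
  moreover have "\<mu> \<cdot>\<^sub>m form_mat k n = four_block_mat (0\<^sub>m n n) ((\<mu> * \<epsilon>) \<cdot>\<^sub>m 1\<^sub>m n) (\<mu> \<cdot>\<^sub>m 1\<^sub>m n) (0\<^sub>m n n)"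
    by (simp add: J block_smult[of _ n] smult_smult_mat smult_zero_mat)
  ultimately show ?thesis
    using c by (simp add: block_inject[of _ n] square_simps[where n = n])
qed

definition levi :: "nat \<Rightarrow> 'a::field mat \<Rightarrow> 'a mat \<Rightarrow> 'a mat" where
  "levi n A D = four_block_mat A (0\<^sub>m n n) (0\<^sub>m n n) D"

definition unip :: "nat \<Rightarrow> 'a::field mat \<Rightarrow> 'a mat" where
  "unip n B = four_block_mat (1\<^sub>m n) B (0\<^sub>m n n) (1\<^sub>m n)"

lemma levi_mult:
  assumes "A \<in> carrier_mat n n" "D \<in> carrier_mat n n" "A' \<in> carrier_mat n n" "D' \<in> carrier_mat n n"
  shows "levi n A D * levi n A' D' = levi n (A * A') (D * D')"
  using assms by (simp add: levi_def block_mult[of _ n] square_simps[where n = n])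

lemma siegel_parabolic_block_iff:
  fixes A :: "'a::field mat"
  assumes "A \<in> carrier_mat n n" "B \<in> carrier_mat n n" "C \<in> carrier_mat n n" "D \<in> carrier_mat n n"
  shows "four_block_mat A B C D \<in> siegel_parabolic k n \<longleftrightarrow>
    four_block_mat A B C D \<in> classical_set k n \<and> C = 0\<^sub>m n n"
  using assms by (auto simp: siegel_parabolic_def block_inject[of _ n])

lemma siegel_parabolic_cases:
  assumes "p \<in> siegel_parabolic k n"
  obtains A B D where "A \<in> GL_set n" "B \<in> carrier_mat n n" "D \<in> GL_set n" "p = four_block_mat A B (0\<^sub>m n n) D"
proof -
  obtain A B D where *: "A \<in> carrier_mat n n" "B \<in> carrier_mat n n" "D \<in> carrier_mat n n"
    "p = four_block_mat A B (0\<^sub>m n n) D" "p \<in> classical_set k n"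
    using assms by (auto simp: siegel_parabolic_def)
  then have "A \<in> GL_set n \<and> D \<in> GL_set n"
    using classical_set_GL[OF *(5)] block_triangular_GL[OF *(1-3)] by simp
  then show thesis using that * by blast
qed

lemma siegel_levi_part:
  assumes A: "A \<in> carrier_mat n n" and B: "B \<in> carrier_mat n n" and D: "D \<in> carrier_mat n n"
    and p: "four_block_mat A B (0\<^sub>m n n) D \<in> siegel_parabolic k n"
  shows "levi n A D \<in> siegel_parabolic k n"
proof -
  have p: "four_block_mat A B (0\<^sub>m n n) D \<in> classical_set k n"
    using p by (simp add: siegel_parabolic_def)
  have "levi n A D \<in> classical_set k n"
  proof (cases "has_form k")
    case True
    then show ?thesis
      using p A B D unfolding mem_classical_form[OF True] levi_def
      by (auto simp: block_triangular_GL form_mat_block_iff[of _ n] square_simps[where n = n])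
  next
    case False
    then show ?thesis
      using p A B D unfolding mem_classical_linear[OF False] levi_def
      by (auto simp: block_triangular_GL det_block_triangular)
  qed
  then show ?thesis using A D by (simp add: levi_def siegel_parabolic_block_iff[of _ n])
qed

lemma unip_mem_form:
  assumes B: "B \<in> carrier_mat n n" and k: "has_form k" and "B + form_sign k \<cdot>\<^sub>m transpose_mat B = 0\<^sub>m n n"
  shows "unip n B \<in> siegel_parabolic k n"
proof -
  have "unip n B \<in> classical_set k n"
    unfolding mem_classical_form[OF k] unip_def
    using assms by (auto simp: block_triangular_GL GL_one form_mat_block_iff[of _ n] square_simps[where n = n] intro!: exI[of _ 1])
  then show ?thesis using B by (simp add: unip_def siegel_parabolic_block_iff[of _ n])
qed

lemma unip_smult_mem:
  assumes B: "B \<in> carrier_mat n n" and u: "unip n B \<in> siegel_parabolic k n" and n: "n > 0"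
  shows "unip n (a \<cdot>\<^sub>m B) \<in> siegel_parabolic k n"
proof (cases "has_form k")
  case True
  have "unip n B \<in> classical_set k n" using u by (simp add: siegel_parabolic_def)
  then obtain \<mu> where "transpose_mat (unip n B) * form_mat k n * unip n B = \<mu> \<cdot>\<^sub>m form_mat k n"
    unfolding mem_classical_form[OF True] by blast
  from this[unfolded unip_def form_mat_block_iff[OF one_carrier_mat B zero_carrier_mat one_carrier_mat]]
  have "B + form_sign k \<cdot>\<^sub>m transpose_mat B = 0\<^sub>m n n"
    using B by (simp add: square_simps[where n = n])
  moreover have "a \<cdot>\<^sub>m B + form_sign k \<cdot>\<^sub>m transpose_mat (a \<cdot>\<^sub>m B) = a \<cdot>\<^sub>m (B + form_sign k \<cdot>\<^sub>m transpose_mat B)"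
    using B by (simp add: smult_add_mat[of _ n n] smult_smult_mat transpose_smult_mat mult.commute)
  ultimately have "a \<cdot>\<^sub>m B + form_sign k \<cdot>\<^sub>m transpose_mat (a \<cdot>\<^sub>m B) = 0\<^sub>m n n"
    by (simp add: smult_zero_mat)
  then show ?thesis using B True by (intro unip_mem_form) auto
next
  case False
  then show ?thesis
    using B unfolding siegel_parabolic_block_iff[OF one_carrier_mat smult_carrier_mat[OF B] zero_carrier_mat one_carrier_mat] unip_def
      mem_classical_linear[OF False]
    by (simp add: block_triangular_GL GL_one det_block_triangular)
qed

text \<open>An embedding of \<open>GL\<^sub>n\<close> into the Levi subgroup whose image lies in each of the six groups: the block
  diagonal matrix has determinant \<open>1\<close> and multiplier \<open>1\<close>.\<close>

definition dual_levi :: "nat \<Rightarrow> 'a::field mat \<Rightarrow> 'a mat" where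
  "dual_levi n A = levi n A (dual_mat n A)"

lemma dual_levi_mem:
  assumes A: "A \<in> GL_set n"
  shows "dual_levi n A \<in> siegel_parabolic k n"
proof -
  note d = dual_mat[OF A] and c = GL_carrier[OF A] GL_carrier[OF dual_mat(1)[OF A]]
  have td: "transpose_mat (dual_mat n A) * A = 1\<^sub>m n" by (rule d)
  have detd: "det A * det (dual_mat n A) = 1"
    using det_mult[of "transpose_mat A" n "dual_mat n A"] c d by (simp add: det_transpose)
  have GL: "dual_levi n A \<in> GL_set (2 * n)"
    using c A d(1) by (simp add: dual_levi_def levi_def block_triangular_GL)
  have "dual_levi n A \<in> classical_set k n"
  proof (cases "has_form k")
    case True
    have "transpose_mat (dual_levi n A) * form_mat k n * dual_levi n A = 1 \<cdot>\<^sub>m form_mat k n"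
      unfolding dual_levi_def levi_def using c d(2) td
      by (subst form_mat_block_iff[of _ n]) (simp_all add: square_simps[where n = n] smult_zero_mat)
    then show ?thesis
      unfolding mem_classical_form[OF True] using GL by (intro conjI exI[of _ 1]) auto
  next
    case False
    have "det (dual_levi n A) = 1"
      using c detd by (simp add: dual_levi_def levi_def det_block_triangular)
    then show ?thesis unfolding mem_classical_linear[OF False] using GL by simp
  qed
  then show ?thesis using c by (simp add: dual_levi_def levi_def siegel_parabolic_block_iff[of _ n])
qed

lemma dual_levi_mult:
  assumes "A \<in> GL_set n" "B \<in> GL_set n"
  shows "dual_levi n (A * B) = dual_levi n A * dual_levi n B"
  using assms by (simp add: dual_levi_def dual_mat_mult levi_mult dual_mat(1) GL_carrier)

section \<open>The anti-involution\<close>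

definition swap_mat :: "nat \<Rightarrow> 'a::field mat" where
  "swap_mat n = four_block_mat (0\<^sub>m n n) (1\<^sub>m n) (1\<^sub>m n) (0\<^sub>m n n)"

text \<open>Transposition maps the parabolic subgroup to the opposite one; conjugation by the swap of the two
  halves brings it back.\<close>

definition flip :: "nat \<Rightarrow> 'a::field mat \<Rightarrow> 'a mat" where
  "flip n g = swap_mat n * transpose_mat g * swap_mat n"

lemma swap_mat_carrier [simp]: "swap_mat n \<in> carrier_mat (2 * n) (2 * n)"
  by (simp add: swap_mat_def)

lemma swap_mat_square: "swap_mat n * swap_mat n = 1\<^sub>m (2 * n)"
  by (simp add: swap_mat_def block_mult[of _ n] square_simps[where n = n] mult_2)

lemma flip_block:
  assumes "A \<in> carrier_mat n n" "B \<in> carrier_mat n n" "C \<in> carrier_mat n n" "D \<in> carrier_mat n n"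
  shows "flip n (four_block_mat A B C D) =
    four_block_mat (transpose_mat D) (transpose_mat B) (transpose_mat C) (transpose_mat A)"
  using assms by (simp add: flip_def swap_mat_def block_transpose[of _ n] block_mult[of _ n] square_simps[where n = n])

lemma flip_carrier: "g \<in> carrier_mat (2 * n) (2 * n) \<Longrightarrow> flip n g \<in> carrier_mat (2 * n) (2 * n)"
  unfolding flip_def by (intro mult_carrier_mat[of _ _ "2 * n"]) auto

lemma flip_flip: 
  assumes "g \<in> carrier_mat (2 * n) (2 * n)"
  shows "flip n (flip n g) = g"
  using assms by (rule block_cases) (simp add: flip_block[of _ n])

lemma flip_mult:
  assumes g: "g \<in> carrier_mat (2 * n) (2 * n)" and h: "h \<in> carrier_mat (2 * n) (2 * n)"
  shows "flip n (g * h) = flip n h * flip n g"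
proof -
  note c = g h swap_mat_carrier[of n]
  have "flip n h * flip n g = swap_mat n * transpose_mat h * (swap_mat n * swap_mat n) * transpose_mat g * swap_mat n"
    using c by (simp add: flip_def square_simps[where n = "2 * n"])
  then show ?thesis using c by (simp add: swap_mat_square flip_def square_simps[where n = "2 * n"])
qed

lemma det_swap_mat_square: "det (swap_mat n :: 'a::field mat) * det (swap_mat n) = (1::'a)"
  using det_mult[of "swap_mat n :: 'a mat" "2 * n" "swap_mat n"] by (simp add: swap_mat_square)

lemma det_flip:
  assumes g: "g \<in> carrier_mat (2 * n) (2 * n)"
  shows "det (flip n g) = det g"
proof -
  have "det (flip n g) = det g * (det (swap_mat n) * det (swap_mat n))"
    unfolding flip_def using g
    by (simp add: det_mult[of _ "2 * n"] mult_carrier_mat[of _ "2 * n" "2 * n" _ "2 * n"] det_transpose)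
  then show ?thesis by (simp add: det_swap_mat_square)
qed

text \<open>The swap matrix \<open>K\<close> satisfies \<open>K J K = \<epsilon> J\<close>, so conjugation by \<open>K\<close> preserves the similitude relation;
  for the transpose one needs \<open>g J g\<^sup>T = \<mu> J\<close>, which follows by inverting \<open>g\<^sup>T J g = \<mu> J\<close>.\<close>

lemma flip_similitude:
  fixes g :: "'a::field mat"
  assumes g: "g \<in> GL_set (2 * n)" and s: "transpose_mat g * form_mat k n * g = \<mu> \<cdot>\<^sub>m form_mat k n" "\<mu> \<noteq> 0"
  shows "transpose_mat (flip n g) * form_mat k n * flip n g = \<mu> \<cdot>\<^sub>m form_mat k n"
proof -
  let ?J = "form_mat k n :: 'a mat" and ?K = "swap_mat n :: 'a mat" and ?e = "form_sign k :: 'a"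
  note sq = square_simps[where n = "2 * n"]
  note c = GL_carrier[OF g] form_mat_carrier[of k n, where ?'a = 'a] swap_mat_carrier[of n, where ?'a = 'a]
  have JJ: "?J * ?J = ?e \<cdot>\<^sub>m 1\<^sub>m (2 * n)"
    unfolding block_one[symmetric]
    by (simp add: form_mat_def block_mult[of _ n] square_simps[where n = n] block_smult[of _ n]
        smult_zero_mat del: four_block_one_mat)
  have KJK: "?K * ?J * ?K = ?e \<cdot>\<^sub>m ?J"
    by (simp add: form_mat_def swap_mat_def block_mult[of _ n] square_simps[where n = n] block_smult[of _ n]
        smult_zero_mat smult_smult_mat form_sign_square)
  have KT: "transpose_mat ?K = ?K"
    by (simp add: swap_mat_def block_transpose[of _ n])
  \<comment> \<open>The form relation for \<open>g\<close> exhibits a left inverse of \<open>g\<close>; it is also a right inverse.\<close>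
  let ?L = "inverse \<mu> \<cdot>\<^sub>m (?e \<cdot>\<^sub>m (?J * transpose_mat g * ?J))"
  have "?L * g = inverse \<mu> \<cdot>\<^sub>m (?e \<cdot>\<^sub>m (?J * (transpose_mat g * ?J * g)))"
    using c by (simp add: sq)
  also have "\<dots> = 1\<^sub>m (2 * n)"
    unfolding s(1) using c s(2) by (simp add: sq JJ smult_smult_mat form_sign_square mult.left_commute[of ?e])
  finally have Lg: "?L * g = 1\<^sub>m (2 * n)" .
  have "g * ?L = 1\<^sub>m (2 * n)"
    by (rule mat_mult_left_right_inverse[OF _ _ Lg]) (use c in \<open>simp_all add: sq\<close>)
  then have "(\<mu> \<cdot>\<^sub>m (g * ?L)) * ?J = \<mu> \<cdot>\<^sub>m ?J" using c by (simp add: sq)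
  moreover have "(\<mu> \<cdot>\<^sub>m (g * ?L)) * ?J = ?e \<cdot>\<^sub>m (g * ?J * transpose_mat g * (?J * ?J))"
    using c s(2) by (simp add: sq smult_smult_mat mult.assoc[symmetric])
  ultimately have gJ: "g * ?J * transpose_mat g = \<mu> \<cdot>\<^sub>m ?J"
    using c by (simp add: JJ sq smult_smult_mat form_sign_square)
  have "transpose_mat (flip n g) * ?J * flip n g = ?K * g * (?K * ?J * ?K) * transpose_mat g * ?K"
    using c by (simp add: flip_def sq KT)
  also have "\<dots> = ?e \<cdot>\<^sub>m (?K * (g * ?J * transpose_mat g) * ?K)"
    unfolding KJK using c by (simp add: sq)
  also have "\<dots> = (?e * \<mu>) \<cdot>\<^sub>m (?K * ?J * ?K)"
    unfolding gJ using c by (simp add: sq smult_smult_mat)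
  also have "\<dots> = \<mu> \<cdot>\<^sub>m ?J"
    unfolding KJK using form_sign_square[of k, where ?'a = 'a] by (simp add: smult_smult_mat mult.commute mult.left_commute)
  finally show ?thesis .
qed

lemma flip_mem_classical:
  assumes g: "g \<in> classical_set k n"
  shows "flip n g \<in> classical_set k n"
proof -
  note c = classical_set_carrier[OF g] and gl = classical_set_GL[OF g]
  have fgl: "flip n g \<in> GL_set (2 * n)" using gl c by (simp add: GL_iff_det det_flip flip_carrier)
  show ?thesis
    using g fgl flip_similitude[OF gl] unfolding mem_classical_form mem_classical_linear
    by (cases "has_form k") (auto simp: mem_classical_form mem_classical_linear det_flip c)
qed

lemma flip_mem_siegel:
  assumes "p \<in> siegel_parabolic k n"
  shows "flip n p \<in> siegel_parabolic k n"
proof -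
  have "p \<in> classical_set k n" using assms by (simp add: siegel_parabolic_def)
  then have "flip n p \<in> classical_set k n" by (rule flip_mem_classical)
  then show ?thesis
    using assms by (elim siegel_parabolic_cases) (simp add: flip_block[of _ n] siegel_parabolic_block_iff[of _ n] GL_carrier)
qed

section \<open>Representatives of the double cosets\<close>

definition diagm :: "nat \<Rightarrow> (nat \<Rightarrow> 'a::field) \<Rightarrow> 'a mat" where
  "diagm n d = mat n n (\<lambda>(i, j). if i = j then d i else 0)"

lemma diagm_carrier [simp]: "diagm n d \<in> carrier_mat n n"
  by (simp add: diagm_def)

lemma diagm_mult: "diagm n d * diagm n e = diagm n (\<lambda>i. d i * e i)"
proof (rule eq_matI)
  fix i j assume "i < dim_row (diagm n (\<lambda>i. d i * e i))" "j < dim_col (diagm n (\<lambda>i. d i * e i))"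
  then have ij: "i < n" "j < n" by (auto simp: diagm_def)
  have "(diagm n d * diagm n e) $$ (i, j) = (\<Sum>t<n. diagm n d $$ (i, t) * diagm n e $$ (t, j))"
    using ij by (auto simp: diagm_def scalar_prod_def lessThan_atLeast0)
  also have "\<dots> = (\<Sum>t<n. if t = i then (if i = j then d i * e i else 0) else 0)"
    using ij by (intro sum.cong) (auto simp: diagm_def)
  finally show "(diagm n d * diagm n e) $$ (i, j) = diagm n (\<lambda>i. d i * e i) $$ (i, j)"
    using ij by (simp add: diagm_def)
qed (auto simp: diagm_def)

lemma dilation_eq_diagm: "dilation n k a = diagm n (\<lambda>i. if i = k then a else 1)"
  by (auto simp: dilation_def diagm_def)

lemma det_dilation:
  assumes "l < n"
  shows "det (dilation n l a) = a"
proof -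
  have "upper_triangular (dilation n l a)" by (auto simp: dilation_def upper_triangular_def)
  then have "det (dilation n l a) = (\<Prod>i<n. dilation n l a $$ (i, i))"
    using det_upper_triangular[of "dilation n l a" n] by (simp add: prod_list_diag_prod lessThan_atLeast0)
  also have "\<dots> = dilation n l a $$ (l, l)"
    using assms by (subst prod.remove[of _ l]) (auto intro!: prod.neutral simp: dilation_def)
  finally show ?thesis using assms by (simp add: dilation_def)
qed

lemma coord_proj_eq_diagm: "coord_proj n I = diagm n (\<lambda>i. if i \<in> I then 1 else 0)"
  by (auto simp: coord_proj_def diagm_def)

lemma coord_proj_carrier [simp]: "coord_proj n I \<in> carrier_mat n n"
  by (simp add: coord_proj_eq_diagm)

lemma transpose_coord_proj: "transpose_mat (coord_proj n I) = coord_proj n I"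
  by (auto simp: coord_proj_def)

lemma coord_proj_mult: "coord_proj n I * coord_proj n J = coord_proj n (I \<inter> J)"
  unfolding coord_proj_eq_diagm diagm_mult by (rule arg_cong[of _ _ "diagm n"]) (auto simp: fun_eq_iff)

lemma coord_proj_empty: "coord_proj n {} = 0\<^sub>m n n"
  by (auto simp: coord_proj_def)

lemma coord_proj_complement: "coord_proj n (- I) + coord_proj n I = 1\<^sub>m n" "coord_proj n I + coord_proj n (- I) = 1\<^sub>m n"
  by (auto simp: coord_proj_def)

lemma coord_proj_products:
  "coord_proj n I * coord_proj n I = coord_proj n I" "coord_proj n (- I) * coord_proj n (- I) = coord_proj n (- I)"
  "coord_proj n I * coord_proj n (- I) = 0\<^sub>m n n" "coord_proj n (- I) * coord_proj n I = 0\<^sub>m n n"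
  by (simp_all add: coord_proj_mult coord_proj_empty)

lemma coord_proj_products_assoc:
  assumes "X \<in> carrier_mat n n"
  shows "coord_proj n I * (coord_proj n I * X) = coord_proj n I * X" "coord_proj n (- I) * (coord_proj n (- I) * X) = coord_proj n (- I) * X"
    "coord_proj n I * (coord_proj n (- I) * X) = 0\<^sub>m n n" "coord_proj n (- I) * (coord_proj n I * X) = 0\<^sub>m n n"
  using assms by (simp_all add: assoc_mult_mat[of _ n n _ n _ n, symmetric] coord_proj_products)

lemma dilation_coord_proj_commute: "dilation n l a * coord_proj n I = coord_proj n I * dilation n l a"
  by (simp add: dilation_eq_diagm coord_proj_eq_diagm diagm_mult mult.commute)

lemma coord_proj_complement_dilation: "l \<in> I \<Longrightarrow> coord_proj n (- I) * dilation n l a = coord_proj n (- I)"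
  unfolding dilation_eq_diagm coord_proj_eq_diagm diagm_mult by (rule arg_cong[of _ _ "diagm n"]) (auto simp: fun_eq_iff)

text \<open>If \<open>X M Y = E\<close> is idempotent, then \<open>M = X\<inverse> E Y\<inverse>\<close>, and \<open>U = Y X\<close> works.\<close>

lemma unit_regular:
  fixes M :: "'a::field mat"
  assumes M: "M \<in> carrier_mat n n" and n: "n > 0"
  obtains U where "U \<in> GL_set n" "M * U * M = M"
proof -
  obtain X Y I where XY: "X \<in> GL_set n" "Y \<in> GL_set n" "X * M * Y = coord_proj n I"
    using rank_normal_form[OF M n] .
  obtain X' where X': "X' \<in> GL_set n" "X' * X = 1\<^sub>m n" using GL_inverse[OF XY(1)] by metis
  obtain Y' where Y': "Y' \<in> GL_set n" "Y * Y' = 1\<^sub>m n" using GL_inverse[OF XY(2)] by metis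
  note c = M XY(1,2)[THEN GL_carrier] X'(1)[THEN GL_carrier] Y'(1)[THEN GL_carrier]
  note sq = square_simps[where n = n]
  have M_eq: "M = X' * coord_proj n I * Y'"
  proof -
    have "X' * (X * M * Y) * Y' = (X' * X) * M * (Y * Y')" using c by (simp add: sq)
    then show ?thesis using X' Y' c XY(3) by (simp add: sq)
  qed
  have "M * (Y * X) * M = M * Y * (X * M * Y) * Y'"
  proof -
    have "M * Y * (X * M * Y) * Y' = M * (Y * X) * M * (Y * Y')" using c by (simp add: sq)
    then show ?thesis using Y' c by (simp add: sq)
  qed
  also have "\<dots> = (X' * X) * M * Y * coord_proj n I * Y'" using X' c XY(3) by (simp add: sq)
  also have "\<dots> = X' * (X * M * Y) * coord_proj n I * Y'" using c by (simp add: sq)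
  also have "\<dots> = M" unfolding XY(3) using c by (simp add: sq coord_proj_products_assoc M_eq)
  finally show thesis using that GL_mult[OF XY(2,1)] by blast
qed

text \<open>The two basis vectors with index \<open>i \<in> I\<close> are exchanged, one of them with a sign. For \<open>GL\<close> and \<open>SL\<close>
  the sign is \<open>- 1\<close>, which makes the determinant \<open>1\<close>.\<close>

definition weyl :: "group_kind \<Rightarrow> nat \<Rightarrow> nat set \<Rightarrow> 'a::field mat" where
  "weyl k n I = four_block_mat (coord_proj n (- I)) (form_sign k \<cdot>\<^sub>m coord_proj n I) (coord_proj n I) (coord_proj n (- I))"

definition weyl_inv :: "group_kind \<Rightarrow> nat \<Rightarrow> nat set \<Rightarrow> 'a::field mat" where
  "weyl_inv k n I = four_block_mat (coord_proj n (- I)) (coord_proj n I) (form_sign k \<cdot>\<^sub>m coord_proj n I) (coord_proj n (- I))"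

lemma weyl_carrier [simp]:
  "weyl k n I \<in> carrier_mat (2 * n) (2 * n)" "weyl_inv k n I \<in> carrier_mat (2 * n) (2 * n)"
  by (simp_all add: weyl_def weyl_inv_def)

lemma weyl_inverse: "weyl k n I * weyl_inv k n I = 1\<^sub>m (2 * n)"
  by (simp add: weyl_def weyl_inv_def block_mult[of _ n] square_simps[where n = n] coord_proj_products
      smult_zero_mat smult_smult_mat form_sign_square coord_proj_complement mult_2)

lemma weyl_inverse': "weyl_inv k n I * weyl k n I = 1\<^sub>m (2 * n)"
  by (rule mat_mult_left_right_inverse[OF _ _ weyl_inverse]) auto

lemma weyl_form:
  "transpose_mat (weyl k n I) * form_mat k n * weyl k n I = (1::'a::field) \<cdot>\<^sub>m form_mat k n"
  unfolding weyl_def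
  by (subst form_mat_block_iff[of _ n])
     (simp_all add: square_simps[where n = n] transpose_coord_proj coord_proj_products smult_zero_mat smult_smult_mat
       form_sign_square transpose_smult_mat coord_proj_complement smult_add_mat[of _ n n, symmetric])

text \<open>As for \<open>n = 1\<close>, the matrix is a product of three block unipotent matrices, upper, lower, upper.\<close>

lemma det_weyl_linear:
  assumes "\<not> has_form k"
  shows "det (weyl k n I :: 'a::field mat) = 1"
proof -
  let ?E = "coord_proj n I :: 'a mat" and ?F = "coord_proj n (- I) :: 'a mat"
  have sign: "form_sign k = (-1 :: 'a)" using assms by (auto simp: has_form_def form_sign_def)
  let ?U = "four_block_mat (1\<^sub>m n) (- 1 \<cdot>\<^sub>m ?E) (0\<^sub>m n n) (1\<^sub>m n)"
  let ?L = "four_block_mat (1\<^sub>m n) (0\<^sub>m n n) ?E (1\<^sub>m n)"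
  have F: "1\<^sub>m n + - 1 \<cdot>\<^sub>m ?E = ?F" by (auto simp: coord_proj_def)
  have F': "- 1 \<cdot>\<^sub>m ?E + 1\<^sub>m n = ?F" by (auto simp: coord_proj_def)
  have "?U * ?L * ?U = weyl k n I"
    by (simp add: weyl_def sign block_mult[of _ n] square_simps[where n = n] F F' coord_proj_products smult_zero_mat)
  then have "det (weyl k n I :: 'a mat) = det ?U * det ?L * det ?U"
    by (metis (no_types, lifting) block_carrier det_mult mult_carrier_mat one_carrier_mat)
  moreover have "det ?U = 1" by (simp add: det_block_triangular[of _ n])
  moreover have "det ?L = 1" by (subst det_four_block_mat_upper_right_zero[of _ n _ n]) auto
  ultimately show ?thesis by simp
qed

lemma weyl_mem: "weyl k n I \<in> classical_set k n"
proof -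
  have "det (weyl k n I :: 'a mat) * det (weyl_inv k n I :: 'a mat) = 1"
    by (simp add: det_mult[symmetric, of _ "2 * n"] weyl_inverse)
  then have "weyl k n I \<in> (GL_set (2 * n) :: 'a mat set)" by (auto simp: GL_iff_det)
  then show ?thesis
    using weyl_form[of k n I] det_weyl_linear[of k n I]
    by (cases "has_form k") (auto simp: mem_classical_form mem_classical_linear intro!: exI[of _ 1])
qed

lemma classical_set_left_inverse_mem:
  assumes g: "g \<in> classical_set k n" and h: "h \<in> carrier_mat (2 * n) (2 * n)" "g * h = 1\<^sub>m (2 * n)"
  shows "h \<in> classical_set k n"
proof -
  obtain h' where h': "h' \<in> classical_set k n" "h' * g = 1\<^sub>m (2 * n)"
    using classical_set_inverse[OF g] by blast
  note c = classical_set_carrier[OF g] classical_set_carrier[OF h'(1)] h(1)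
  have "h' * (g * h) = (h' * g) * h" using c by (simp add: square_simps[where n = "2 * n"])
  then show ?thesis using h h' c by simp
qed

lemma weyl_inv_mem: "weyl_inv k n I \<in> classical_set k n"
  by (rule classical_set_left_inverse_mem[OF weyl_mem _ weyl_inverse]) auto

lemma flip_weyl: "flip n (weyl k n I) = weyl k n I"
  by (simp add: weyl_def flip_block[of _ n] transpose_coord_proj transpose_smult_mat)

text \<open>Let \<open>E\<close> be the lower left block, \<open>F = 1 - E\<close>, and \<open>g\<close> the given matrix. For \<open>p\<close> in the parabolic
  subgroup with blocks \<open>X, Y, 0, Z\<close>, the lower left block of \<open>g p w\<inverse>\<close>, where \<open>w = weyl k n I\<close>, is
  \<open>E X F + \<epsilon> (E Y + D Z) E\<close>. The two equations in the conclusion make it vanish, so that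
  \<open>g p w\<inverse>\<close> lies in the parabolic subgroup.

  In a group with a form, the relation \<open>E D\<^sup>T + \<epsilon> D E = 0\<close> holds for the bottom row of \<open>g\<close>. It gives
  \<open>F D E = 0\<close>, so \<open>X = Z = 1\<close> and \<open>Y = - D E = - E D E\<close> satisfy the equations, and it also says that
  \<open>Y\<close> has the symmetry required of the unipotent radical.

  In the linear groups it suffices that \<open>F D Z = F\<close> with \<open>Z\<close> invertible, since then \<open>F D Z E = 0\<close> and
  \<open>Y = - E D Z\<close> works. As the bottom row of \<open>g\<close> has full rank, \<open>F D\<close> has a right inverse on the range
  of \<open>F\<close>; unit regularity replaces it by an invertible \<open>U\<close> with \<open>F D U F = F\<close>, and a unipotent factor
  removes the remaining component \<open>F D U E\<close>. The determinant is corrected by the dilation \<open>X\<close>, which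
  commutes with \<open>E\<close>.\<close>

lemma big_cell_shift:
  fixes A :: "'a::field mat"
  assumes c: "A \<in> carrier_mat n n" "B \<in> carrier_mat n n" "D \<in> carrier_mat n n"
    and g: "four_block_mat A B (coord_proj n I) D \<in> classical_set k n" and n: "n > 0"
  obtains X Y Z where "X \<in> carrier_mat n n" "Y \<in> carrier_mat n n" "Z \<in> carrier_mat n n"
    "four_block_mat X Y (0\<^sub>m n n) Z \<in> siegel_parabolic k n"
    "coord_proj n I * X * coord_proj n (- I) = 0\<^sub>m n n" "(coord_proj n I * Y + D * Z) * coord_proj n I = 0\<^sub>m n n"
proof -
  define E where "E = (coord_proj n I :: 'a mat)"
  define F where "F = (coord_proj n (- I) :: 'a mat)"
  note sq = square_simps[where n = n]
  have EF: "E \<in> carrier_mat n n" "F \<in> carrier_mat n n" "E * E = E" "E * F = 0\<^sub>m n n" "F * E = 0\<^sub>m n n" "F * F = F"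
    "transpose_mat E = E" "E + F = 1\<^sub>m n"
    by (simp_all add: E_def F_def coord_proj_products transpose_coord_proj coord_proj_complement)
  have EFa: "E * (E * M) = E * M" "E * (F * M) = 0\<^sub>m n n" "F * (E * M) = 0\<^sub>m n n" "F * (F * M) = F * M"
    if "M \<in> carrier_mat n n" for M
    using that by (simp_all add: E_def F_def coord_proj_products_assoc)
  have cancel: "- 1 \<cdot>\<^sub>m M + M = 0\<^sub>m n n" "M + - 1 \<cdot>\<^sub>m M = 0\<^sub>m n n" if "M \<in> carrier_mat n n" for M :: "'a mat"
    using that by (auto intro!: eq_matI)
  show thesis
  proof (cases "has_form k")
    case True
    let ?e = "form_sign k :: 'a"
    have "flip n (four_block_mat A B E D) \<in> classical_set k n"
      using flip_mem_classical[OF g] by (simp add: E_def)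
    then obtain \<mu> where "transpose_mat (flip n (four_block_mat A B E D)) * form_mat k n * flip n (four_block_mat A B E D)
        = \<mu> \<cdot>\<^sub>m form_mat k n"
      unfolding mem_classical_form[OF True] by blast
    then have "E * transpose_mat D + ?e \<cdot>\<^sub>m (D * E) = 0\<^sub>m n n"
      using c EF by (simp add: flip_block[of _ n] form_mat_block_iff[of _ n])
    moreover have "E * transpose_mat D = (E * transpose_mat D + ?e \<cdot>\<^sub>m (D * E)) + (- ?e) \<cdot>\<^sub>m (D * E)"
      using c EF by (auto intro!: eq_matI)
    ultimately have ED: "E * transpose_mat D = (- ?e) \<cdot>\<^sub>m (D * E)"
      using c EF by (simp add: sq)
    have "(- ?e) \<cdot>\<^sub>m (E * (D * E)) = E * (E * transpose_mat D)"
      unfolding ED using c EF by (simp add: sq)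
    also have "\<dots> = E * transpose_mat D" using c by (intro EFa) simp
    finally have DE: "(- ?e) \<cdot>\<^sub>m (E * (D * E)) = (- ?e) \<cdot>\<^sub>m (D * E)" unfolding ED .
    have "(- ?e) \<cdot>\<^sub>m ((- ?e) \<cdot>\<^sub>m M) = M" for M
      by (simp add: smult_smult_mat form_sign_square)
    then have DE: "E * (D * E) = D * E" using DE by metis
    let ?Y = "- 1 \<cdot>\<^sub>m (D * E)"
    have "transpose_mat ?Y = ?e \<cdot>\<^sub>m (D * E)"
      using c EF by (simp add: transpose_smult_mat transpose_mult[of _ n n _ n] ED smult_smult_mat)
    then have "unip n ?Y \<in> siegel_parabolic k n"
      using c EF by (intro unip_mem_form[OF _ True]) (simp_all add: sq smult_smult_mat form_sign_square cancel)
    then have "four_block_mat (1\<^sub>m n) ?Y (0\<^sub>m n n) (1\<^sub>m n) \<in> siegel_parabolic k n" by (simp add: unip_def)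
    then show thesis
      using c EF DE by (intro that[of "1\<^sub>m n" ?Y "1\<^sub>m n"]) (simp_all add: sq E_def[symmetric] F_def[symmetric] cancel)
  next
    case False
    obtain h where h: "h \<in> GL_set (2 * n)" "four_block_mat A B E D * h = 1\<^sub>m (2 * n)"
      using GL_inverse[OF classical_set_GL[OF g]] unfolding E_def by metis
    obtain A' B' C' D' where h': "A' \<in> carrier_mat n n" "B' \<in> carrier_mat n n" "C' \<in> carrier_mat n n" "D' \<in> carrier_mat n n"
      "h = four_block_mat A' B' C' D'"
      using block_cases[OF GL_carrier[OF h(1)]] .
    have "four_block_mat A B E D * h = four_block_mat (1\<^sub>m n) (0\<^sub>m n n) (0\<^sub>m n n) (1\<^sub>m n)"
      using h(2) by (simp only: block_one)
    then have r: "E * B' + D * D' = 1\<^sub>m n"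
      using h'(1-4) c EF unfolding h'(5) by (simp add: block_mult[of _ n] block_inject[of _ n] sq del: four_block_one_mat)
    have FDD: "F * D * D' = F"
      using arg_cong[OF r, of "\<lambda>M. F * M"] h' c EF EFa by (simp add: sq)
    obtain U where U: "U \<in> GL_set n" "(F * D) * U * (F * D) = F * D"
      using unit_regular[OF mult_carrier_mat[OF EF(2) c(3)] n] .
    note Uc = GL_carrier[OF U(1)]
    have "(F * D) * U * (F * D) * D' = (F * D) * U * (F * D * D')"
      using Uc c EF h'(4) by (simp add: sq)
    then have FKF: "F * D * U * F = F" unfolding U(2) FDD by simp
    define V where "V = 1\<^sub>m n + - 1 \<cdot>\<^sub>m (F * (D * (U * E)))"
    define V' where "V' = 1\<^sub>m n + F * (D * (U * E))"
    have Vc: "V \<in> carrier_mat n n" "V' \<in> carrier_mat n n" using c Uc EF by (auto simp: V_def V'_def sq)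
    have "V * V' = 1\<^sub>m n"
      using c Uc EF EFa by (simp add: V_def V'_def sq cancel smult_zero_mat assoc_add_mat[of _ n n])
    then have "det V * det V' = 1" using det_mult[OF Vc] by simp
    then have V: "V \<in> GL_set n" using Vc by (auto simp: GL_iff_det)
    define Z where "Z = U * V"
    have Z: "Z \<in> GL_set n" unfolding Z_def by (rule GL_mult[OF U(1) V])
    note Zc = GL_carrier[OF Z]
    have FKF': "F * (D * (U * (F * M))) = F * M" if "M \<in> carrier_mat n n" for M
      using arg_cong[OF FKF, of "\<lambda>N. N * M"] that c Uc EF by (simp add: sq)
    have FKE: "F * (D * U) + - 1 \<cdot>\<^sub>m (F * (D * (U * E))) = F"
    proof -
      have "F * (D * U) = F * (D * U) * (E + F)" unfolding EF(8) using c Uc EF(1,2) by (simp add: sq)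
      also have "\<dots> = F * (D * (U * E)) + F * D * U * F" using c Uc EF(1,2) by (simp add: sq)
      finally have "F * (D * U) = F * (D * (U * E)) + F" unfolding FKF .
      then show ?thesis using c Uc EF by (auto intro!: eq_matI)
    qed
    have FDZ: "F * (D * Z) = F"
      using FKE c Uc EF unfolding Z_def V_def by (simp add: sq FKF')
    have EDZE: "E * (D * (Z * E)) = D * (Z * E)"
    proof -
      have "F * (D * (Z * E)) = F * (D * Z) * E" using c Zc EF(1,2) by (simp add: sq)
      then have z: "F * (D * (Z * E)) = 0\<^sub>m n n" unfolding FDZ using EF by simp
      have "D * (Z * E) = (E + F) * (D * (Z * E))" unfolding EF(8) using c Zc EF(1) by (simp add: sq)
      also have "\<dots> = E * (D * (Z * E)) + F * (D * (Z * E))" using c Zc EF(1,2) by (simp add: sq)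
      also have "\<dots> = E * (D * (Z * E))" unfolding z using c Zc EF(1) by (simp add: sq)
      finally show ?thesis ..
    qed
    define X where "X = dilation n 0 (1 / det Z)"
    have d: "det Z \<noteq> 0" using Z by (simp add: GL_iff_det)
    have XGL: "X \<in> GL_set n" unfolding X_def using d by (intro dilation_GL) auto
    have detX: "det X = 1 / det Z"
      unfolding X_def using n by (rule det_dilation)
    have EXF: "E * X * F = 0\<^sub>m n n"
      unfolding X_def E_def F_def dilation_coord_proj_commute[symmetric]
      by (simp add: sq coord_proj_products)
    let ?Y = "- 1 \<cdot>\<^sub>m (E * (D * Z))"
    have Yc: "?Y \<in> carrier_mat n n" using c EF Zc by (simp add: sq)
    note Xc = GL_carrier[OF XGL]
    have "four_block_mat X ?Y (0\<^sub>m n n) Z \<in> classical_set k n"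
      unfolding mem_classical_linear[OF False]
      using block_triangular_GL[OF Xc Yc Zc] det_block_triangular[OF Xc Yc Zc] XGL Z detX d by simp
    then have "four_block_mat X ?Y (0\<^sub>m n n) Z \<in> siegel_parabolic k n"
      using siegel_parabolic_block_iff[OF Xc Yc zero_carrier_mat Zc] by simp
    then show thesis
      using c EF EFa EDZE Zc EXF
      by (intro that[OF Xc Yc Zc]) (simp_all add: sq E_def[symmetric] F_def[symmetric] cancel)
  qed
qed

lemma siegel_subset: "siegel_parabolic k n \<subseteq> classical_set k n"
  by (auto simp: siegel_parabolic_def)

lemma siegel_mult:
  assumes "p \<in> siegel_parabolic k n" "p' \<in> siegel_parabolic k n"
  shows "p * p' \<in> siegel_parabolic k n"
proof -
  have m: "p * p' \<in> classical_set k n" using assms siegel_subset classical_set_mult by blast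
  obtain A B D where p: "A \<in> GL_set n" "B \<in> carrier_mat n n" "D \<in> GL_set n" "p = four_block_mat A B (0\<^sub>m n n) D"
    using siegel_parabolic_cases[OF assms(1)] .
  obtain A' B' D' where p': "A' \<in> GL_set n" "B' \<in> carrier_mat n n" "D' \<in> GL_set n" "p' = four_block_mat A' B' (0\<^sub>m n n) D'"
    using siegel_parabolic_cases[OF assms(2)] .
  show ?thesis
    using m p p' by (simp add: GL_carrier block_mult[of _ n] square_simps[where n = n] siegel_parabolic_block_iff[of _ n])
qed

lemma siegel_inverse_mem:
  assumes p: "p \<in> siegel_parabolic k n" and h: "h \<in> classical_set k n" "h * p = 1\<^sub>m (2 * n)"
  shows "h \<in> siegel_parabolic k n"
proof -
  obtain A B D where *: "A \<in> GL_set n" "B \<in> carrier_mat n n" "D \<in> GL_set n" "p = four_block_mat A B (0\<^sub>m n n) D"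
    using siegel_parabolic_cases[OF p] .
  obtain A' B' C' D' where h': "A' \<in> carrier_mat n n" "B' \<in> carrier_mat n n" "C' \<in> carrier_mat n n" "D' \<in> carrier_mat n n"
      "h = four_block_mat A' B' C' D'"
    using block_cases[OF classical_set_carrier[OF h(1)]] .
  note c = h'(1-4) GL_carrier[OF *(1)] GL_carrier[OF *(3)] *(2)
  have "h * p = four_block_mat (1\<^sub>m n) (0\<^sub>m n n) (0\<^sub>m n n) (1\<^sub>m n)" using h(2) by (simp only: block_one)
  then have CA: "C' * A = 0\<^sub>m n n"
    using c unfolding h'(5) *(4) by (simp add: block_mult[of _ n] block_inject[of _ n] square_simps[where n = n] del: four_block_one_mat)
  obtain A2 where A2: "A2 \<in> GL_set n" "A * A2 = 1\<^sub>m n" using GL_inverse[OF *(1)] by metis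
  have "C' * A * A2 = C' * (A * A2)" using c GL_carrier[OF A2(1)] by (simp add: square_simps[where n = n])
  then have "C' = 0\<^sub>m n n" using CA A2 c GL_carrier[OF A2(1)] by (simp add: square_simps[where n = n])
  then show ?thesis using h(1) h' by (simp add: siegel_parabolic_block_iff[of _ n])
qed

lemma siegel_one: "(1\<^sub>m (2 * n) :: 'a::field mat) \<in> siegel_parabolic k n"
proof -
  have "four_block_mat (1\<^sub>m n) (0\<^sub>m n n) (0\<^sub>m n n) (1\<^sub>m n :: 'a mat) \<in> siegel_parabolic k n"
    by (subst siegel_parabolic_block_iff[OF one_carrier_mat zero_carrier_mat zero_carrier_mat one_carrier_mat])
       (simp only: block_one classical_set_one simp_thms)
  then show ?thesis by (simp only: block_one)
qed

lemma siegel_inverse: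
  assumes p: "p \<in> siegel_parabolic k n"
  obtains p' where "p' \<in> siegel_parabolic k n" "p' * p = 1\<^sub>m (2 * n)" "p * p' = 1\<^sub>m (2 * n)"
proof -
  have pc: "p \<in> classical_set k n" using p siegel_subset by blast
  obtain h where h: "h \<in> classical_set k n" "h * p = 1\<^sub>m (2 * n)" using classical_set_inverse[OF pc] by blast
  have "p * h = 1\<^sub>m (2 * n)"
    by (rule mat_mult_left_right_inverse[OF _ _ h(2)]) (use h pc in \<open>auto intro: classical_set_carrier\<close>)
  then show thesis using that[OF siegel_inverse_mem[OF p h] h(2)] by blast
qed

lemma subgroup_siegel: "subgroup (siegel_parabolic k n) (classical_group k n)"
proof -
  interpret group "classical_group k n" by (rule group_classical_group)
  show ?thesis
  proof (rule subgroupI)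
    show "siegel_parabolic k n \<noteq> {}" using siegel_one by blast
    fix p :: "'a mat" assume p: "p \<in> siegel_parabolic k n"
    obtain p' where p': "p' \<in> siegel_parabolic k n" "p' * p = 1\<^sub>m (2 * n)" "p * p' = 1\<^sub>m (2 * n)"
      using siegel_inverse[OF p] .
    have "inv\<^bsub>classical_group k n\<^esub> p = p'"
      by (rule inv_equality) (use p p' siegel_subset in \<open>auto simp: classical_group_def\<close>)
    then show "inv\<^bsub>classical_group k n\<^esub> p \<in> siegel_parabolic k n" using p' by simp
  qed (use siegel_subset siegel_mult in \<open>auto simp: classical_group_def\<close>)
qed

lemma siegel_carrier: "p \<in> siegel_parabolic k n \<Longrightarrow> p \<in> carrier_mat (2 * n) (2 * n)"
  using siegel_subset classical_set_carrier by blast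

lemma double_coset_transport:
  fixes g :: "'a::field mat"
  assumes p: "p \<in> siegel_parabolic k n" "p' \<in> siegel_parabolic k n" and q: "q \<in> siegel_parabolic k n" "q' \<in> siegel_parabolic k n"
    and g: "g \<in> carrier_mat (2 * n) (2 * n)" and w: "w \<in> carrier_mat (2 * n) (2 * n)" and e: "p * g * p' = q * w * q'"
  shows "\<exists>r\<in>siegel_parabolic k n. \<exists>r'\<in>siegel_parabolic k n. g = r * w * r'"
proof -
  note sq = square_simps[where n = "2 * n"]
  obtain a where a: "a \<in> siegel_parabolic k n" "a * p = 1\<^sub>m (2 * n)" using siegel_inverse[OF p(1)] by metis
  obtain b where b: "b \<in> siegel_parabolic k n" "p' * b = 1\<^sub>m (2 * n)" using siegel_inverse[OF p(2)] by metis
  note c = siegel_carrier[OF p(1)] siegel_carrier[OF p(2)] siegel_carrier[OF q(1)] siegel_carrier[OF q(2)]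
    siegel_carrier[OF a(1)] siegel_carrier[OF b(1)] g w
  have "g = (a * p) * g * (p' * b)" unfolding a b using c by (simp add: sq)
  also have "\<dots> = a * (p * g * p') * b" using c by (simp add: sq)
  also have "\<dots> = (a * q) * w * (q' * b)" unfolding e using c by (simp add: sq)
  finally show ?thesis using siegel_mult[OF a(1) q(1)] siegel_mult[OF q(2) b(1)] by blast
qed

text \<open>Multiplication by elements of \<open>dual_levi\<close> on both sides replaces the lower left block \<open>C\<close> by
  \<open>X C Y\<close>, which can be made a coordinate projection; \<open>big_cell_shift\<close> then applies.\<close>

lemma siegel_double_cosets:
  fixes g :: "'a::field mat"
  assumes g: "g \<in> classical_set k n" and n: "n > 0"
  shows "\<exists>I. \<exists>p\<in>siegel_parabolic k n. \<exists>p'\<in>siegel_parabolic k n. g = p * weyl k n I * p'"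
proof -
  obtain A B C D where gb: "A \<in> carrier_mat n n" "B \<in> carrier_mat n n" "C \<in> carrier_mat n n" "D \<in> carrier_mat n n"
    "g = four_block_mat A B C D"
    using block_cases[OF classical_set_carrier[OF g]] .
  obtain X Y I where XY: "X \<in> GL_set n" "Y \<in> GL_set n" "X * C * Y = coord_proj n I"
    using rank_normal_form[OF gb(3) n] .
  let ?l = "dual_levi n (dual_mat n X)" and ?r = "dual_levi n Y"
  have l: "?l \<in> siegel_parabolic k n" and r: "?r \<in> siegel_parabolic k n"
    using XY by (auto intro: dual_levi_mem dual_mat(1))
  note c = gb(1-4) XY(1,2)[THEN GL_carrier] XY(1,2)[THEN dual_mat(1), THEN GL_carrier]
  obtain A1 B1 D1 where g1: "A1 \<in> carrier_mat n n" "B1 \<in> carrier_mat n n" "D1 \<in> carrier_mat n n"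
    "?l * g * ?r = four_block_mat A1 B1 (coord_proj n I) D1"
  proof (rule that)
    show "?l * g * ?r = four_block_mat (dual_mat n X * A * Y) (dual_mat n X * B * dual_mat n Y) (coord_proj n I) (X * D * dual_mat n Y)"
      using c XY(3) by (simp add: gb(5) dual_levi_def levi_def dual_mat_dual XY(1) block_mult[of _ n] square_simps[where n = n])
  qed (use c in \<open>simp_all add: square_simps[where n = n]\<close>)
  have g1m: "?l * g * ?r \<in> classical_set k n"
    using l r g siegel_subset by (intro classical_set_mult) auto
  obtain X' Y' Z' where s: "X' \<in> carrier_mat n n" "Y' \<in> carrier_mat n n" "Z' \<in> carrier_mat n n"
    "four_block_mat X' Y' (0\<^sub>m n n) Z' \<in> siegel_parabolic k n"
    "coord_proj n I * X' * coord_proj n (- I) = 0\<^sub>m n n" "(coord_proj n I * Y' + D1 * Z') * coord_proj n I = 0\<^sub>m n n"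
    using big_cell_shift[OF g1(1-3) g1m[unfolded g1(4)] n] .
  let ?p = "four_block_mat X' Y' (0\<^sub>m n n) Z'"
  let ?q = "?l * g * ?r * ?p * weyl_inv k n I"
  have qm: "?q \<in> classical_set k n"
    by (rule classical_set_mult[OF classical_set_mult[OF g1m subsetD[OF siegel_subset s(4)]] weyl_inv_mem])
  define R S where "R = A1 * Y' + B1 * Z'" and "S = coord_proj n I * Y' + D1 * Z'"
  have RS: "R \<in> carrier_mat n n" "S \<in> carrier_mat n n" "A1 * X' \<in> carrier_mat n n" "coord_proj n I * X' \<in> carrier_mat n n"
    using g1(1-3) s(1-3) by (simp_all add: R_def S_def mult_carrier_mat[of _ n n _ n])
  have "?l * g * ?r * ?p = four_block_mat (A1 * X') R (coord_proj n I * X') S"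
    unfolding g1(4) using g1(1-3) s(1-3) by (simp add: R_def S_def block_mult[of _ n] square_simps[where n = n])
  moreover have "coord_proj n I * X' * coord_proj n (- I) + S * (form_sign k \<cdot>\<^sub>m coord_proj n I) = 0\<^sub>m n n"
    using s(5,6) RS(2) by (simp add: S_def[symmetric] mult_smult_distrib[of _ n n _ n] smult_zero_mat)
  ultimately have "?q = four_block_mat (A1 * X' * coord_proj n (- I) + R * (form_sign k \<cdot>\<^sub>m coord_proj n I)) (A1 * X' * coord_proj n I + R * coord_proj n (- I))
      (0\<^sub>m n n) (coord_proj n I * X' * coord_proj n I + S * coord_proj n (- I))"
    using RS by (simp add: weyl_inv_def block_mult[of _ n])
  moreover have "A1 * X' * coord_proj n (- I) + R * (form_sign k \<cdot>\<^sub>m coord_proj n I) \<in> carrier_mat n n"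
    "A1 * X' * coord_proj n I + R * coord_proj n (- I) \<in> carrier_mat n n" "coord_proj n I * X' * coord_proj n I + S * coord_proj n (- I) \<in> carrier_mat n n"
    using RS by (simp_all add: mult_carrier_mat[of _ n n _ n])
  ultimately have "\<exists>Q R S. Q \<in> carrier_mat n n \<and> R \<in> carrier_mat n n \<and> S \<in> carrier_mat n n \<and> ?q = four_block_mat Q R (0\<^sub>m n n) S"
    by metis
  then have q: "?q \<in> siegel_parabolic k n" using qm by (simp add: siegel_parabolic_def)
  note cc = siegel_carrier[OF l] siegel_carrier[OF r] siegel_carrier[OF s(4)] classical_set_carrier[OF g] classical_set_carrier[OF g1m]
    weyl_carrier(1)[of k n I] weyl_carrier(2)[of k n I]
  have "?l * g * (?r * ?p) = ?q * weyl k n I * 1\<^sub>m (2 * n)"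
  proof -
    have "?q * weyl k n I = ?l * g * ?r * ?p * (weyl_inv k n I * weyl k n I)"
      using cc by (simp add: square_simps[where n = "2 * n"])
    then show ?thesis unfolding weyl_inverse' using cc(1-5) by (simp add: square_simps[where n = "2 * n"])
  qed
  from double_coset_transport[OF l siegel_mult[OF r s(4)] q siegel_one _ _ this]
  show ?thesis using cc(4) by auto
qed

section \<open>Characters of the Siegel parabolic subgroup\<close>

text \<open>A field of odd order prime to \<open>3\<close> has at least five elements, so it is not exhausted by \<open>0, 1, - 1\<close>.\<close>

lemma exists_nontrivial_square:
  assumes "odd (CARD('a::{field, finite}))" "\<not> 3 dvd CARD('a::{field, finite})"
  obtains a :: "'a::{field, finite}" where "a \<noteq> 0" "a\<^sup>2 \<noteq> 1"
proof -
  have "CARD('a) > 1" using card_mono[of "UNIV :: 'a set" "{0, 1}"] by simp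
  then have "CARD('a) > 3" using assms by (cases "CARD('a) = 3") presburger+
  moreover have "card {0, 1, - 1 :: 'a} \<le> 3" by (simp add: card_insert_if)
  ultimately have "{0, 1, - 1 :: 'a} \<noteq> UNIV" by (metis not_le)
  then obtain a :: 'a where "a \<notin> {0, 1, - 1}" by blast
  then show thesis using that[of a] by (simp add: power2_eq_1_iff)
qed

lemma finite_carrier_mat: "finite (carrier_mat m n :: 'a::finite mat set)"
proof -
  let ?I = "{..<m} \<times> {..<n}"
  have "M \<in> mat m n ` (?I \<rightarrow>\<^sub>E (UNIV :: 'a set))" if M: "M \<in> carrier_mat m n" for M
  proof -
    let ?f = "restrict (\<lambda>(i, j). M $$ (i, j)) ?I"
    have "?f \<in> ?I \<rightarrow>\<^sub>E UNIV" by (simp add: restrict_PiE_iff)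
    moreover have "mat m n ?f = M" using M by (intro eq_matI) auto
    ultimately show ?thesis by (metis imageI)
  qed
  then have "carrier_mat m n \<subseteq> mat m n ` (?I \<rightarrow>\<^sub>E (UNIV :: 'a set))" by blast
  then show ?thesis by (rule finite_subset) (auto intro!: finite_PiE)
qed

locale siegel_character =
  fixes k :: group_kind and n :: nat and \<chi> :: "'a::field mat \<Rightarrow> complex" and a :: 'a
  assumes n_pos: "n > 0"
    and a: "a \<noteq> 0" "a\<^sup>2 \<noteq> 1"
    and mult: "\<And>p p'. p \<in> siegel_parabolic k n \<Longrightarrow> p' \<in> siegel_parabolic k n \<Longrightarrow> \<chi> (p * p') = \<chi> p * \<chi> p'"
    and nonzero: "\<And>p. p \<in> siegel_parabolic k n \<Longrightarrow> \<chi> p \<noteq> 0"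
begin

abbreviation P :: "'a mat set" where "P \<equiv> siegel_parabolic k n"

lemma a_not_one: "a \<noteq> 1"
  using a by auto

lemma chi_one: "\<chi> (1\<^sub>m (2 * n)) = 1"
  using mult[OF siegel_one siegel_one] nonzero[OF siegel_one] by simp

lemma chi_conj:
  assumes "p \<in> P" "q \<in> P" "r \<in> P" "p * q = r * p"
  shows "\<chi> q = \<chi> r"
  using mult[OF assms(1,2)] mult[OF assms(3,1)] assms(4) nonzero[OF assms(1)] by simp

text \<open>Conjugation by the block scalar matrix with blocks \<open>a\<close> and \<open>1 / a\<close> multiplies \<open>B\<close> by \<open>a\<^sup>2\<close>. As
  \<open>a\<^sup>2 \<noteq> 1\<close>, every element of the unipotent radical is a commutator in the parabolic subgroup.\<close>

lemma chi_unip: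
  assumes B: "B \<in> carrier_mat n n" and u: "unip n B \<in> P"
  shows "\<chi> (unip n B) = 1"
proof -
  let ?t = "levi n (a \<cdot>\<^sub>m 1\<^sub>m n) ((1 / a) \<cdot>\<^sub>m 1\<^sub>m n)"
  have aGL: "a \<cdot>\<^sub>m 1\<^sub>m n \<in> GL_set n" using a(1) by (simp add: GL_iff_det)
  have "dual_mat n (a \<cdot>\<^sub>m 1\<^sub>m n) = (1 / a) \<cdot>\<^sub>m 1\<^sub>m n"
    using a(1) by (intro dual_mat_unique[OF aGL])
      (simp_all add: transpose_smult_mat square_simps[where n = n] smult_smult_mat)
  then have t: "?t \<in> P" using dual_levi_mem[OF aGL, of k] by (simp add: dual_levi_def)
  \<comment> \<open>conjugation takes \<open>b B\<close> to \<open>a\<^sup>2 b B = b B + B\<close>\<close>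
  define b where "b = 1 / (a\<^sup>2 - 1)"
  have b: "a * a * b = b + 1" using a(2) by (simp add: b_def field_simps power2_eq_square)
  have m: "unip n (c \<cdot>\<^sub>m B) \<in> P" for c by (rule unip_smult_mem[OF B u n_pos])
  have "\<chi> (unip n (b \<cdot>\<^sub>m B)) = \<chi> (unip n ((a * a * b) \<cdot>\<^sub>m B))"
  proof (rule chi_conj[OF t m m])
    show "?t * unip n (b \<cdot>\<^sub>m B) = unip n ((a * a * b) \<cdot>\<^sub>m B) * ?t"
      using B a(1) by (simp add: levi_def unip_def block_mult[of _ n] square_simps[where n = n] smult_smult_mat smult_zero_mat mult.commute)
  qed
  also have "unip n ((a * a * b) \<cdot>\<^sub>m B) = unip n (b \<cdot>\<^sub>m B) * unip n B"
  proof -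
    have "(b + 1) \<cdot>\<^sub>m B = B + b \<cdot>\<^sub>m B" by (auto intro!: eq_matI simp: algebra_simps)
    then show ?thesis
      using B by (simp add: b unip_def block_mult[of _ n] square_simps[where n = n])
  qed
  also have "\<chi> \<dots> = \<chi> (unip n (b \<cdot>\<^sub>m B)) * \<chi> (unip n B)" using mult[OF m u] .
  finally show ?thesis using nonzero[OF m] by simp
qed

lemma chi_levi_part:
  assumes A: "A \<in> GL_set n" and B: "B \<in> carrier_mat n n" and D: "D \<in> GL_set n"
    and p: "four_block_mat A B (0\<^sub>m n n) D \<in> P"
  shows "\<chi> (four_block_mat A B (0\<^sub>m n n) D) = \<chi> (levi n A D)"
proof -
  note c = GL_carrier[OF A] B GL_carrier[OF D]
  have l: "levi n A D \<in> P" by (rule siegel_levi_part[OF c p])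
  obtain l' where l': "l' \<in> P" "levi n A D * l' = 1\<^sub>m (2 * n)" using siegel_inverse[OF l] by metis
  obtain D' where D': "D' \<in> GL_set n" "D' * D = 1\<^sub>m n" using GL_inverse[OF D] by metis
  note c' = c GL_carrier[OF D'(1)]
  have e: "unip n (B * D') * levi n A D = four_block_mat A B (0\<^sub>m n n) D"
    using c' D'(2) by (simp add: unip_def levi_def block_mult[of _ n] square_simps[where n = n])
  have ud: "unip n (B * D') \<in> carrier_mat (2 * n) (2 * n)" by (simp add: unip_def)
  have "unip n (B * D') = unip n (B * D') * (levi n A D * l')" using l'(2) ud by simp
  also have "\<dots> = four_block_mat A B (0\<^sub>m n n) D * l'"
    unfolding e[symmetric] using ud siegel_carrier[OF l] siegel_carrier[OF l'(1)]
    by (simp add: square_simps[where n = "2 * n"])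
  finally have u: "unip n (B * D') \<in> P" using siegel_mult[OF p l'(1)] by simp
  show ?thesis
    using mult[OF u l] chi_unip[OF mult_carrier_mat[OF B GL_carrier[OF D'(1)]] u] unfolding e by simp
qed

lemma chi_dual_levi_mult:
  "A \<in> GL_set n \<Longrightarrow> B \<in> GL_set n \<Longrightarrow> \<chi> (dual_levi n (A * B)) = \<chi> (dual_levi n A) * \<chi> (dual_levi n B)"
  by (simp add: dual_levi_mult mult dual_levi_mem)

lemma chi_dual_levi_conj:
  assumes "A \<in> GL_set n" "C \<in> GL_set n" "C' \<in> GL_set n" "C * C' = 1\<^sub>m n"
  shows "\<chi> (dual_levi n (C * A * C')) = \<chi> (dual_levi n A)"
proof -
  have "\<chi> (dual_levi n C) * \<chi> (dual_levi n C') = \<chi> (dual_levi n (C * C'))"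
    using chi_dual_levi_mult[OF assms(2,3)] by simp
  also have "\<dots> = 1"
  proof -
    have "dual_levi n (1\<^sub>m n) = (1\<^sub>m (2 * n) :: 'a mat)"
      using dual_mat_unique[OF GL_one one_carrier_mat, of n, where ?'a = 'a]
      by (simp add: dual_levi_def levi_def mult_2)
    then show ?thesis by (simp add: assms chi_one)
  qed
  finally show ?thesis using assms by (simp add: chi_dual_levi_mult GL_mult)
qed

text \<open>The restriction of \<open>\<chi>\<close> to the image of \<open>dual_levi\<close> is a character of \<open>GL\<^sub>n\<close>, hence trivial on
  elementary matrices, and only the determinant remains.\<close>

lemma chi_dual_levi_dilation:
  assumes A: "A \<in> GL_set n" and l: "l < n"
  shows "\<chi> (dual_levi n A) = \<chi> (dual_levi n (dilation n l (det A)))"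
proof -
  have triv: "\<chi> (dual_levi n S) = 1" if "S \<in> elem_group n" for S
  proof (rule character_elem_group_trivial[OF a(1) a_not_one, where c = "\<lambda>A. \<chi> (dual_levi n A)", OF _ _ _ that])
    fix j and S :: "'a mat" assume "j < n" "S \<in> elem_group n"
    then show "\<chi> (dual_levi n (dilation n j a * S * dilation n j (1 / a))) = \<chi> (dual_levi n S)"
      using a(1) by (intro chi_dual_levi_conj) (auto simp: elem_group_GL dilation_GL dilation_mult dilation_one)
  qed (auto simp: chi_dual_levi_mult elem_group_GL nonzero dual_levi_mem)
  obtain S T where ST: "S \<in> elem_group n" "T \<in> elem_group n" "A = S * dilation n l (det A) * T"
    using elem_dilation_decomposition[OF a(1) a_not_one A l] .
  have d: "det A \<noteq> 0" using A by (simp add: GL_iff_det)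
  have "\<chi> (dual_levi n (S * dilation n l (det A) * T)) = \<chi> (dual_levi n (dilation n l (det A)))"
    using ST(1,2) d by (simp add: chi_dual_levi_mult GL_mult elem_group_GL dilation_GL triv)
  then show ?thesis using ST(3) by simp
qed

lemma levi_mem_linear:
  assumes "\<not> has_form k" "A \<in> GL_set n" "D \<in> GL_set n"
  shows "levi n A D \<in> P \<longleftrightarrow> (k = KSL \<longrightarrow> det A * det D = 1)"
proof -
  note c = GL_carrier[OF assms(2)] zero_carrier_mat GL_carrier[OF assms(3)]
  show ?thesis
    unfolding levi_def siegel_parabolic_block_iff[OF c(1) zero_carrier_mat zero_carrier_mat c(3)]
      mem_classical_linear[OF assms(1)] det_block_triangular[OF c] block_triangular_GL[OF c]
    using assms by auto
qed

text \<open>In \<open>SL\<close> the second block cannot be conjugated by a dilation alone, but it can be conjugated by an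
  element of \<open>dual_levi\<close>, whose action on the first block \<open>1\<close> is trivial.\<close>

lemma chi_levi_dilation:
  assumes k: "\<not> has_form k" and D: "D \<in> GL_set n" and l: "l < n"
    and m: "levi n (1\<^sub>m n) D \<in> P"
  shows "\<chi> (levi n (1\<^sub>m n) D) = \<chi> (levi n (1\<^sub>m n) (dilation n l (det D)))"
proof -
  obtain S T where ST: "S \<in> elem_group n" "T \<in> elem_group n" "D = S * dilation n l (det D) * T"
    using elem_dilation_decomposition[OF a(1) a_not_one D l] .
  have d: "det D \<noteq> 0" using D by (simp add: GL_iff_det)
  have det1: "det S = 1" if "S \<in> elem_group n" for S :: "'a mat"
    by (rule det_elem_group[OF a(1) a_not_one that])
  have conj: "dual_levi n (dilation n j (1 / a)) * levi n (1\<^sub>m n) S =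
      levi n (1\<^sub>m n) (dilation n j a * S * dilation n j (1 / a)) * dual_levi n (dilation n j (1 / a))"
    if "S \<in> carrier_mat n n" for j and S :: "'a mat"
    using that a(1) by (simp add: dual_levi_def dual_mat_dilation levi_mult square_simps[where n = n] dilation_mult dilation_one)
  note e = elem_group_GL elem_group_carrier det1 levi_mem_linear[OF k] GL_one GL_carrier dilation_GL GL_mult
  have mem: "levi n (1\<^sub>m n) S \<in> P" if "S \<in> elem_group n" for S
    using that det1[OF that] by (simp add: levi_mem_linear[OF k] GL_one elem_group_GL)
  have triv: "\<chi> (levi n (1\<^sub>m n) S) = 1" if "S \<in> elem_group n" for S
  proof (rule character_elem_group_trivial[OF a(1) a_not_one, where c = "\<lambda>A. \<chi> (levi n (1\<^sub>m n) A)", OF _ _ _ that])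
    fix A B :: "'a mat" assume AB: "A \<in> elem_group n" "B \<in> elem_group n"
    then have "levi n (1\<^sub>m n) (A * B) = levi n (1\<^sub>m n) A * levi n (1\<^sub>m n) B"
      by (simp add: levi_mult)
    then show "\<chi> (levi n (1\<^sub>m n) (A * B)) = \<chi> (levi n (1\<^sub>m n) A) * \<chi> (levi n (1\<^sub>m n) B)"
      using mult[OF mem[OF AB(1)] mem[OF AB(2)]] by simp
  next
    fix j and S :: "'a mat" assume S: "j < n" "S \<in> elem_group n"
    have "\<chi> (levi n (1\<^sub>m n) S) = \<chi> (levi n (1\<^sub>m n) (dilation n j a * S * dilation n j (1 / a)))"
    proof (rule chi_conj[OF dual_levi_mem[OF dilation_GL[of "1 / a"]] mem[OF S(2)]])
      show "dual_levi n (dilation n j (1 / a)) * levi n (1\<^sub>m n) S =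
        levi n (1\<^sub>m n) (dilation n j a * S * dilation n j (1 / a)) * dual_levi n (dilation n j (1 / a))"
        using S by (intro conj) simp
      have "det (dilation n j a) * det (dilation n j (1 / a)) = (1 :: 'a)"
        using a(1) by (simp add: det_mult[symmetric, of _ n] dilation_mult dilation_one)
      then show "levi n (1\<^sub>m n) (dilation n j a * S * dilation n j (1 / a)) \<in> P"
        using S a(1) by (simp add: e det_mult[of _ n] mult_carrier_mat[of _ n n _ n])
    qed (use a(1) in simp)
    then show "\<chi> (levi n (1\<^sub>m n) (dilation n j a * S * dilation n j (1 / a))) = \<chi> (levi n (1\<^sub>m n) S)" ..
  qed (simp add: nonzero mem)
  have s: "levi n (1\<^sub>m n) (dilation n l (det D)) \<in> P"
    using m d D by (simp add: levi_mem_linear[OF k] GL_one dilation_GL det_dilation[OF l])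
  have "levi n (1\<^sub>m n) D = levi n (1\<^sub>m n) S * levi n (1\<^sub>m n) (dilation n l (det D)) * levi n (1\<^sub>m n) T"
    using ST by (simp add: levi_mult mult_carrier_mat[of _ n n _ n])
  then show ?thesis
    using mult[OF siegel_mult[OF mem[OF ST(1)] s] mem[OF ST(2)]] mult[OF mem[OF ST(1)] s] triv[OF ST(1)] triv[OF ST(2)]
    by simp
qed

end

text \<open>Characters take values in a commutative group, so composition with an anti-automorphism of the
  parabolic subgroup is again a character. This transfers statements about the second diagonal block
  to the first.\<close>

lemma siegel_character_flip:
  assumes "siegel_character k n \<chi> a"
  shows "siegel_character k n (\<lambda>p. \<chi> (flip n p)) a"
proof -
  interpret siegel_character k n \<chi> a by fact
  show ?thesis
    by unfold_locales
       (use n_pos a in \<open>simp_all add: flip_mult siegel_carrier mult flip_mem_siegel nonzero\<close>)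
qed

lemma weyl_levi_dilation:
  fixes x y :: "'a::field"
  assumes l: "l \<in> I"
  shows "weyl k n I * levi n (dilation n l x) (dilation n l y) = levi n (dilation n l y) (dilation n l x) * weyl k n I"
proof -
  have F: "dilation n l z * coord_proj n (- I) = coord_proj n (- I)" for z :: 'a
    using coord_proj_complement_dilation[OF l, of n z] by (simp add: dilation_coord_proj_commute)
  show ?thesis
    by (simp add: weyl_def levi_def block_mult[of _ n] square_simps[where n = n] F coord_proj_complement_dilation[OF l]
        dilation_coord_proj_commute)
qed

definition similitude :: "group_kind \<Rightarrow> nat \<Rightarrow> 'a::field mat \<Rightarrow> 'a" where
  "similitude k n g = (THE \<mu>. transpose_mat g * form_mat k n * g = \<mu> \<cdot>\<^sub>m form_mat k n)"

lemma similitude_eqI: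
  fixes g :: "'a::field mat"
  assumes n: "n > 0" and e: "transpose_mat g * form_mat k n * g = \<mu> \<cdot>\<^sub>m form_mat k n"
  shows "similitude k n g = \<mu>"
proof -
  have "\<nu> = \<mu>" if "\<nu> \<cdot>\<^sub>m form_mat k n = \<mu> \<cdot>\<^sub>m (form_mat k n :: 'a mat)" for \<nu> \<mu> :: 'a
    using arg_cong[OF that, of "\<lambda>M. M $$ (n, 0)"] n by (simp add: form_mat_def)
  then show ?thesis unfolding similitude_def using e by (intro the_equality) auto
qed

context siegel_character
begin

text \<open>The compatibility of \<open>\<chi>\<close> with itself without which every bi-equivariant function vanishes at the
  representative.\<close>

definition supported :: "nat set \<Rightarrow> bool" where
  "supported I \<longleftrightarrow> (\<forall>p\<in>P. \<forall>p'\<in>P. weyl k n I * p = p' * weyl k n I \<longrightarrow> \<chi> p' = \<chi> p)"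

lemma supportedD:
  "supported I \<Longrightarrow> p \<in> P \<Longrightarrow> p' \<in> P \<Longrightarrow> weyl k n I * p = p' * weyl k n I \<Longrightarrow> \<chi> p' = \<chi> p"
  by (simp add: supported_def)

lemma chi_levi_dilation':
  assumes k: "\<not> has_form k" and D: "D \<in> GL_set n" and l: "l < n"
    and m: "levi n D (1\<^sub>m n) \<in> P"
  shows "\<chi> (levi n D (1\<^sub>m n)) = \<chi> (levi n (dilation n l (det D)) (1\<^sub>m n))"
proof -
  interpret F: siegel_character k n "\<lambda>p. \<chi> (flip n p)" a
    by (rule siegel_character_flip) (rule siegel_character_axioms)
  note c = GL_carrier[OF D]
  have f: "flip n (levi n (1\<^sub>m n) B) = levi n (transpose_mat B) (1\<^sub>m n)" if "B \<in> carrier_mat n n" for B :: "'a mat"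
    using that by (simp add: levi_def flip_block[of _ n])
  have f': "flip n (levi n B (1\<^sub>m n)) = levi n (1\<^sub>m n) (transpose_mat B)" if "B \<in> carrier_mat n n" for B :: "'a mat"
    using that by (simp add: levi_def flip_block[of _ n])
  have "levi n (1\<^sub>m n) (transpose_mat D) \<in> P" using flip_mem_siegel[OF m] by (simp add: f' c)
  from F.chi_levi_dilation[OF k transpose_GL[OF D] l this] show ?thesis
    using c by (simp add: f det_transpose transpose_dilation)
qed

text \<open>On the image of \<open>dual_levi\<close>, the flip inverts the determinant; so does conjugation by the
  representative, applied to a dilation at an index \<open>l \<in> I\<close>.\<close>

lemma chi_flip_dual_levi:
  assumes l: "l < n" "l \<in> I" and A: "A \<in> GL_set n"
    and supp: "supported I"
  shows "\<chi> (flip n (dual_levi n A)) = \<chi> (dual_levi n A)"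
proof -
  let ?A' = "transpose_mat (dual_mat n A)"
  have A': "?A' \<in> GL_set n" by (rule transpose_GL[OF dual_mat(1)[OF A]])
  note c = GL_carrier[OF A] GL_carrier[OF A'] GL_carrier[OF dual_mat(1)[OF A]]
  have "dual_mat n ?A' = transpose_mat A"
    by (rule dual_mat_unique[OF A']) (use c dual_mat[OF A] in simp_all)
  then have "flip n (dual_levi n A) = dual_levi n ?A'"
    using c by (simp add: dual_levi_def levi_def flip_block[of _ n])
  moreover have d: "det A \<noteq> 0" using A by (simp add: GL_iff_det)
  have "det ?A' * det A = 1"
    using dual_mat(4)[OF A] det_mult[OF c(2,1)] by simp
  then have "det ?A' = 1 / det A" using d by (simp add: field_simps)
  moreover have "\<chi> (dual_levi n (dilation n l (1 / det A))) = \<chi> (dual_levi n (dilation n l (det A)))"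
  proof (rule supportedD[OF supp])
    show "weyl k n I * dual_levi n (dilation n l (det A)) = dual_levi n (dilation n l (1 / det A)) * weyl k n I"
      using weyl_levi_dilation[OF l(2), of k n "det A" "1 / det A"] d by (simp add: dual_levi_def dual_mat_dilation)
  qed (use d in \<open>auto intro!: dual_levi_mem dilation_GL\<close>)
  ultimately show ?thesis using chi_dual_levi_dilation[OF A l(1)] chi_dual_levi_dilation[OF A' l(1)] by simp
qed

text \<open>The Levi component with blocks \<open>A\<close> and \<open>D\<close> is the product of \<open>dual_levi n A\<close> and the block diagonal
  matrix with blocks \<open>1\<close> and \<open>A\<^sup>T D\<close>. On the first factor \<open>\<chi>\<close> and its flip agree, so they can differ
  only on the second.\<close>

lemma chi_flip_factor:
  assumes l: "l < n" "l \<in> I"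
    and supp: "supported I"
    and A: "A \<in> GL_set n" and B: "B \<in> carrier_mat n n" and D: "D \<in> GL_set n"
    and p: "four_block_mat A B (0\<^sub>m n n) D \<in> P"
  defines "D' \<equiv> transpose_mat A * D"
  shows "levi n (1\<^sub>m n) D' \<in> P" "levi n (transpose_mat D') (1\<^sub>m n) \<in> P"
    and "\<chi> (four_block_mat A B (0\<^sub>m n n) D) = \<chi> (dual_levi n A) * \<chi> (levi n (1\<^sub>m n) D')"
    and "\<chi> (flip n (four_block_mat A B (0\<^sub>m n n) D)) =
      \<chi> (dual_levi n A) * \<chi> (levi n (transpose_mat D') (1\<^sub>m n))"
proof -
  interpret F: siegel_character k n "\<lambda>p. \<chi> (flip n p)" a
    by (rule siegel_character_flip) (rule siegel_character_axioms)
  note c = GL_carrier[OF A] B GL_carrier[OF D] GL_carrier[OF dual_mat(1)[OF A]]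
  note sq = square_simps[where n = n]
  have D': "D' \<in> carrier_mat n n" using c by (simp add: D'_def sq)
  have lA: "dual_levi n A \<in> P" by (rule dual_levi_mem[OF A])
  have e: "levi n A D = dual_levi n A * levi n (1\<^sub>m n) D'"
  proof -
    have "dual_mat n A * D' = (dual_mat n A * transpose_mat A) * D"
      using c by (simp add: D'_def sq)
    then show ?thesis using c D' dual_mat(3)[OF A] by (simp add: dual_levi_def levi_mult)
  qed
  obtain r where r: "r \<in> P" "r * dual_levi n A = 1\<^sub>m (2 * n)" using siegel_inverse[OF lA] by metis
  have lD': "levi n (1\<^sub>m n) D' \<in> carrier_mat (2 * n) (2 * n)" using D' by (simp add: levi_def)
  have "r * levi n A D = (r * dual_levi n A) * levi n (1\<^sub>m n) D'"
    unfolding e using lD' siegel_carrier[OF r(1)] siegel_carrier[OF lA] by (simp add: square_simps[where n = "2 * n"])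
  then have "r * levi n A D = levi n (1\<^sub>m n) D'" unfolding r(2) using lD' by simp
  then show m: "levi n (1\<^sub>m n) D' \<in> P"
    using siegel_mult[OF r(1) siegel_levi_part[OF c(1-3) p]] by simp
  have f: "flip n (levi n (1\<^sub>m n) D') = levi n (transpose_mat D') (1\<^sub>m n)"
    using D' by (simp add: levi_def flip_block[of _ n])
  show "levi n (transpose_mat D') (1\<^sub>m n) \<in> P" using flip_mem_siegel[OF m] by (simp add: f)
  have fA: "\<chi> (flip n (dual_levi n A)) = \<chi> (dual_levi n A)"
    by (rule chi_flip_dual_levi[OF l A supp])
  show "\<chi> (four_block_mat A B (0\<^sub>m n n) D) = \<chi> (dual_levi n A) * \<chi> (levi n (1\<^sub>m n) D')"
    unfolding chi_levi_part[OF A B D p] e by (rule mult[OF lA m])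
  show "\<chi> (flip n (four_block_mat A B (0\<^sub>m n n) D)) = \<chi> (dual_levi n A) * \<chi> (levi n (transpose_mat D') (1\<^sub>m n))"
    unfolding F.chi_levi_part[OF A B D p] e F.mult[OF lA m] f fA ..
qed

text \<open>By \<open>chi_flip_factor\<close> only block diagonal matrices with blocks \<open>1\<close> and \<open>D'\<close> matter. In the linear
  groups \<open>D'\<close> may be replaced by a dilation at \<open>l\<close>, on which the flip agrees with conjugation by the
  representative, so no twist arises. In the groups with a form \<open>D'\<close> is the multiplier times the
  identity, so the twist is the function \<open>\<eta>\<close> of the multiplier.\<close>

lemma exists_twist:
  assumes l: "l < n" "l \<in> I"
    and supp: "supported I"
  shows "\<exists>\<psi>. (\<forall>g\<in>classical_set k n. \<forall>h\<in>classical_set k n. \<psi> (g * h) = \<psi> g * \<psi> h) \<and> (\<forall>J. \<psi> (weyl k n J) = 1) \<and>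
        (\<forall>p\<in>P. \<chi> (flip n p) * \<psi> p = \<chi> p)"
proof (cases "has_form k")
  case False
  have "\<chi> (flip n p) = \<chi> p" if p: "p \<in> P" for p
  proof -
    obtain A B D where p': "A \<in> GL_set n" "B \<in> carrier_mat n n" "D \<in> GL_set n" "p = four_block_mat A B (0\<^sub>m n n) D"
      using siegel_parabolic_cases[OF p] .
    define D' where "D' = transpose_mat A * D"
    note f = chi_flip_factor[OF l supp p'(1-3) p[unfolded p'(4)], folded D'_def p'(4)]
    have D': "D' \<in> GL_set n" unfolding D'_def by (rule GL_mult[OF transpose_GL[OF p'(1)] p'(3)])
    note c = GL_carrier[OF D'] and tD' = transpose_GL[OF D']
    have "det D' \<noteq> 0" using D' by (simp add: GL_iff_det)
    then have S: "dilation n l (det D') \<in> GL_set n" by (rule dilation_GL)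
    have "k = KSL \<longrightarrow> det D' = 1" using f(1) levi_mem_linear[OF False GL_one D'] by simp
    then have s: "levi n (1\<^sub>m n) (dilation n l (det D')) \<in> P" "levi n (dilation n l (det D')) (1\<^sub>m n) \<in> P"
      unfolding levi_mem_linear[OF False GL_one S] levi_mem_linear[OF False S GL_one] det_dilation[OF l(1)] by simp_all
    have "\<chi> (levi n (dilation n l (det D')) (1\<^sub>m n)) = \<chi> (levi n (1\<^sub>m n) (dilation n l (det D')))"
      using supportedD[OF supp s] weyl_levi_dilation[OF l(2), of k n 1 "det D'"] by (simp add: dilation_one)
    then show ?thesis
      using f(3,4) chi_levi_dilation[OF False D' l(1) f(1)] chi_levi_dilation'[OF False tD' l(1) f(2)] c
      by (simp add: det_transpose)
  qed
  then show ?thesis by (intro exI[of _ "\<lambda>_. 1"]) auto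
next
  case True
  define \<eta> where "\<eta> \<mu> = \<chi> (levi n (1\<^sub>m n) (\<mu> \<cdot>\<^sub>m 1\<^sub>m n)) / \<chi> (levi n (\<mu> \<cdot>\<^sub>m 1\<^sub>m n) (1\<^sub>m n))" for \<mu>
  define M where "M = {\<mu> :: 'a. \<mu> \<noteq> 0 \<and> (k \<in> {KO, KSp} \<longrightarrow> \<mu> = 1)}"
  have M: "levi n (1\<^sub>m n) (\<mu> \<cdot>\<^sub>m 1\<^sub>m n) \<in> P" "levi n (\<mu> \<cdot>\<^sub>m 1\<^sub>m n) (1\<^sub>m n) \<in> P" if \<mu>: "\<mu> \<in> M" for \<mu>
  proof -
    have GL: "\<mu> \<cdot>\<^sub>m 1\<^sub>m n \<in> GL_set n" using \<mu> by (simp add: GL_iff_det M_def)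
    have m: "levi n A D \<in> P" if "A \<in> GL_set n" "D \<in> GL_set n" "transpose_mat A * D = \<mu> \<cdot>\<^sub>m 1\<^sub>m n" "transpose_mat D * A = \<mu> \<cdot>\<^sub>m 1\<^sub>m n" for A D :: "'a mat"
    proof -
      note c = GL_carrier[OF that(1)] GL_carrier[OF that(2)]
      have "transpose_mat (levi n A D) * form_mat k n * levi n A D = \<mu> \<cdot>\<^sub>m form_mat k n"
        unfolding levi_def using c that
        by (subst form_mat_block_iff[of _ n]) (simp_all add: square_simps[where n = n] smult_zero_mat smult_smult_mat mult.commute)
      moreover have "levi n A D \<in> GL_set (2 * n)"
        unfolding levi_def using block_triangular_GL[OF c(1) zero_carrier_mat c(2)] that by simp
      ultimately have "levi n A D \<in> classical_set k n"
        unfolding mem_classical_form[OF True] using \<mu> by (auto simp: M_def)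
      then show ?thesis
        unfolding levi_def siegel_parabolic_block_iff[OF c(1) zero_carrier_mat zero_carrier_mat c(2)] by simp
    qed
    show "levi n (1\<^sub>m n) (\<mu> \<cdot>\<^sub>m 1\<^sub>m n) \<in> P" "levi n (\<mu> \<cdot>\<^sub>m 1\<^sub>m n) (1\<^sub>m n) \<in> P"
      by (intro m GL GL_one; simp add: transpose_smult_mat square_simps[where n = n])+
  qed
  have sim: "similitude k n g \<in> M \<and> transpose_mat g * form_mat k n * g = similitude k n g \<cdot>\<^sub>m form_mat k n"
    if g: "g \<in> classical_set k n" for g :: "'a mat"
  proof -
    obtain \<mu> where "\<mu> \<in> M" "transpose_mat g * form_mat k n * g = \<mu> \<cdot>\<^sub>m form_mat k n"
      using g unfolding mem_classical_form[OF True] M_def by blast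
    then show ?thesis using similitude_eqI[OF n_pos] by metis
  qed
  have \<eta>_mult: "\<eta> (\<mu> * \<nu>) = \<eta> \<mu> * \<eta> \<nu>" if "\<mu> \<in> M" "\<nu> \<in> M" for \<mu> \<nu>
  proof -
    have "levi n (1\<^sub>m n) ((\<mu> * \<nu>) \<cdot>\<^sub>m 1\<^sub>m n) = levi n (1\<^sub>m n) (\<mu> \<cdot>\<^sub>m 1\<^sub>m n) * levi n (1\<^sub>m n) (\<nu> \<cdot>\<^sub>m 1\<^sub>m n)"
         "levi n ((\<mu> * \<nu>) \<cdot>\<^sub>m 1\<^sub>m n) (1\<^sub>m n) = levi n (\<mu> \<cdot>\<^sub>m 1\<^sub>m n) (1\<^sub>m n) * levi n (\<nu> \<cdot>\<^sub>m 1\<^sub>m n) (1\<^sub>m n)"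
      by (simp_all add: levi_mult square_simps[where n = n] smult_smult_mat mult.commute)
    then show ?thesis unfolding \<eta>_def using mult M[OF that(1)] M[OF that(2)] by simp
  qed
  define \<psi> where "\<psi> g = \<eta> (similitude k n g)" for g
  have "\<psi> (g * h) = \<psi> g * \<psi> h" if "g \<in> classical_set k n" "h \<in> classical_set k n" for g h
  proof -
    have "similitude k n (g * h) = similitude k n g * similitude k n h"
      by (rule similitude_eqI[OF n_pos similitude_mult[OF form_mat_carrier]])
         (use that sim classical_set_carrier in auto)
    then show ?thesis using \<eta>_mult sim that by (simp add: \<psi>_def)
  qed
  moreover have "\<psi> (weyl k n J) = 1" for J
  proof -
    have "similitude k n (weyl k n J :: 'a mat) = 1" by (rule similitude_eqI[OF n_pos weyl_form])
    moreover have "1 \<in> M" by (simp add: M_def)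
    ultimately show ?thesis using nonzero[OF M(1)[of 1]] by (simp add: \<psi>_def \<eta>_def)
  qed
  moreover have "\<chi> (flip n p) * \<psi> p = \<chi> p" if p: "p \<in> P" for p
  proof -
    obtain A B D where p': "A \<in> GL_set n" "B \<in> carrier_mat n n" "D \<in> GL_set n" "p = four_block_mat A B (0\<^sub>m n n) D"
      using siegel_parabolic_cases[OF p] .
    note c = GL_carrier[OF p'(1)] p'(2) GL_carrier[OF p'(3)] GL_carrier[OF dual_mat(1)[OF p'(1)]]
    define \<mu> where "\<mu> = similitude k n p"
    have \<mu>: "\<mu> \<in> M" "transpose_mat p * form_mat k n * p = \<mu> \<cdot>\<^sub>m form_mat k n"
      using sim[of p] p siegel_subset by (auto simp: \<mu>_def)
    from \<mu>(2)[unfolded p'(4) form_mat_block_iff[OF c(1,2) zero_carrier_mat c(3)]]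
    have "transpose_mat D * A = \<mu> \<cdot>\<^sub>m 1\<^sub>m n"
      using c by (simp add: square_simps[where n = n] smult_zero_mat)
    from arg_cong[OF this, of transpose_mat] have AD: "transpose_mat A * D = \<mu> \<cdot>\<^sub>m 1\<^sub>m n"
      using c by (simp add: square_simps[where n = n] transpose_smult_mat)
    have "transpose_mat (\<mu> \<cdot>\<^sub>m 1\<^sub>m n) = \<mu> \<cdot>\<^sub>m (1\<^sub>m n :: 'a mat)" by (simp add: transpose_smult_mat)
    note f = chi_flip_factor(3,4)[OF l supp p'(1-3) p[unfolded p'(4)], folded p'(4), unfolded AD this]
    show ?thesis
      using f nonzero[OF M(2)[OF \<mu>(1)]] by (simp add: \<psi>_def \<eta>_def \<mu>_def[symmetric])
  qed
  ultimately show ?thesis by (intro exI[of _ \<psi>]) blast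
qed

end

theorem proposition2p3p6:
  fixes q n :: nat
    and k :: group_kind
    and G :: "'a::{field, finite} mat monoid"
    and P :: "'a mat set"
    and \<chi> :: "'a mat \<Rightarrow> complex"
  assumes "CARD('a) = q" and "primepow q" and "odd q" and "\<not> 3 dvd q"
    and "n \<ge> 1"
    and "G = classical_group k n"
    and "P = siegel_parabolic k n"
    and "\<chi> \<in> hom (G\<lparr>carrier := P\<rparr>) complex_units"
  shows "multiplicity_free G fun_scale (induced_space G P \<chi>) (right_translation G)"
proof -
  obtain a :: 'a where a: "a \<noteq> 0" "a\<^sup>2 \<noteq> 1"
    using exists_nontrivial_square assms(1,3,4) by metis
  have G: "carrier G = classical_set k n" "\<And>x y. x \<otimes>\<^bsub>G\<^esub> y = x * y"
    using assms(6) by (simp_all add: classical_group_def)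
  interpret group G using assms(6) group_classical_group by simp
  have "finite (carrier G)"
    unfolding G by (rule finite_subset[OF _ finite_carrier_mat[of "2 * n" "2 * n"]]) (auto dest: classical_set_carrier)
  moreover have "subgroup P G" using subgroup_siegel assms(6,7) by simp
  ultimately interpret I: induced_character G P \<chi>
    by (intro induced_character.intro induced_character_axioms.intro is_group assms(8))
  interpret S: siegel_character k n \<chi> a
    by unfold_locales (use assms(5,7) a I.\<chi>_mult I.\<chi>_nonzero in \<open>auto simp: G\<close>)
  show ?thesis
  proof (rule I.multiplicity_free_induced[where \<tau> = "flip n" and W = "range (weyl k n)"], unfold G assms(7))
    fix g :: "'a mat" assume g: "g \<in> classical_set k n"
    show "flip n g \<in> classical_set k n" by (rule flip_mem_classical[OF g])
    show "flip n (flip n g) = g" by (rule flip_flip[OF classical_set_carrier[OF g]])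
    show "flip n (g * h) = flip n h * flip n g" if "h \<in> classical_set k n" for h
      by (rule flip_mult[OF classical_set_carrier[OF g] classical_set_carrier[OF that]])
    show "\<exists>p\<in>siegel_parabolic k n. \<exists>w\<in>range (weyl k n). \<exists>p'\<in>siegel_parabolic k n. g = p * w * p'"
      using siegel_double_cosets[OF g] assms(5) by auto
  next
    fix w :: "'a mat" assume w: "w \<in> range (weyl k n)" "w \<notin> siegel_parabolic k n"
      and supp: "\<And>p p'. p \<in> siegel_parabolic k n \<Longrightarrow> p' \<in> siegel_parabolic k n \<Longrightarrow> w * p = p' * w \<Longrightarrow> \<chi> p' = \<chi> p"
    obtain I where I: "w = weyl k n I" using w by blast
    have "\<exists>l<n. l \<in> I"
    proof (rule ccontr)
      assume "\<not> (\<exists>l<n. l \<in> I)"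
      then have "coord_proj n I = (0\<^sub>m n n :: 'a mat)" by (auto simp: coord_proj_def)
      moreover have "weyl k n I \<in> (classical_set k n :: 'a mat set)" by (rule weyl_mem)
      ultimately have "weyl k n I \<in> (siegel_parabolic k n :: 'a mat set)"
        unfolding weyl_def by (subst siegel_parabolic_block_iff[of _ n]) simp_all
      then show False using w I by simp
    qed
    then obtain l where l: "l < n" "l \<in> I" by blast
    show "\<exists>\<psi>. (\<forall>g\<in>classical_set k n. \<forall>h\<in>classical_set k n. \<psi> (g * h) = \<psi> g * \<psi> h) \<and>
      (\<forall>w\<in>range (weyl k n). \<psi> w = 1) \<and> (\<forall>p\<in>siegel_parabolic k n. \<chi> (flip n p) * \<psi> p = \<chi> p)"
      using S.exists_twist[OF l] supp I by (auto simp: S.supported_def)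
  qed (auto simp: flip_mem_siegel weyl_mem flip_weyl)
qed

end
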